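(* Let $(p_k\mid k\geqslant 3,\ k\ne 6)$ be a sequence of nonnegative integers with $p_3=0$ satisfying $$3p_3+2p_4+p_5=12+\sum_{k\geqslant 7}(k-6)p_k.$$ Then there exists a value of $p_6$ and a flag simple $3$-polytope $P^3$ such that $p_k=p_k(P^3)$ for all $k\geqslant 3$.
   Context: For a $3$-polytope $P$, $p_k(P)$ denotes the number of its $2$-dimensional faces (facets) that are $k$-gons. A $3$-polytope is simple if every vertex lies in exactly $3$ facets. A simple polytope is flag if every set of pairwise intersecting facets has nonempty common intersection. *)

theory Defs
  imports "HOL-Analysis.Analysis"
begin

definition polytope3 :: "(real^3) set \<Rightarrow> bool" where
  "polytope3 P \<longleftrightarrow> polytope P \<and> aff_dim P = 3"

definition pk :: "(real^3) set \<Rightarrow> nat \<Rightarrow> nat" where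
  "pk P k = card {F. F facet_of P \<and> card {v. v extreme_point_of F} = k}"

definition simple_polytope3 :: "(real^3) set \<Rightarrow> bool" where
  "simple_polytope3 P \<longleftrightarrow>
     (\<forall>v. v extreme_point_of P \<longrightarrow> card {F. F facet_of P \<and> v \<in> F} = 3)"

definition flag_polytope3 :: "(real^3) set \<Rightarrow> bool" where
  "flag_polytope3 P \<longleftrightarrow>
     (\<forall>S. S \<subseteq> {F. F facet_of P} \<and> (\<forall>F\<in>S. \<forall>G\<in>S. F \<inter> G \<noteq> {}) \<longrightarrow> \<Inter>S \<noteq> {})"

end

theory Submission
  imports Defs
begin

text \<open>
  A facet \<open>F\<close> of a simple polytope can be split along a chord by rotating its plane slightly about
  the line through the midpoints of two of its edges. If the neighbours of \<open>F\<close>, in cyclic order, have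
  sizes \<open>a, w\<^sub>1, \<dots>, w\<^sub>m, b, \<dots>\<close>, then after the split they have sizes \<open>a + 1, m + 3, b + 1, \<dots>\<close>, and the
  facets \<open>w\<^sub>1, \<dots>, w\<^sub>m\<close> keep their sizes but are separated from \<open>F\<close>. Starting from the simplex, this turns
  the problem into a rewriting problem on cyclic words: fans create the large faces, rows and rings of
  hexagons transport the word to a tube \<open>5\<^sup>n\<close> while the required quadrangles and pentagons are closed,
  and a tube whose length has the right residue modulo 3 is closed by a triangular cap each of whose
  corners is a quadrangle or a pair of pentagons.

  Cutting off all edges of the resulting polytope at the same depth (chamfering) replaces every edge by
  a hexagon and keeps the sizes of the old facets. As there are no triangles, the chamfered polytope
  is flag.
\<close>

section \<open>Systems of affine inequalities\<close>

text \<open>Every rewriting step is an actual cut of a convex region, so the bookkeeping with words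
  never loses the polytope. Hexagons cost nothing, as their number is free. Giving a k-gon the
  curvature 6 - k, the total is 12: the part built from fans carries 6, and the cap carries 6 in
  three corners of 2 each. The tube between them may have any length, but the threefold shape of the
  cap fixes the length modulo 3. Each spare hexagon placed among the fans adds two letters, which
  reaches every residue. The exception is the case without pentagons and with all large facets even:
  there the letters 4 are all merged in pairs, also across the spare hexagons, each of which then
  adds three letters; but then the residue is right by itself. Chamfering is needed because
  splitting may create three pairwise adjacent facets without a common vertex. Two of the new
  hexagons meet only if their edges share an end, which excludes such triples, except around a
  triangle.\<close>

definition aff :: "(real^3) \<times> real \<Rightarrow> real^3 \<Rightarrow> real" where
  "aff a x = fst a \<bullet> x + snd a"

definition region :: "'i set \<Rightarrow> ('i \<Rightarrow> (real^3) \<times> real) \<Rightarrow> (real^3) set" where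
  "region I c = {x. \<forall>i\<in>I. 0 \<le> aff (c i) x}"

definition tight :: "'i set \<Rightarrow> ('i \<Rightarrow> (real^3) \<times> real) \<Rightarrow> real^3 \<Rightarrow> 'i set" where
  "tight I c x = {i\<in>I. aff (c i) x = 0}"

text \<open>The normals of the constraints in \<open>t\<close> span the space. For the constraints
  that are tight at a point of the region, this says that the point is a vertex.\<close>

definition rigid :: "'i set \<Rightarrow> ('i \<Rightarrow> (real^3) \<times> real) \<Rightarrow> bool" where
  "rigid t c \<longleftrightarrow> (\<forall>d. (\<forall>i\<in>t. fst (c i) \<bullet> d = 0) \<longrightarrow> d = 0)"

lemma rigidD: "rigid t c \<Longrightarrow> (\<And>i. i \<in> t \<Longrightarrow> fst (c i) \<bullet> d = 0) \<Longrightarrow> d = 0"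
  unfolding rigid_def by blast

lemma rigidI: "(\<And>d. (\<And>i. i \<in> t \<Longrightarrow> fst (c i) \<bullet> d = 0) \<Longrightarrow> d = 0) \<Longrightarrow> rigid t c"
  unfolding rigid_def by blast

lemma aff_add_scaleR: "aff a (x + s *\<^sub>R d) = aff a x + s * (fst a \<bullet> d)"
  by (simp add: aff_def algebra_simps)

lemma aff_diff: "aff a y - aff a x = fst a \<bullet> (y - x)"
  by (simp add: aff_def algebra_simps)

lemma aff_convex: "aff a ((1 - u) *\<^sub>R x + u *\<^sub>R y) = (1 - u) * aff a x + u * aff a y"
  by (simp add: aff_def algebra_simps)

text \<open>Pairs form a vector space that acts pointwise on functions. This is the reason for the
  encoding: the tilted plane of a split and the planes of the chamfering are linear combinations of
  pairs.\<close>

lemma aff_plus: "aff (a + b) x = aff a x + aff b x"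
  by (simp add: aff_def algebra_simps)

lemma aff_scaleR: "aff (r *\<^sub>R a) x = r * aff a x"
  by (simp add: aff_def algebra_simps)

lemma aff_minus: "aff (a - b) x = aff a x - aff b x"
  by (simp add: aff_def algebra_simps)

lemma continuous_aff: "continuous_on S (aff a)"
  unfolding aff_def by (intro continuous_intros)

lemma closed_region: "closed (region I c)"
proof -
  have "region I c = (\<Inter>i\<in>I. {x. 0 \<le> aff (c i) x})"
    by (auto simp: region_def)
  then show ?thesis
    by (auto intro!: closed_INT closed_Collect_le continuous_aff)
qed

lemma convex_region: "convex (region I c)"
proof -
  have "convex {x. 0 \<le> aff (c i) x}" for i
  proof -
    have "{x. 0 \<le> aff (c i) x} = {x. fst (c i) \<bullet> x \<ge> - snd (c i)}"
      by (auto simp: aff_def)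
    then show ?thesis using convex_halfspace_ge[of "- snd (c i)" "fst (c i)"] by simp
  qed
  moreover have "region I c = (\<Inter>i\<in>I. {x. 0 \<le> aff (c i) x})"
    by (auto simp: region_def)
  ultimately show ?thesis by (auto intro: convex_INT)
qed

lemma tight_between:
  assumes "x \<in> region I c" "y \<in> region I c" "0 < u" "u < 1"
  shows "(1 - u) *\<^sub>R x + u *\<^sub>R y \<in> region I c"
    and "tight I c ((1 - u) *\<^sub>R x + u *\<^sub>R y) = tight I c x \<inter> tight I c y"
proof -
  show "(1 - u) *\<^sub>R x + u *\<^sub>R y \<in> region I c"
    using assms convexD[OF convex_region assms(1,2), of "1-u" u] by simp
  have "(1 - u) * p + u * q = 0 \<longleftrightarrow> p = 0 \<and> q = 0" if "0 \<le> p" "0 \<le> q" for p q :: real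
    using that assms(3,4) by (simp add: add_nonneg_eq_0_iff)
  then show "tight I c ((1 - u) *\<^sub>R x + u *\<^sub>R y) = tight I c x \<inter> tight I c y"
    using assms(1,2) by (auto simp: tight_def region_def aff_convex)
qed

lemma rigid_card_ge:
  assumes "finite t" "rigid t c"
  shows "3 \<le> card t"
proof (rule ccontr)
  assume "\<not> 3 \<le> card t"
  let ?S = "(fst \<circ> c) ` t"
  have "dim ?S \<le> card ?S" using assms by (intro dim_le_card') auto
  also have "\<dots> \<le> card t" using assms by (intro card_image_le)
  finally have "dim ?S < DIM(real^3)" using \<open>\<not> 3 \<le> card t\<close> by simp
  then obtain d where "d \<noteq> 0" "\<And>y. y \<in> span ?S \<Longrightarrow> orthogonal d y"
    using orthogonal_to_subspace_exists by blast
  then have "fst (c i) \<bullet> d = 0" if "i \<in> t" for i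
    using that by (metis comp_apply imageI orthogonal_def inner_commute span_base)
  with \<open>d \<noteq> 0\<close> show False using rigidD[OF assms(2)] by blast
qed

text \<open>Three normals with trivial common kernel define an injective, hence surjective, linear
  map. At a simple vertex the three slopes of a direction can thus be prescribed freely.\<close>

lemma rigid_solve:
  assumes "card t = 3" "rigid t c"
  shows "\<exists>d. \<forall>i\<in>t. fst (c i) \<bullet> d = g i"
proof -
  from assms(1) obtain i j k where t: "t = {i,j,k}" "i \<noteq> j" "i \<noteq> k" "j \<noteq> k"
    by (auto simp: card_3_iff)
  define L :: "real^3 \<Rightarrow> real^3" where
    "L d = vector [fst (c i) \<bullet> d, fst (c j) \<bullet> d, fst (c k) \<bullet> d]" for d
  have lin: "linear L"
    by (rule linearI) (simp_all add: L_def vec_eq_iff forall_3 algebra_simps)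
  moreover have "inj L"
    unfolding linear_injective_0[OF lin]
    using rigidD[OF assms(2)] by (auto simp: L_def vec_eq_iff forall_3 t)
  ultimately have "surj L" using linear_inj_imp_surj by blast
  then obtain d where "L d = vector [g i, g j, g k]" by (metis surjD)
  then show ?thesis
    by (intro exI[of _ d]) (auto simp: L_def vec_eq_iff forall_3 t)
qed

text \<open>The ratio test of linear programming: on a bounded region some constraint decreases
  along the ray, and \<open>s\<close> is the least parameter at which a decreasing constraint
  reaches zero.\<close>

lemma region_exit:
  assumes "finite I" "bounded (region I c)" "x \<in> region I c" "d \<noteq> 0"
  obtains s i where "0 \<le> s" "x + s *\<^sub>R d \<in> region I c" "i \<in> I" "fst (c i) \<bullet> d < 0"
    "aff (c i) (x + s *\<^sub>R d) = 0"
proof -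
  define J where "J = {i\<in>I. fst (c i) \<bullet> d < 0}"
  have finJ: "finite J" using assms(1) by (simp add: J_def)
  have neJ: "J \<noteq> {}"
  proof
    assume "J = {}"
    then have nn: "0 \<le> fst (c i) \<bullet> d" if "i \<in> I" for i
      using that by (force simp: J_def)
    have ray: "x + s *\<^sub>R d \<in> region I c" if "0 \<le> s" for s
      using assms(3) nn that by (auto simp: region_def aff_add_scaleR)
    obtain B where B: "\<And>y. y \<in> region I c \<Longrightarrow> norm y \<le> B"
      using assms(2) bounded_iff by blast
    define s where "s = (B + norm x + 1) / norm d"
    have "0 \<le> B" using B[OF assms(3)] norm_ge_zero order_trans by blast
    then have s: "0 \<le> s" by (simp add: s_def)
    have "norm (s *\<^sub>R d) = B + norm x + 1"
      using assms(4) s \<open>0 \<le> B\<close> by (simp add: s_def)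
    moreover have "norm (s *\<^sub>R d) \<le> norm (x + s *\<^sub>R d) + norm x"
      by (metis add_diff_cancel_left' norm_triangle_ineq4)
    ultimately show False using B[OF ray[OF s]] by simp
  qed
  define r where "r i = aff (c i) x / - (fst (c i) \<bullet> d)" for i
  define s where "s = Min (r ` J)"
  have "s \<in> r ` J" unfolding s_def using finJ neJ by (intro Min_in) auto
  then obtain i where i: "i \<in> J" "s = r i" by blast
  have le: "s \<le> r j" if "j \<in> J" for j using that finJ by (simp add: s_def)
  have s0: "0 \<le> s"
    using i assms(3) by (auto simp: r_def J_def region_def intro!: divide_nonneg_neg)
  have "x + s *\<^sub>R d \<in> region I c"
    unfolding region_def
  proof (rule CollectI, rule ballI)
    fix j assume j: "j \<in> I"
    show "0 \<le> aff (c j) (x + s *\<^sub>R d)"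
    proof (cases "fst (c j) \<bullet> d < 0")
      case True
      then have "s \<le> r j" using j le by (simp add: J_def)
      then have "s * - (fst (c j) \<bullet> d) \<le> aff (c j) x"
        using True by (simp add: r_def field_simps)
      then show ?thesis by (simp add: aff_add_scaleR)
    next
      case False
      then show ?thesis using s0 j assms(3) by (auto simp: aff_add_scaleR region_def)
    qed
  qed
  moreover have "aff (c i) (x + s *\<^sub>R d) = 0"
    using i by (simp add: aff_add_scaleR r_def J_def field_simps)
  ultimately show thesis using that[of s i] s0 i(1) by (simp add: J_def)
qed

text \<open>A direction orthogonal to all tight normals keeps these constraints tight, and following
  it to the boundary makes a further one tight. So every face contains a vertex.\<close>

lemma tight_face:
  assumes "finite I" "bounded (region I c)" "x \<in> region I c"
  shows "\<exists>y\<in>region I c. tight I c x \<subseteq> tight I c y \<and> rigid (tight I c y) c"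
  using assms(3)
proof (induction "card I - card (tight I c x)" arbitrary: x rule: less_induct)
  case less
  show ?case
  proof (cases "rigid (tight I c x) c")
    case True
    then show ?thesis using less.prems by blast
  next
    case False
    then obtain d where d: "d \<noteq> 0" "\<And>i. i \<in> tight I c x \<Longrightarrow> fst (c i) \<bullet> d = 0"
      unfolding rigid_def by blast
    obtain s i where s: "0 \<le> s" "x + s *\<^sub>R d \<in> region I c" "i \<in> I" "fst (c i) \<bullet> d < 0"
      "aff (c i) (x + s *\<^sub>R d) = 0"
      using region_exit[OF assms(1,2) less.prems d(1)] .
    let ?y = "x + s *\<^sub>R d"
    have sub: "tight I c x \<subseteq> tight I c ?y"
      using d(2) by (auto simp: tight_def aff_add_scaleR)
    have "i \<in> tight I c ?y" "i \<notin> tight I c x" using s d(2) by (auto simp: tight_def)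
    then have "tight I c x \<subset> tight I c ?y" using sub by blast
    moreover have fin: "finite (tight I c ?y)" using assms(1) by (simp add: tight_def)
    ultimately have "card (tight I c x) < card (tight I c ?y)" by (simp add: psubset_card_mono)
    moreover have "card (tight I c ?y) \<le> card I"
      using assms(1) by (intro card_mono) (auto simp: tight_def)
    ultimately have "card I - card (tight I c ?y) < card I - card (tight I c x)" by linarith
    from less.hyps[OF this s(2)] show ?thesis using sub by blast
  qed
qed

section \<open>Simple systems\<close>

text \<open>A simple polytope with facets indexed by \<open>I\<close>. A vertex is identified with
  the triple of facets through it, so \<open>T\<close> holds the combinatorial structure;
  \<open>cover\<close> ensures that each inequality really defines a facet.\<close>

locale simple_system =
  fixes I :: "'i set" and c :: "'i \<Rightarrow> (real^3) \<times> real" and T :: "'i set set"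
  assumes finite_I: "finite I"
    and bounded_reg: "bounded (region I c)"
    and simple: "\<And>x. x \<in> region I c \<Longrightarrow> rigid (tight I c x) c \<Longrightarrow> card (tight I c x) = 3"
    and T_eq: "T = tight I c ` {x \<in> region I c. rigid (tight I c x) c}"
    and T_nonempty: "T \<noteq> {}"
    and cover: "I \<subseteq> \<Union>T"
begin

definition vertex :: "'i set \<Rightarrow> real^3" where
  "vertex t = (SOME x. x \<in> region I c \<and> tight I c x = t)"

lemma T_I:
  assumes "x \<in> region I c" "rigid (tight I c x) c"
  shows "tight I c x \<in> T"
  using assms T_eq by blast

lemma
  assumes "t \<in> T"
  shows vertex_in: "vertex t \<in> region I c" and tight_vertex: "tight I c (vertex t) = t"
    and T_rigid: "rigid t c" and T_card: "card t = 3" and T_sub: "t \<subseteq> I" and T_finite: "finite t"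
proof -
  obtain x where x: "x \<in> region I c" "tight I c x = t" "rigid t c"
    using assms T_eq by auto
  then have "\<exists>x. x \<in> region I c \<and> tight I c x = t" by blast
  from someI_ex[OF this] show "vertex t \<in> region I c" "tight I c (vertex t) = t"
    by (simp_all add: vertex_def)
  show "rigid t c" "card t = 3" "t \<subseteq> I" using x simple by (auto simp: tight_def)
  then show "finite t" using finite_I finite_subset by blast
qed

lemma aff_vertex_eq_0_iff: "t \<in> T \<Longrightarrow> i \<in> I \<Longrightarrow> aff (c i) (vertex t) = 0 \<longleftrightarrow> i \<in> t"
  using tight_vertex[of t] by (auto simp: tight_def)

lemma aff_vertex_nonneg: "t \<in> T \<Longrightarrow> i \<in> I \<Longrightarrow> 0 \<le> aff (c i) (vertex t)"
  using vertex_in[of t] by (auto simp: region_def)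

lemma aff_vertex_pos: "t \<in> T \<Longrightarrow> i \<in> I \<Longrightarrow> i \<notin> t \<Longrightarrow> 0 < aff (c i) (vertex t)"
  using aff_vertex_nonneg[of t i] aff_vertex_eq_0_iff[of t i] by linarith

lemma finite_T: "finite T"
  using finite_I T_sub by (meson Pow_iff finite_Pow_iff finite_subset subsetI)

lemma eq_vertexI:
  assumes "t \<in> T" "\<And>i. i \<in> t \<Longrightarrow> aff (c i) x = 0"
  shows "x = vertex t"
proof -
  have "fst (c i) \<bullet> (x - vertex t) = 0" if "i \<in> t" for i
  proof -
    have "aff (c i) x = 0" "aff (c i) (vertex t) = 0"
      using assms that T_sub aff_vertex_eq_0_iff by blast+
    then show ?thesis using aff_diff[of "c i" x "vertex t"] by simp
  qed
  then show ?thesis using rigidD[OF T_rigid[OF assms(1)]] by force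
qed

lemma vertex_inj: "t \<in> T \<Longrightarrow> t' \<in> T \<Longrightarrow> vertex t = vertex t' \<Longrightarrow> t = t'"
  by (metis tight_vertex)

lemma vertex_solve: "t \<in> T \<Longrightarrow> \<exists>d. \<forall>i\<in>t. fst (c i) \<bullet> d = g i"
  by (intro rigid_solve T_card T_rigid)

lemma tight_subset_T: "x \<in> region I c \<Longrightarrow> \<exists>t\<in>T. tight I c x \<subseteq> t"
  using tight_face[OF finite_I bounded_reg] T_I by blast

lemma card_inter_lt:
  assumes "t \<in> T" "t' \<in> T" "t \<noteq> t'"
  shows "card (t \<inter> t') \<le> 2"
proof -
  have "t \<inter> t' \<noteq> t"
    using assms T_card T_finite by (metis card_subset_eq inf.cobounded2)
  then have "card (t \<inter> t') < card t"
    using T_finite[OF assms(1)] by (intro psubset_card_mono) auto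
  then show ?thesis using T_card[OF assms(1)] by simp
qed

text \<open>Releasing \<open>k\<close> at the vertex leaves a direction \<open>d\<close> along which
  \<open>k\<close> grows at unit rate and the other two constraints stay tight; the exit point is
  the other end. Of two further vertices on this ray, the nearer would lie strictly between
  \<open>t\<close> and the farther one, so its triple would be the intersection of two distinct
  triples and too small.\<close>

lemma edge_other:
  assumes t: "t \<in> T" and k: "k \<in> t"
  shows "\<exists>t'\<in>T. t' \<noteq> t \<and> t - {k} \<subseteq> t' \<and> (\<forall>t''\<in>T. t - {k} \<subseteq> t'' \<longrightarrow> t'' = t \<or> t'' = t')"
proof -
  let ?v = "vertex t"
  obtain d where d: "\<And>i. i \<in> t \<Longrightarrow> fst (c i) \<bullet> d = (if i = k then 1 else 0)"
    using vertex_solve[OF t, of "\<lambda>i. if i = k then 1 else 0"] by auto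
  have dk: "fst (c k) \<bullet> d = 1" using d k by simp
  have d0: "d \<noteq> 0" using dk by auto
  have line: "z = (fst (c k) \<bullet> z) *\<^sub>R d" if "\<And>i. i \<in> t - {k} \<Longrightarrow> fst (c i) \<bullet> z = 0" for z
  proof -
    have "fst (c i) \<bullet> (z - (fst (c k) \<bullet> z) *\<^sub>R d) = 0" if "i \<in> t" for i
      using that d \<open>\<And>i. i \<in> t - {k} \<Longrightarrow> fst (c i) \<bullet> z = 0\<close> by (cases "i = k") (auto simp: inner_diff_right)
    then show ?thesis using rigidD[OF T_rigid[OF t]] by force
  qed
  have on_line: "vertex t'' = ?v + aff (c k) (vertex t'') *\<^sub>R d" if "t'' \<in> T" "t - {k} \<subseteq> t''" for t''
  proof -
    have "fst (c i) \<bullet> (vertex t'' - ?v) = 0" if i: "i \<in> t - {k}" for i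
    proof -
      have "aff (c i) (vertex t'') = 0" "aff (c i) ?v = 0"
        using \<open>t'' \<in> T\<close> \<open>t - {k} \<subseteq> t''\<close> i t T_sub aff_vertex_eq_0_iff by blast+
      then show ?thesis using aff_diff[of "c i" "vertex t''" ?v] by simp
    qed
    from line[OF this] have "vertex t'' - ?v = (fst (c k) \<bullet> (vertex t'' - ?v)) *\<^sub>R d" .
    moreover have "fst (c k) \<bullet> (vertex t'' - ?v) = aff (c k) (vertex t'')"
    proof -
      have "aff (c k) ?v = 0" using k t T_sub aff_vertex_eq_0_iff by blast
      then show ?thesis using aff_diff[of "c k" "vertex t''" ?v] by simp
    qed
    ultimately show ?thesis by (metis add.commute diff_add_cancel)
  qed
  obtain s i where s: "0 \<le> s" "?v + s *\<^sub>R d \<in> region I c" "i \<in> I" "fst (c i) \<bullet> d < 0"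
      "aff (c i) (?v + s *\<^sub>R d) = 0"
    using region_exit[OF finite_I bounded_reg vertex_in[OF t] d0] .
  let ?w = "?v + s *\<^sub>R d"
  have it: "i \<notin> t" using s(4) d by (force split: if_splits)
  have sub: "t - {k} \<subseteq> tight I c ?w"
    using d T_sub[OF t] aff_vertex_eq_0_iff[OF t] by (auto simp: tight_def aff_add_scaleR)
  have iw: "i \<in> tight I c ?w" using s by (simp add: tight_def)
  have "rigid (tight I c ?w) c"
  proof (rule rigidI)
    fix z assume z: "\<And>j. j \<in> tight I c ?w \<Longrightarrow> fst (c j) \<bullet> z = 0"
    then have zd: "z = (fst (c k) \<bullet> z) *\<^sub>R d" using line sub by blast
    have "0 = fst (c i) \<bullet> z" using z[OF iw] by simp
    also have "\<dots> = (fst (c k) \<bullet> z) * (fst (c i) \<bullet> d)"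
      using zd by (metis inner_scaleR_right)
    finally have "fst (c k) \<bullet> z = 0" using s(4) by simp
    then show "z = 0" using zd by simp
  qed
  then have wT: "tight I c ?w \<in> T" using T_I s(2) by blast
  have unique: "t'' = t'" if "t'' \<in> T" "t - {k} \<subseteq> t''" "t'' \<noteq> t" "t' \<in> T" "t - {k} \<subseteq> t'" "t' \<noteq> t"
    "aff (c k) (vertex t'') < aff (c k) (vertex t')" for t' t''
  proof -
    have nk: "k \<notin> t''"
    proof
      assume "k \<in> t''"
      then have "t \<subseteq> t''" using that by blast
      then show False using that T_card T_finite t by (metis card_subset_eq)
    qed
    let ?a = "aff (c k) (vertex t'')" and ?b = "aff (c k) (vertex t')"
    have a: "0 < ?a" using aff_vertex_pos[OF that(1)] nk k T_sub[OF t] by blast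
    define u where "u = ?a / ?b"
    have u: "0 < u" "u < 1" using a that(7) by (auto simp: u_def)
    have "vertex t'' = (1 - u) *\<^sub>R ?v + u *\<^sub>R vertex t'"
    proof -
      define a b where "a = ?a" and "b = ?b"
      have w: "vertex t' = ?v + b *\<^sub>R d" using on_line[OF that(4,5)] by (simp add: b_def)
      have v: "vertex t'' = ?v + a *\<^sub>R d" using on_line[OF that(1,2)] by (simp add: a_def)
      have "u * b = a" using a that(7) by (simp add: u_def a_def b_def)
      then have "u *\<^sub>R vertex t' = u *\<^sub>R ?v + a *\<^sub>R d" unfolding w by (simp add: scaleR_add_right)
      then show ?thesis unfolding v by (simp add: algebra_simps)
    qed
    then have "t'' = t \<inter> t'"
      using tight_between(2)[OF vertex_in[OF t] vertex_in[OF that(4)] u] tight_vertex t that(1,4) by metis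
    then have "card t'' \<le> 2" using card_inter_lt[OF t that(4)] that(6) by simp
    then show ?thesis using T_card[OF that(1)] by simp
  qed
  have wt: "tight I c ?w \<noteq> t" using it iw by blast
  have "t'' = tight I c ?w" if "t'' \<in> T" "t - {k} \<subseteq> t''" "t'' \<noteq> t" for t''
  proof -
    consider "aff (c k) (vertex t'') < aff (c k) (vertex (tight I c ?w))"
      | "aff (c k) (vertex (tight I c ?w)) < aff (c k) (vertex t'')"
      | "aff (c k) (vertex (tight I c ?w)) = aff (c k) (vertex t'')" by linarith
    then show ?thesis
    proof cases
      case 3
      then show ?thesis using on_line[OF that(1,2)] on_line[OF wT sub] vertex_inj that(1) wT by metis
    qed (use unique that wT sub wt in metis)+
  qed
  then show ?thesis using wT sub wt by blast
qed

lemma two_triples: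
  assumes "t \<in> T" "e \<subseteq> t" "card e = 2"
  shows "\<exists>t'\<in>T. t' \<noteq> t \<and> t \<inter> t' = e \<and> {t''\<in>T. e \<subseteq> t''} = {t, t'}"
proof -
  have "card (t - e) = 1" using assms T_card T_finite by (simp add: card_Diff_subset finite_subset)
  then obtain k where "t - e = {k}" by (auto simp: card_1_singleton_iff)
  then have k: "k \<in> t" "e = t - {k}" using assms by auto
  obtain t' where t': "t' \<in> T" "t' \<noteq> t" "t - {k} \<subseteq> t'" "\<forall>t''\<in>T. t - {k} \<subseteq> t'' \<longrightarrow> t'' = t \<or> t'' = t'"
    using edge_other[OF assms(1) k(1)] by blast
  have "e = t \<inter> t'"
    using card_inter_lt[OF assms(1) t'(1)] t' assms T_finite k by (intro card_seteq) auto
  moreover have "{t''\<in>T. e \<subseteq> t''} = {t, t'}"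
    using t' k(2) assms(1) by (intro set_eqI) auto
  ultimately show ?thesis using t'(1,2) by blast
qed

lemma card_edge_triples:
  assumes "t \<in> T" "e \<subseteq> t" "card e = 2"
  shows "card {t''\<in>T. e \<subseteq> t''} = 2"
proof -
  obtain t' where "t' \<noteq> t" "{t''\<in>T. e \<subseteq> t''} = {t, t'}" using two_triples[OF assms] by blast
  then show ?thesis by (metis card_2_iff)
qed

end

section \<open>Cutting by a half-space\<close>

context simple_system begin

text \<open>Two triples with two common indices are the ends of an edge. Each edge that crosses the
  plane of \<open>h\<close> contributes one new vertex.\<close>

definition cut_triples :: "(real^3) \<times> real \<Rightarrow> 'i \<Rightarrow> 'i set set" where
  "cut_triples h g = {t\<in>T. 0 < aff h (vertex t)} \<union>
     {insert g (t \<inter> t') | t t'. t \<in> T \<and> t' \<in> T \<and> 0 < aff h (vertex t) \<and> aff h (vertex t') < 0 \<and> card (t \<inter> t') = 2}"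

lemma region_cut:
  assumes "g \<notin> I"
  shows "region (insert g I) (c(g := h)) = region I c \<inter> {x. 0 \<le> aff h x}"
    and "tight (insert g I) (c(g := h)) x = (if aff h x = 0 then insert g (tight I c x) else tight I c x)"
proof -
  have *: "i \<noteq> g" if "i \<in> I" for i using assms that by auto
  show "region (insert g I) (c(g := h)) = region I c \<inter> {x. 0 \<le> aff h x}"
    by (auto simp: region_def dest: *)
  show "tight (insert g I) (c(g := h)) x = (if aff h x = 0 then insert g (tight I c x) else tight I c x)"
    by (auto simp: tight_def dest: *)
qed

text \<open>A vertex of the cut region on the new plane is no old vertex, as \<open>h\<close>
  vanishes at none, so its old tight constraints leave a line of freedom. On this line
  \<open>h\<close> varies, and walking both ways ends in two old vertices on opposite sides of the
  plane: the point is interior to an old edge.\<close>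

lemma cut_vertex:
  assumes g: "g \<notin> I" and h0: "\<And>t. t \<in> T \<Longrightarrow> aff h (vertex t) \<noteq> 0"
    and x: "x \<in> region (insert g I) (c(g := h))"
    and rig: "rigid (tight (insert g I) (c(g := h)) x) (c(g := h))"
  shows "card (tight (insert g I) (c(g := h)) x) = 3 \<and> tight (insert g I) (c(g := h)) x \<in> cut_triples h g"
proof -
  let ?c = "c(g := h)" and ?I = "insert g I"
  have xr: "x \<in> region I c" "0 \<le> aff h x" using x region_cut(1)[OF g, of h] by auto
  have ti: "tight I c x \<subseteq> I" by (auto simp: tight_def)
  have eq: "?c i = c i" if "i \<in> I" for i using g that by auto
  show ?thesis
  proof (cases "aff h x = 0")
    case False
    then have t: "tight ?I ?c x = tight I c x" using region_cut(2)[OF g] by simp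
    have r: "rigid (tight I c x) c" using rig ti eq unfolding t by (auto simp: rigid_def subset_iff)
    then have T: "tight I c x \<in> T" using T_I xr by blast
    moreover have "x = vertex (tight I c x)" using T by (intro eq_vertexI) (auto simp: tight_def)
    ultimately show ?thesis using False xr simple r T_card by (auto simp: t cut_triples_def)
  next
    case True
    have t: "tight ?I ?c x = insert g (tight I c x)" using True region_cut(2)[OF g] by simp
    have rigD: "z = 0" if "fst h \<bullet> z = 0" "\<And>i. i \<in> tight I c x \<Longrightarrow> fst (c i) \<bullet> z = 0" for z
    proof (rule rigidD[OF rig])
      fix i assume "i \<in> tight ?I ?c x"
      then show "fst (?c i) \<bullet> z = 0" using that t by auto
    qed
    have "\<not> rigid (tight I c x) c"
    proof
      assume "rigid (tight I c x) c"
      then have T: "tight I c x \<in> T" using T_I xr by blast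
      moreover have "x = vertex (tight I c x)" using T by (intro eq_vertexI) (auto simp: tight_def)
      ultimately show False using h0 True by metis
    qed
    then obtain d where d: "d \<noteq> 0" "\<And>i. i \<in> tight I c x \<Longrightarrow> fst (c i) \<bullet> d = 0"
      unfolding rigid_def by blast
    have hd: "fst h \<bullet> d \<noteq> 0" using rigD d by blast
    have line: "z = ((fst h \<bullet> z) / (fst h \<bullet> d)) *\<^sub>R d" if "\<And>i. i \<in> tight I c x \<Longrightarrow> fst (c i) \<bullet> z = 0" for z
    proof -
      have "z - ((fst h \<bullet> z) / (fst h \<bullet> d)) *\<^sub>R d = 0"
        by (rule rigD) (use that d(2) hd in \<open>auto simp: inner_diff_right\<close>)
      then show ?thesis by simp
    qed
    have walk: "\<exists>s>0. x + s *\<^sub>R e \<in> region I c \<and> tight I c (x + s *\<^sub>R e) \<in> T"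
      if e: "e \<noteq> 0" "\<And>i. i \<in> tight I c x \<Longrightarrow> fst (c i) \<bullet> e = 0" for e
    proof -
      obtain s i where s: "0 \<le> s" "x + s *\<^sub>R e \<in> region I c" "i \<in> I" "fst (c i) \<bullet> e < 0"
        "aff (c i) (x + s *\<^sub>R e) = 0"
        using region_exit[OF finite_I bounded_reg xr(1) e(1)] .
      have "i \<notin> tight I c x" using s(4) e(2) by force
      then have "s \<noteq> 0" using s(3,5) by (auto simp: tight_def)
      moreover have "rigid (tight I c (x + s *\<^sub>R e)) c"
      proof (rule rigidI)
        fix z assume z: "\<And>j. j \<in> tight I c (x + s *\<^sub>R e) \<Longrightarrow> fst (c j) \<bullet> z = 0"
        have sub: "tight I c x \<subseteq> tight I c (x + s *\<^sub>R e)"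
          using e(2) by (auto simp: tight_def aff_add_scaleR)
        obtain p where p: "z = p *\<^sub>R d" using line z sub by blast
        obtain q where q: "e = q *\<^sub>R d" using line[OF e(2)] by blast
        have "fst (c i) \<bullet> z = 0" using z s(3,5) by (simp add: tight_def)
        then have "p = 0" using s(4) p q by auto
        then show "z = 0" using p by simp
      qed
      ultimately show ?thesis using s T_I by (intro exI[of _ s]) auto
    qed
    define d' where "d' = (if 0 < fst h \<bullet> d then d else - d)"
    have d': "d' \<noteq> 0" "\<And>i. i \<in> tight I c x \<Longrightarrow> fst (c i) \<bullet> d' = 0" "0 < fst h \<bullet> d'"
      using d hd by (auto simp: d'_def)
    obtain s where s: "s > 0" "x + s *\<^sub>R d' \<in> region I c" "tight I c (x + s *\<^sub>R d') \<in> T"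
      using walk[OF d'(1,2)] by blast
    have "\<exists>r>0. x + r *\<^sub>R (- d') \<in> region I c \<and> tight I c (x + r *\<^sub>R (- d')) \<in> T"
      by (rule walk) (use d' in auto)
    then obtain r where r: "r > 0" "x + r *\<^sub>R (- d') \<in> region I c" "tight I c (x + r *\<^sub>R (- d')) \<in> T"
      by blast
    let ?v = "x + s *\<^sub>R d'" and ?w = "x + r *\<^sub>R (- d')"
    define u where "u = s / (s + r)"
    have u: "0 < u" "u < 1" using s r by (auto simp: u_def)
    have "(1 - u) *\<^sub>R ?v + u *\<^sub>R ?w = x + ((1 - u) * s - u * r) *\<^sub>R d'"
      by (simp add: algebra_simps)
    moreover have "(1 - u) * s - u * r = 0"
      using s(1) r(1) by (simp add: u_def divide_simps)
    ultimately have "x = (1 - u) *\<^sub>R ?v + u *\<^sub>R ?w" by simp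
    then have tx: "tight I c x = tight I c ?v \<inter> tight I c ?w"
      using tight_between(2)[OF s(2) r(2) u] by metis
    have vv: "?v = vertex (tight I c ?v)" by (rule eq_vertexI[OF s(3)]) (auto simp: tight_def)
    have ww: "?w = vertex (tight I c ?w)" by (rule eq_vertexI[OF r(3)]) (auto simp: tight_def)
    have hv: "0 < aff h ?v" using s(1) d'(3) True by (simp add: aff_add_scaleR)
    have hw: "aff h ?w < 0" using r(1) d'(3) True by (simp add: aff_add_scaleR del: scaleR_minus_right)
    have "tight I c ?v \<noteq> tight I c ?w" using vv ww hv hw by (metis less_asym)
    then have "card (tight I c x) \<le> 2" using card_inter_lt[OF s(3) r(3)] tx by simp
    moreover have gt: "g \<notin> tight I c x" using g ti by blast
    have fin: "finite (tight I c x)" using finite_I ti finite_subset by blast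
    moreover have "3 \<le> card (insert g (tight I c x))"
      using rigid_card_ge[OF _ rig] fin unfolding t by simp
    ultimately have c2: "card (tight I c x) = 2" using gt by simp
    then have "card (insert g (tight I c x)) = 3" using gt fin by simp
    moreover have "insert g (tight I c x) \<in> cut_triples h g"
    proof -
      have "0 < aff h (vertex (tight I c ?v))" "aff h (vertex (tight I c ?w)) < 0"
        using hv hw vv ww by metis+
      moreover have "card (tight I c ?v \<inter> tight I c ?w) = 2" using c2 tx by simp
      ultimately show ?thesis unfolding cut_triples_def tx using s(3) r(3) by blast
    qed
    ultimately show ?thesis unfolding t by blast
  qed
qed

text \<open>On an edge from a positive to a negative vertex, \<open>u\<close> is the interpolation
  parameter at which \<open>h\<close> vanishes. Rigidity holds because the two common normals leave
  only the direction of the edge, along which \<open>h\<close> is not constant.\<close>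

lemma cut_attained:
  assumes g: "g \<notin> I" and t: "t \<in> cut_triples h g"
  shows "\<exists>x\<in>region (insert g I) (c(g := h)). tight (insert g I) (c(g := h)) x = t \<and> rigid t (c(g := h))"
proof -
  let ?c = "c(g := h)" and ?I = "insert g I"
  have eq: "?c i = c i" if "i \<in> I" for i using g that by auto
  consider "t \<in> T" "0 < aff h (vertex t)" | p q where "t = insert g (p \<inter> q)" "p \<in> T" "q \<in> T"
    "0 < aff h (vertex p)" "aff h (vertex q) < 0" "card (p \<inter> q) = 2"
    using t unfolding cut_triples_def by blast
  then show ?thesis
  proof cases
    case 1
    have "rigid t ?c" using T_rigid[OF 1(1)] T_sub[OF 1(1)] eq by (auto simp: rigid_def subset_iff)
    then show ?thesis using 1 vertex_in tight_vertex region_cut[OF g]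
      by (intro bexI[of _ "vertex t"]) auto
  next
    case 2
    let ?v = "vertex p" and ?w = "vertex q"
    define u where "u = aff h ?v / (aff h ?v - aff h ?w)"
    have u: "0 < u" "u < 1" using 2 by (auto simp: u_def)
    define x where "x = (1 - u) *\<^sub>R ?v + u *\<^sub>R ?w"
    have tx: "tight I c x = p \<inter> q"
      using tight_between(2)[OF vertex_in[OF 2(2)] vertex_in[OF 2(3)] u] tight_vertex 2(2,3) x_def by metis
    have xr: "x \<in> region I c"
      using tight_between(1)[OF vertex_in[OF 2(2)] vertex_in[OF 2(3)] u] x_def by metis
    have hx: "aff h x = 0"
    proof -
      have "u * (aff h ?v - aff h ?w) = aff h ?v" using 2 by (simp add: u_def)
      then show ?thesis unfolding x_def aff_convex by (simp add: algebra_simps)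
    qed
    have "card (p - q) = 1"
      using card_Int_Diff[OF T_finite[OF 2(2)], of q] T_card[OF 2(2)] 2(6) by simp
    then obtain k where k: "p - q = {k}" by (auto simp: card_1_singleton_iff)
    then have kp: "i = k \<or> i \<in> p \<inter> q" if "i \<in> p" for i using that by blast
    let ?d = "?w - ?v"
    have dpq: "fst (c i) \<bullet> ?d = 0" if "i \<in> p \<inter> q" for i
    proof -
      have "aff (c i) ?v = 0" "aff (c i) ?w = 0" using that 2 aff_vertex_eq_0_iff T_sub by blast+
      then show ?thesis using aff_diff[of "c i" ?w ?v] by simp
    qed
    have d0: "fst h \<bullet> ?d < 0" using aff_diff[of h ?w ?v] 2 by simp
    have dk: "fst (c k) \<bullet> ?d \<noteq> 0"
    proof
      assume "fst (c k) \<bullet> ?d = 0"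
      then have "fst (c i) \<bullet> ?d = 0" if "i \<in> p" for i using dpq kp[OF that] by blast
      then have "?d = 0" using rigidD[OF T_rigid[OF 2(2)]] by blast
      then show False using d0 by simp
    qed
    have "rigid t ?c"
    proof (rule rigidI)
      fix z assume z: "\<And>i. i \<in> t \<Longrightarrow> fst (?c i) \<bullet> z = 0"
      have zh: "fst h \<bullet> z = 0" using z[of g] 2(1) by simp
      have zi: "fst (c i) \<bullet> z = 0" if "i \<in> p \<inter> q" for i
        using z[of i] that 2(1) eq[of i] T_sub[OF 2(2)] by auto
      define r where "r = (fst (c k) \<bullet> z) / (fst (c k) \<bullet> ?d)"
      have "fst (c i) \<bullet> (z - r *\<^sub>R ?d) = 0" if "i \<in> p" for i
      proof (cases "i = k")
        case True
        then show ?thesis using dk by (simp add: r_def inner_diff_right[of _ z])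
      next
        case False
        then have "i \<in> p \<inter> q" using kp[OF that] by blast
        then show ?thesis using zi dpq by (simp add: inner_diff_right[of _ z])
      qed
      then have zr: "z = r *\<^sub>R ?d" using rigidD[OF T_rigid[OF 2(2)]] by force
      then have "r * (fst h \<bullet> ?d) = 0" using zh by (metis inner_scaleR_right)
      then have "r = 0" using d0 by simp
      then show "z = 0" using zr by simp
    qed
    then show ?thesis using xr tx hx 2(1) region_cut[OF g] by (intro bexI[of _ x]) auto
  qed
qed

lemma simple_system_cut:
  assumes g: "g \<notin> I" and h0: "\<And>t. t \<in> T \<Longrightarrow> aff h (vertex t) \<noteq> 0"
    and cov: "insert g I \<subseteq> \<Union>(cut_triples h g)"
  shows "simple_system (insert g I) (c(g := h)) (cut_triples h g)"
proof
  show "finite (insert g I)" using finite_I by simp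
  show "bounded (region (insert g I) (c(g := h)))"
    using bounded_reg region_cut(1)[OF g] by (metis bounded_subset inf_le1)
  show "card (tight (insert g I) (c(g := h)) x) = 3"
    if "x \<in> region (insert g I) (c(g := h))" "rigid (tight (insert g I) (c(g := h)) x) (c(g := h))" for x
    using cut_vertex[OF g h0 that] by blast
  show "cut_triples h g = tight (insert g I) (c(g := h)) `
    {x \<in> region (insert g I) (c(g := h)). rigid (tight (insert g I) (c(g := h)) x) (c(g := h))}"
  proof
    show "cut_triples h g \<subseteq> tight (insert g I) (c(g := h)) `
      {x \<in> region (insert g I) (c(g := h)). rigid (tight (insert g I) (c(g := h)) x) (c(g := h))}"
      using cut_attained[OF g] by blast
  qed (use cut_vertex[OF g h0] in blast)
  show "cut_triples h g \<noteq> {}" using cov by blast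
  show "insert g I \<subseteq> \<Union>(cut_triples h g)" by (rule cov)
qed

end

section \<open>Splitting a facet\<close>

text \<open>The vertices of the facet \<open>F\<close> between successive members of a list of its
  neighbours. A closed cycle is expressed by repeating the first neighbour at the end.\<close>

fun tris :: "'i \<Rightarrow> 'i list \<Rightarrow> 'i set set" where
  "tris F (x # y # zs) = insert {F, x, y} (tris F (y # zs))"
| "tris F _ = {}"

lemma tris_append: "tris F (xs @ y # zs) = tris F (xs @ [y]) \<union> tris F (y # zs)"
  by (induction F xs rule: tris.induct) auto

lemma tris_rev: "tris F (rev xs) = tris F xs"
proof (induction F xs rule: tris.induct)
  case (1 F x y zs)
  have "tris F (rev (x # y # zs)) = tris F (rev zs @ y # [x])" by simp
  also have "\<dots> = tris F (rev zs @ [y]) \<union> tris F [y, x]" by (rule tris_append)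
  also have "\<dots> = tris F (y # zs) \<union> {{F, y, x}}" using 1 by simp
  finally show ?case by (auto simp: insert_commute)
qed simp_all

lemma tris_elem:
  "t \<in> tris F xs \<Longrightarrow> distinct xs \<Longrightarrow> \<exists>x y. t = {F, x, y} \<and> x \<in> set xs \<and> y \<in> set xs \<and> x \<noteq> y"
  by (induction F xs rule: tris.induct) auto

lemma tris_rename: "F \<notin> set xs \<Longrightarrow> tris G xs = (\<lambda>t. insert G (t - {F})) ` tris F xs"
proof (induction F xs rule: tris.induct)
  case (1 F x y zs)
  have "{F, x, y} - {F} = {x, y}" using 1 by auto
  then show ?case using 1 by simp
qed simp_all

lemma tris_mem: "t \<in> tris F xs \<Longrightarrow> F \<in> t"
  by (induction F xs rule: tris.induct) auto

lemma tris_subset: "t \<in> tris F xs \<Longrightarrow> t \<subseteq> insert F (set xs)"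
  by (induction F xs rule: tris.induct) auto

lemma finite_tris: "finite (tris F xs)"
  by (induction F xs rule: tris.induct) auto

lemma card_tris: "distinct xs \<Longrightarrow> F \<notin> set xs \<Longrightarrow> card (tris F xs) = length xs - 1"
proof (induction F xs rule: tris.induct)
  case (1 F x y zs)
  have "{F, x, y} \<notin> tris F (y # zs)"
    using tris_subset[of "{F,x,y}" F "y # zs"] 1 by auto
  then show ?case using 1 finite_tris[of F "y # zs"] by simp
qed simp_all

definition deg :: "'i set set \<Rightarrow> 'i \<Rightarrow> nat" where
  "deg T i = card {t\<in>T. i \<in> t}"

text \<open>The vertices of \<open>F\<close> passed on the way from \<open>a\<close> to
  \<open>b\<close> now belong to \<open>G\<close> instead, and the two ends of the chord are new.
  What is left of \<open>F\<close> lies on the other side of the chord.\<close>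

definition split_triples :: "'i set set \<Rightarrow> 'i \<Rightarrow> 'i \<Rightarrow> 'i \<Rightarrow> 'i list \<Rightarrow> 'i \<Rightarrow> 'i set set" where
  "split_triples T F G a w b =
     (T - tris F (a # w @ [b])) \<union> tris G (a # w @ [b]) \<union> {{G, F, a}, {G, F, b}}"

text \<open>Exchanging \<open>F\<close> for \<open>G\<close> is injective on the removed triples and
  affects no other membership, so apart from \<open>F\<close> and \<open>G\<close> only
  \<open>a\<close> and \<open>b\<close> change: each gains an end of the chord. The facet
  \<open>G\<close> has \<open>length w + 1\<close> inherited vertices and the two ends.\<close>

lemma deg_split:
  assumes fin: "finite T" and G: "\<And>t. t \<in> T \<Longrightarrow> G \<notin> t" and sub: "tris F (a # w @ [b]) \<subseteq> T"
    and F: "F \<notin> set (a # w @ [b])" and GF: "G \<noteq> F" and ab: "distinct (a # w @ [b])"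
    and Gw: "G \<notin> set (a # w @ [b])"
  shows "deg (split_triples T F G a w b) G = length w + 3"
    and "i \<noteq> F \<Longrightarrow> i \<noteq> G \<Longrightarrow>
      deg (split_triples T F G a w b) i = deg T i + (if i = a \<or> i = b then 1 else 0)"
proof -
  let ?D = "tris F (a # w @ [b])" and ?E = "tris G (a # w @ [b])"
  let ?T = "split_triples T F G a w b"
  have FE: "F \<notin> t" if "t \<in> ?E" for t using tris_subset[OF that] F GF by auto
  have GE: "G \<in> t" if "t \<in> ?E" for t using tris_mem[OF that] .
  have "{t\<in>?T. G \<in> t} = ?E \<union> {{G, F, a}, {G, F, b}}"
    using G GE by (auto simp: split_triples_def)
  moreover have "?E \<inter> {{G, F, a}, {G, F, b}} = {}" using FE by auto
  moreover have "card {{G, F, a}, {G, F, b}} = 2"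
  proof -
    have "b \<notin> {G, F, a}" using F Gw ab by auto
    then have "{G, F, a} \<noteq> {G, F, b}" by blast
    then show ?thesis by simp
  qed
  moreover have "card ?E = length w + 1" using card_tris[OF ab Gw] by simp
  moreover have "card (?E \<union> {{G, F, a}, {G, F, b}}) = card ?E + card {{G, F, a}, {G, F, b}}"
    using calculation(2) finite_tris by (intro card_Un_disjoint) auto
  ultimately have "card {t\<in>?T. G \<in> t} = length w + 1 + 2" by metis
  then show "deg ?T G = length w + 3" unfolding deg_def by simp
next
  let ?D = "tris F (a # w @ [b])" and ?E = "tris G (a # w @ [b])"
  let ?T = "split_triples T F G a w b"
  assume i: "i \<noteq> F" "i \<noteq> G"
  have FE: "F \<notin> t" if "t \<in> ?E" for t using tris_subset[OF that] F GF by auto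
  have GE: "G \<in> t" if "t \<in> ?E" for t using tris_mem[OF that] .
  have FD: "F \<in> t" if "t \<in> ?D" for t using tris_mem[OF that] .
  define A where "A = {t\<in>T. i \<in> t} - {t\<in>?D. i \<in> t}"
  define X where "X = {t\<in>{{G, F, a}, {G, F, b}}. i \<in> t}"
  have eq: "{t\<in>?T. i \<in> t} = A \<union> ({t\<in>?E. i \<in> t} \<union> X)"
    unfolding split_triples_def A_def X_def by blast
  have fE: "finite {t\<in>?E. i \<in> t}" and fD: "finite {t\<in>?D. i \<in> t}" and fX: "finite X" and fA: "finite A"
    using finite_tris[of G "a # w @ [b]"] finite_tris[of F "a # w @ [b]"] fin
    by (auto simp: A_def X_def simp del: tris.simps)
  have d1: "A \<inter> ({t\<in>?E. i \<in> t} \<union> X) = {}"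
    using G GE by (auto simp: A_def X_def simp del: tris.simps)
  have d2: "{t\<in>?E. i \<in> t} \<inter> X = {}" using FE by (auto simp: X_def simp del: tris.simps)
  have "card {t\<in>?E. i \<in> t} = card {t\<in>?D. i \<in> t}"
  proof -
    have "{t\<in>?E. i \<in> t} = (\<lambda>t. insert G (t - {F})) ` {t\<in>?D. i \<in> t}"
      unfolding tris_rename[OF F, of G] using i by (auto simp del: tris.simps)
    moreover have "inj_on (\<lambda>t. insert G (t - {F})) {t\<in>?D. i \<in> t}"
    proof (rule inj_onI)
      fix s t assume st: "s \<in> {t\<in>?D. i \<in> t}" "t \<in> {t\<in>?D. i \<in> t}" "insert G (s - {F}) = insert G (t - {F})"
      then have "G \<notin> s" "G \<notin> t" "F \<in> s" "F \<in> t" using G sub FD by blast+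
      then show "s = t" using st(3) by (metis Diff_insert_absorb insert_Diff insert_iff Diff_iff)
    qed
    ultimately show ?thesis by (simp add: card_image del: tris.simps)
  qed
  moreover have "card X = (if i = a \<or> i = b then 1 else 0)"
  proof -
    have "X = (if i = a then {{G, F, a}} else if i = b then {{G, F, b}} else {})"
      using i ab by (auto simp: X_def)
    then show ?thesis by simp
  qed
  moreover have "card A + card {t\<in>?D. i \<in> t} = deg T i"
  proof -
    have "{t\<in>?D. i \<in> t} \<subseteq> {t\<in>T. i \<in> t}" using sub by blast
    note card_Diff_subset[OF fD this] card_mono[OF _ this]
    then show ?thesis unfolding A_def deg_def using fin by simp
  qed
  ultimately show "deg ?T i = deg T i + (if i = a \<or> i = b then 1 else 0)"
    unfolding deg_def[of ?T] eq using card_Un_disjoint[OF fA _ d1] card_Un_disjoint[OF fE fX d2] fE fX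
    by (simp del: tris.simps)
qed

text \<open>Of three distinct collinear points of a convex region, the middle one has its tight
  constraints contained in those of both others. The cases for \<open>s\<close> decide which point
  is in the middle.\<close>

lemma collinear_region:
  assumes "p \<in> region I c" "q \<in> region I c" "z \<in> region I c" "z = p + s *\<^sub>R (q - p)"
    and pq: "\<not> tight I c p \<subseteq> tight I c q" "\<not> tight I c q \<subseteq> tight I c p"
    and z: "\<not> tight I c z \<subseteq> tight I c p" "\<not> tight I c z \<subseteq> tight I c q"
  shows False
proof -
  consider "s < 0" | "s = 0" | "0 < s" "s < 1" | "s = 1" | "1 < s" by linarith
  then show False
  proof cases
    case 1
    define u where "u = - s / (1 - s)"
    have u: "0 < u" "u < 1" using 1 by (auto simp: u_def divide_simps)
    have e: "(1 - u) * s + u = 0" using 1 by (simp add: u_def field_simps)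
    have "(1 - u) *\<^sub>R z + u *\<^sub>R q = p + ((1 - u) * s + u) *\<^sub>R (q - p)"
      unfolding assms(4) by (simp add: algebra_simps)
    then have "p = (1 - u) *\<^sub>R z + u *\<^sub>R q" using e by simp
    then show False using tight_between(2)[OF assms(3,2) u] pq(1) by auto
  next
    case 3
    have "z = (1 - s) *\<^sub>R p + s *\<^sub>R q" unfolding assms(4) by (simp add: algebra_simps)
    then show False using tight_between(2)[OF assms(1,2) 3] z(1) by auto
  next
    case 5
    define u where "u = 1 / s"
    have u: "0 < u" "u < 1" using 5 by (auto simp: u_def)
    have e: "u * s = 1" using 5 by (simp add: u_def)
    have "(1 - u) *\<^sub>R p + u *\<^sub>R z = p + (u * s) *\<^sub>R (q - p)"
      unfolding assms(4) by (simp add: algebra_simps)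
    then have "q = (1 - u) *\<^sub>R p + u *\<^sub>R z" using e by simp
    then show False using tight_between(2)[OF assms(1,3) u] pq(2) by auto
  qed (use assms in auto)
qed

text \<open>Otherwise the part of \<open>z\<close> orthogonal to \<open>d\<close> would complete
  four pairwise orthogonal nonzero vectors in three dimensions.\<close>

lemma parallel_in_plane:
  fixes n u d z :: "real^3"
  assumes "n \<noteq> 0" "u \<noteq> 0" "n \<bullet> d = 0" "u \<bullet> d = 0" "n \<bullet> u = 0" "d \<noteq> 0" "n \<bullet> z = 0" "u \<bullet> z = 0"
  shows "z = ((d \<bullet> z) / (d \<bullet> d)) *\<^sub>R d"
proof (rule ccontr)
  assume neq: "z \<noteq> ((d \<bullet> z) / (d \<bullet> d)) *\<^sub>R d"
  define e where "e = z - ((d \<bullet> z) / (d \<bullet> d)) *\<^sub>R d"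
  have e0: "e \<noteq> 0" using neq by (simp add: e_def)
  have "n \<bullet> e = 0" "u \<bullet> e = 0" "d \<bullet> e = 0"
    using assms by (auto simp: e_def inner_diff_right)
  note o = this assms(3,4,5)
  have ne: "n \<noteq> u" "n \<noteq> d" "n \<noteq> e" "u \<noteq> d" "u \<noteq> e" "d \<noteq> e"
    using o assms(1,2,6) e0 by (metis inner_eq_zero_iff)+
  have "pairwise orthogonal {n, u, d, e}"
    using o by (auto simp: pairwise_def orthogonal_def inner_commute)
  then have "independent {n, u, d, e}"
    using assms(1,2,6) e0 by (intro pairwise_orthogonal_independent) auto
  then have "card {n, u, d, e} \<le> DIM(real^3)" using independent_bound by blast
  then show False using ne by simp
qed

section \<open>Separation of the vertices of a facet by a chord\<close>

context simple_system begin

text \<open>The sign of \<open>m\<close> is carried along the edges of \<open>F\<close>. It may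
  change only on the edges shared with \<open>a\<close> and \<open>b\<close>, which can occur only
  at the ends of the list.\<close>

lemma sign_chain:
  assumes "\<And>x y z. {F, x, y} \<in> T \<Longrightarrow> {F, y, z} \<in> T \<Longrightarrow> x \<noteq> z \<Longrightarrow> y \<notin> {a, b} \<Longrightarrow>
      0 < aff m (vertex {F, x, y}) \<Longrightarrow> 0 < aff m (vertex {F, y, z})"
    and "tris F (x # y # zs) \<subseteq> T" "distinct (x # y # zs)"
    and "set (butlast (y # zs)) \<inter> {a, b} = {}" "0 < aff m (vertex {F, x, y})"
  shows "\<forall>t\<in>tris F (x # y # zs). 0 < aff m (vertex t)"
  using assms(2-)
proof (induction zs arbitrary: x y)
  case Nil
  then show ?case by simp
next
  case (Cons z zs)
  have "0 < aff m (vertex {F, y, z})"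
    by (rule assms(1)[of x y z]) (use Cons.prems in auto)
  then show ?case using Cons.IH[of y z] Cons.prems by auto
qed

lemma edge_midpoint:
  assumes "{F, x, y} \<in> T" "{F, y, z} \<in> T" "x \<noteq> z"
  defines "p \<equiv> (1 - 1/2) *\<^sub>R vertex {F, x, y} + (1/2) *\<^sub>R vertex {F, y, z}"
  shows "p \<in> region I c" "tight I c p = {F, y}"
    "2 * aff m p = aff m (vertex {F, x, y}) + aff m (vertex {F, y, z})"
proof -
  have "x \<noteq> F" "y \<noteq> F" "x \<noteq> y" "z \<noteq> F" "z \<noteq> y"
    using T_card[OF assms(1)] T_card[OF assms(2)] by (auto simp: card_insert_if split: if_splits)
  then have i: "{F, x, y} \<inter> {F, y, z} = {F, y}" using assms(3) by auto
  show "p \<in> region I c"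
    unfolding p_def by (rule tight_between(1)[OF vertex_in[OF assms(1)] vertex_in[OF assms(2)]]) auto
  have "tight I c p = {F, x, y} \<inter> {F, y, z}"
    unfolding p_def
    using tight_between(2)[OF vertex_in[OF assms(1)] vertex_in[OF assms(2)], of "1/2"]
      tight_vertex[OF assms(1)] tight_vertex[OF assms(2)] by simp
  then show "tight I c p = {F, y}" using i by simp
  show "2 * aff m p = aff m (vertex {F, x, y}) + aff m (vertex {F, y, z})"
    unfolding p_def aff_convex by simp
qed

text \<open>The line through the midpoints of two edges of a facet separates its vertices into two
  consecutive runs: a further boundary point on that line would be the third of three collinear
  points of the polygon lying on three different edges.\<close>

lemma facet_separation:
  assumes cyc: "{t\<in>T. F \<in> t} = tris F (a # w @ b # rest @ [a])"
    and dist: "distinct (a # w @ b # rest)" and len: "w \<noteq> [] \<or> rest \<noteq> []"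
  shows "\<exists>m. (\<forall>t\<in>tris F (a # w @ [b]). 0 < aff m (vertex t)) \<and>
             (\<forall>t\<in>tris F (b # rest @ [a]). aff m (vertex t) < 0)"
proof -
  define y where "y = hd (w @ [b])"
  define x where "x = last (b # rest)"
  obtain ws where ws: "w @ [b] = y # ws" unfolding y_def by (cases w) auto
  obtain xs where xs: "b # rest = xs @ [x]" unfolding x_def by (metis append_butlast_last_id list.distinct(1))
  have split: "tris F (a # w @ b # rest @ [a]) = tris F (a # w @ [b]) \<union> tris F (b # rest @ [a])"
    using tris_append[of F "a # w" b "rest @ [a]"] by simp
  have D: "tris F (a # w @ [b]) \<subseteq> T" and E: "tris F (b # rest @ [a]) \<subseteq> T" using cyc split by auto
  have ay: "{F, a, y} \<in> T" using D ws by simp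
  have "tris F (b # rest @ [a]) = tris F (xs @ [x, a])" using xs by (metis append_Cons append_assoc append_Nil)
  then have xa: "{F, x, a} \<in> T" using E tris_append[of F xs x "[a]"] by auto
  have xy: "x \<noteq> y"
  proof (cases w)
    case Nil
    then have "y = b" "rest \<noteq> []" using len by (auto simp: y_def)
    then show ?thesis using dist by (auto simp: x_def)
  next
    case (Cons v vs)
    then have "y = v" by (simp add: y_def)
    moreover have "x \<in> set (b # rest)" unfolding x_def by (rule last_in_set) simp
    ultimately show ?thesis using dist Cons by auto
  qed
  define y' where "y' = last (a # w)"
  define x' where "x' = hd (rest @ [a])"
  have y'b: "{F, y', b} \<in> T"
  proof -
    have "a # w = butlast (a # w) @ [y']" unfolding y'_def by simp
    then have "a # w @ [b] = butlast (a # w) @ y' # [b]" by (metis append_Cons append_assoc append_Nil)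
    then have "{F, y', b} \<in> tris F (a # w @ [b])"
      using tris_append[of F "butlast (a # w)" y' "[b]"] by (simp only:) simp
    then show ?thesis using D by blast
  qed
  have bx': "{F, b, x'} \<in> T" using E by (cases rest) (auto simp: x'_def)
  have x'y': "y' \<noteq> x'"
  proof (cases rest)
    case Nil
    then have "x' = a" "w \<noteq> []" using len by (auto simp: x'_def)
    then show ?thesis using dist by (auto simp: y'_def)
  next
    case (Cons v vs)
    then have "x' = v" by (simp add: x'_def)
    moreover have "y' \<in> set (a # w)" unfolding y'_def by (rule last_in_set) simp
    ultimately show ?thesis using dist Cons by auto
  qed
  define p where "p = (1 - 1/2) *\<^sub>R vertex {F, x, a} + (1/2) *\<^sub>R vertex {F, a, y}"
  define q where "q = (1 - 1/2) *\<^sub>R vertex {F, y', b} + (1/2) *\<^sub>R vertex {F, b, x'}"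
  note P = edge_midpoint[OF xa ay xy, folded p_def]
  note Q = edge_midpoint[OF y'b bx' x'y', folded q_def]
  have ab: "a \<noteq> b" using dist by auto
  have Fa: "F \<noteq> a" "F \<noteq> b" using T_card[OF ay] T_card[OF y'b] by (auto simp: card_insert_if split: if_splits)
  have pq: "\<not> tight I c p \<subseteq> tight I c q" "\<not> tight I c q \<subseteq> tight I c p"
    using ab Fa P(2) Q(2) by auto
  have noline: False if "z \<in> region I c" "z = p + s *\<^sub>R (q - p)"
    "\<not> tight I c z \<subseteq> {F, a}" "\<not> tight I c z \<subseteq> {F, b}" for z s
    using collinear_region[OF P(1) Q(1) that(1,2) pq] that(3,4) P(2) Q(2) by auto
  have big: "\<not> t \<subseteq> {F, i}" if "t \<in> T" for t i
    using T_card[OF that] card_mono[of "{F, i}" t] by (auto simp: card_insert_if split: if_splits)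
  let ?n = "fst (c F)" and ?d = "q - p"
  have n0: "?n \<noteq> 0" using vertex_solve[OF ay, of "\<lambda>_. 1"] by auto
  have d0: "?d \<noteq> 0" using pq by auto
  have onF: "aff (c F) z = 0" if "z \<in> region I c" "F \<in> tight I c z" for z
    using that by (simp add: tight_def)
  have nF: "?n \<bullet> (z - p) = 0" if "aff (c F) z = 0" for z
    using aff_diff[of "c F" z p] that onF[OF P(1)] P(2) by simp
  let ?v = "vertex {F, a, y}"
  define s where "s = (?d \<bullet> (?v - p)) / (?d \<bullet> ?d)"
  \<comment> \<open>The component, orthogonal to the chord, of the vector from \<open>p\<close> to
    this vertex. It is the normal of the chord within the plane of \<open>F\<close> that points to
    the side of the vertex.\<close>
  define u where "u = (?v - p) - s *\<^sub>R ?d"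
  have u0: "u \<noteq> 0"
  proof
    assume "u = 0"
    then have "?v = p + s *\<^sub>R ?d" by (simp add: u_def algebra_simps)
    moreover have "\<not> tight I c ?v \<subseteq> {F, i}" for i using tight_vertex[OF ay] big[OF ay] by metis
    ultimately show False using noline[OF vertex_in[OF ay]] by blast
  qed
  have "(v - ((d \<bullet> v) / (d \<bullet> d)) *\<^sub>R d) \<bullet> d = 0" if "d \<noteq> 0" for v d :: "real^3"
    using that by (simp add: inner_diff_right inner_commute)
  then have ud: "u \<bullet> ?d = 0" unfolding u_def s_def using d0 by blast
  have nu: "?n \<bullet> u = 0"
  proof -
    have "?n \<bullet> (?v - p) = 0" using nF onF[OF vertex_in[OF ay]] tight_vertex[OF ay] by auto
    moreover have "?n \<bullet> ?d = 0" using nF onF[OF Q(1)] Q(2) by auto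
    ultimately show ?thesis unfolding u_def by (simp add: inner_diff_right[of _ "?v - p"])
  qed
  define m where "m = (u, - (u \<bullet> p))"
  have m: "aff m z = u \<bullet> (z - p)" for z by (simp add: m_def aff_def inner_diff_right)
  have mp: "aff m p = 0" by (simp add: m)
  have zero: False if z: "z \<in> region I c" "F \<in> tight I c z" "\<not> tight I c z \<subseteq> {F, a}" "\<not> tight I c z \<subseteq> {F, b}"
    "aff m z = 0" for z
  proof -
    have "z - p = ((?d \<bullet> (z - p)) / (?d \<bullet> ?d)) *\<^sub>R ?d"
      by (rule parallel_in_plane[of ?n u])
        (use n0 u0 nu ud d0 nF onF z m Q in \<open>auto\<close>)
    then have "z = p + ((?d \<bullet> (z - p)) / (?d \<bullet> ?d)) *\<^sub>R ?d" by (metis add.commute diff_add_cancel)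
    then show False using noline z by blast
  qed
  have nz: "aff m (vertex t) \<noteq> 0" if "t \<in> T" "F \<in> t" for t
    using zero[OF vertex_in[OF that(1)]] tight_vertex[OF that(1)] big[OF that(1)] that(2) by auto
  have cross: False if t: "{F, i, j} \<in> T" "{F, j, k} \<in> T" "i \<noteq> k" "j \<notin> {a, b}"
    "0 < aff m (vertex {F, i, j})" "aff m (vertex {F, j, k}) < 0" for i j k
  proof -
    let ?x = "vertex {F, i, j}" and ?y = "vertex {F, j, k}"
    define r where "r = aff m ?x / (aff m ?x - aff m ?y)"
    have r: "0 < r" "r < 1" using t by (auto simp: r_def)
    define z where "z = (1 - r) *\<^sub>R ?x + r *\<^sub>R ?y"
    have "r * (aff m ?x - aff m ?y) = aff m ?x" using t by (simp add: r_def)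
    then have mz: "aff m z = 0" unfolding z_def aff_convex by (simp add: algebra_simps)
    have "tight I c z = {F, i, j} \<inter> {F, j, k}"
      using tight_between(2)[OF vertex_in[OF t(1)] vertex_in[OF t(2)] r] tight_vertex[OF t(1)] tight_vertex[OF t(2)]
      unfolding z_def by simp
    moreover have "j \<noteq> F" using T_card[OF t(1)] by (auto simp: card_insert_if split: if_splits)
    ultimately have "F \<in> tight I c z" "j \<in> tight I c z" "j \<noteq> F" by auto
    moreover have "z \<in> region I c"
      using tight_between(1)[OF vertex_in[OF t(1)] vertex_in[OF t(2)] r] unfolding z_def .
    ultimately show False using zero[of z] mz t(4) by blast
  qed
  have pos: "\<forall>t\<in>tris F (a # y # ws). 0 < aff m (vertex t)"
  proof (rule sign_chain[where a = a and b = b])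
    show "0 < aff m (vertex {F, j, k})" if "{F, i, j} \<in> T" "{F, j, k} \<in> T" "i \<noteq> k" "j \<notin> {a, b}"
      "0 < aff m (vertex {F, i, j})" for i j k
      using cross[OF that] nz[OF that(2)] by force
    show "tris F (a # y # ws) \<subseteq> T" using D ws by simp
    show "distinct (a # y # ws)" using dist ws by (metis append.assoc append_Cons append_Nil distinct_append)
    have "butlast (y # ws) = w" using ws by (metis butlast_snoc)
    then show "set (butlast (y # ws)) \<inter> {a, b} = {}" using dist by auto
    have "u \<bullet> (?v - p) = u \<bullet> u"
    proof -
      have "?v - p = u + s *\<^sub>R ?d" by (simp add: u_def)
      then show ?thesis using ud by (simp add: inner_add_right)
    qed
    then show "0 < aff m ?v" using u0 by (simp add: m)
  qed
  \<comment> \<open>The function \<open>m\<close> vanishes at \<open>p\<close>, the midpoint of the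
    edge from this vertex to one where \<open>m\<close> is positive.\<close>
  have "aff m (vertex {F, x, a}) < 0"
    using P(3)[of m] mp pos by auto
  then have neg1: "0 < aff (- m) (vertex {F, a, x})"
    by (simp add: aff_def insert_commute)
  define zs where "zs = rev xs"
  have rl: "rev (b # rest @ [a]) = a # x # zs" using xs unfolding zs_def
    by (metis append_Cons rev.simps(2) rev_append rev_rev_ident rev_singleton_conv singleton_rev_conv append_Nil)
  have neg: "\<forall>t\<in>tris F (a # x # zs). 0 < aff (- m) (vertex t)"
  proof (rule sign_chain[where a = a and b = b])
    show "0 < aff (- m) (vertex {F, j, k})" if t: "{F, i, j} \<in> T" "{F, j, k} \<in> T" "i \<noteq> k" "j \<notin> {a, b}"
      "0 < aff (- m) (vertex {F, i, j})" for i j k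
    proof -
      have "aff m (vertex {F, i, j}) < 0" using t(5) by (simp add: aff_def)
      then have "\<not> 0 < aff m (vertex {F, j, k})"
        using cross[of k j i] t by (auto simp: insert_commute)
      then have "aff m (vertex {F, j, k}) < 0" using nz[OF t(2)] by force
      then show ?thesis by (simp add: aff_def)
    qed
    show "tris F (a # x # zs) \<subseteq> T" using E rl tris_rev by metis
    have "distinct (b # rest @ [a])" using dist by auto
    then show "distinct (a # x # zs)" using rl distinct_rev by metis
    have "x # zs = rev (b # rest)" using xs zs_def by simp
    then have "butlast (x # zs) = rev rest" by simp
    then show "set (butlast (x # zs)) \<inter> {a, b} = {}" using dist by auto
  qed (rule neg1)
  have "tris F (a # x # zs) = tris F (b # rest @ [a])" using rl tris_rev by metis
  then have "\<forall>t\<in>tris F (b # rest @ [a]). aff m (vertex t) < 0"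
    using neg by (auto simp: aff_def)
  moreover have "\<forall>t\<in>tris F (a # w @ [b]). 0 < aff m (vertex t)" using pos ws by simp
  ultimately show ?thesis by blast
qed

end

lemma exists_small_perturbation:
  fixes A B :: "'t \<Rightarrow> real"
  assumes "finite S" "\<And>t. t \<in> S \<Longrightarrow> 0 < A t"
  shows "\<exists>e>0. \<forall>t\<in>S. 0 < A t - e * B t"
  using assms
proof (induction S rule: finite_induct)
  case empty
  then show ?case by (intro exI[of _ 1]) auto
next
  case (insert s S)
  then obtain e where e: "e > 0" "\<forall>t\<in>S. 0 < A t - e * B t" by auto
  \<comment> \<open>The summand 1 avoids a division by zero and makes the final estimate
    strict.\<close>
  define f where "f = min e (A s / (\<bar>B s\<bar> + 1))"
  have As: "0 < A s" using insert by simp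
  have f: "0 < f" "f \<le> e" "f \<le> A s / (\<bar>B s\<bar> + 1)" using e As by (auto simp: f_def)
  have "f * B t \<le> max 0 (e * B t)" for t
    using f by (cases "0 \<le> B t") (auto simp: mult_right_mono mult_nonneg_nonpos le_max_iff_disj)
  then have "0 < A t - f * B t" if "t \<in> S" for t
    using e(2) that insert.prems[of t] by (smt (verit) insertCI)
  moreover have "f * B s < A s"
  proof -
    have "f * B s \<le> f * \<bar>B s\<bar>" using f by (simp add: mult_left_mono)
    also have "\<dots> < f * (\<bar>B s\<bar> + 1)" using f by simp
    also have "\<dots> \<le> A s" using f(3) by (simp add: pos_le_divide_eq)
    finally show ?thesis .
  qed
  ultimately show ?case using f by (intro exI[of _ f]) auto
qed

section \<open>The cut along a chord\<close>

context simple_system begin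

lemma cut_triplesI:
  assumes "t \<in> T" "t' \<in> T" "0 < aff h (vertex t)" "aff h (vertex t') < 0" "card (t \<inter> t') = 2"
  shows "insert g (t \<inter> t') \<in> cut_triples h g"
  unfolding cut_triples_def using assms by (intro UnI2 CollectI exI[of _ t] exI[of _ t'] conjI refl)

text \<open>Only edges with exactly one end among the removed vertices cross the plane. If both ends
  lie on \<open>F\<close>, the edge is shared with \<open>a\<close> or \<open>b\<close> and yields
  an end of the chord. Otherwise it leaves \<open>F\<close> at a removed vertex, and the crossing
  point has the triple of that vertex with \<open>G\<close> in place of \<open>F\<close>.\<close>

lemma cut_triples_split:
  assumes G: "G \<notin> I" and cyc: "{t\<in>T. F \<in> t} = tris F (a # w @ b # rest @ [a])"
    and dist: "distinct (a # w @ b # rest)" and Fnot: "F \<notin> set (a # w @ b # rest)"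
    and neg: "\<And>t. t \<in> tris F (a # w @ [b]) \<Longrightarrow> aff h (vertex t) < 0"
    and pos: "\<And>t. t \<in> T - tris F (a # w @ [b]) \<Longrightarrow> 0 < aff h (vertex t)"
    and disj: "tris F (a # w @ [b]) \<inter> tris F (b # rest @ [a]) = {}"
  shows "cut_triples h G = split_triples T F G a w b"
proof -
  let ?D = "tris F (a # w @ [b])" and ?E = "tris F (b # rest @ [a])"
  have split: "{t\<in>T. F \<in> t} = ?D \<union> ?E"
    using cyc tris_append[of F "a # w" b "rest @ [a]"] by simp
  have D: "?D \<subseteq> T" and E: "?E \<subseteq> T - ?D" using split disj by blast+
  have plus: "t \<in> T - ?D" if "t \<in> T" "0 < aff h (vertex t)" for t using neg that by force
  have minus: "t \<in> ?D" if "t \<in> T" "aff h (vertex t) < 0" for t using pos that by force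
  have d1: "distinct (a # w @ [b])" and d2: "distinct (b # rest @ [a])" using dist by auto
  have new: "insert G (t \<inter> t') \<in> tris G (a # w @ [b]) \<union> {{G, F, a}, {G, F, b}}"
    if t: "t \<in> T - ?D" "t' \<in> ?D" "card (t \<inter> t') = 2" for t t'
  proof (cases "F \<in> t")
    case True
    then have "t \<in> ?E" using t split by blast
    from tris_elem[OF this d2] obtain x y where xy: "t = {F, x, y}" "x \<in> set (b # rest @ [a])" "y \<in> set (b # rest @ [a])"
      by blast
    from tris_elem[OF t(2) d1] obtain x' y' where xy': "t' = {F, x', y'}" "x' \<in> set (a # w @ [b])" "y' \<in> set (a # w @ [b])"
      by blast
    have "z = a \<or> z = b" if "z \<in> set (b # rest @ [a])" "z \<in> set (a # w @ [b])" for z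
      using that dist by auto
    then have sub: "t \<inter> t' \<subseteq> {F, a, b}" using xy xy' by blast
    have F: "F \<in> t \<inter> t'" using xy xy' by blast
    have "\<not> {F, a, b} \<subseteq> t \<inter> t'" if "F \<noteq> a" "F \<noteq> b" "a \<noteq> b"
    proof
      assume "{F, a, b} \<subseteq> t \<inter> t'"
      then have "card {F, a, b} \<le> 2" using card_mono[of "t \<inter> t'" "{F, a, b}"] t(3) by (metis card.infinite zero_neq_numeral)
      then show False using that by simp
    qed
    moreover have "t \<inter> t' \<noteq> {F}" using t(3) by auto
    ultimately have "t \<inter> t' = {F, a} \<or> t \<inter> t' = {F, b}" using sub F by blast
    then show ?thesis by auto
  next
    case False
    from tris_elem[OF t(2) d1] obtain x y where xy: "t' = {F, x, y}" "x \<noteq> y" by blast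
    then have sub: "t \<inter> t' \<subseteq> t' - {F}" using False by blast
    have "card t' = 3" using T_card D t(2) by blast
    then have "card (t' - {F}) = 2" using xy(1) by (metis card_Diff_singleton insertI1 diff_Suc_1 numeral_2_eq_2 numeral_3_eq_3)
    then have "t \<inter> t' = t' - {F}" using sub t(3) by (metis card.infinite card_subset_eq zero_neq_numeral)
    moreover have "F \<notin> set (a # w @ [b])" using Fnot by auto
    ultimately show ?thesis using tris_rename[of F "a # w @ [b]" G] t(2) by auto
  qed
  have n1: "{G, F, a} \<in> cut_triples h G" and n2: "{G, F, b} \<in> cut_triples h G"
  proof -
    obtain y ws where ws: "w @ [b] = y # ws" by (cases w) auto
    obtain x xs where xs: "b # rest = xs @ [x]" by (metis rev_exhaust list.distinct(1))
    have ay: "{F, a, y} \<in> ?D" using ws by simp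
    have "tris F (b # rest @ [a]) = tris F (xs @ [x, a])" using xs by (metis append_Cons append_assoc append_Nil)
    then have xa: "{F, x, a} \<in> ?E" using tris_append[of F xs x "[a]"] by auto
    have "{F, x, a} \<noteq> {F, a, y}" using ay xa disj by (metis IntI empty_iff)
    then have "x \<noteq> y" by (auto simp: insert_commute)
    moreover have "x \<noteq> F" "y \<noteq> F" "a \<noteq> F" "x \<noteq> a" "y \<noteq> a"
    proof -
      have "x \<in> set (b # rest)" "y \<in> set (w @ [b])" using xs ws by auto
      then show "x \<noteq> F" "y \<noteq> F" "a \<noteq> F" "x \<noteq> a" "y \<noteq> a" using Fnot dist by auto
    qed
    ultimately have i: "{F, x, a} \<inter> {F, a, y} = {F, a}" "card {F, a} = 2" by auto
    have "insert G ({F, x, a} \<inter> {F, a, y}) \<in> cut_triples h G"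
      unfolding cut_triples_def using ay xa D E pos[of "{F, x, a}"] neg[OF ay] i by fastforce
    then show "{G, F, a} \<in> cut_triples h G" using i by simp
  next
    obtain y ws where ws: "a # w = ws @ [y]" by (metis rev_exhaust list.distinct(1))
    obtain x xs where xs: "rest @ [a] = x # xs" by (cases rest) auto
    have "a # w @ [b] = ws @ [y, b]" using ws by (metis append_Cons append_assoc append_Nil)
    then have yb: "{F, y, b} \<in> ?D" using tris_append[of F ws y "[b]"] by (simp only:) simp
    have bx: "{F, b, x} \<in> ?E" using xs by simp
    have "{F, y, b} \<noteq> {F, b, x}" using yb bx disj by (metis IntI empty_iff)
    then have "x \<noteq> y" by (auto simp: insert_commute)
    moreover have "x \<noteq> F" "y \<noteq> F" "b \<noteq> F" "x \<noteq> b" "y \<noteq> b"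
    proof -
      have "x \<in> set (rest @ [a])" "y \<in> set (a # w)" using xs ws by auto
      then show "x \<noteq> F" "y \<noteq> F" "b \<noteq> F" "x \<noteq> b" "y \<noteq> b" using Fnot dist by auto
    qed
    ultimately have i: "{F, b, x} \<inter> {F, y, b} = {F, b}" "card {F, b} = 2" by auto
    have "insert G ({F, b, x} \<inter> {F, y, b}) \<in> cut_triples h G"
      unfolding cut_triples_def using yb bx D E pos[of "{F, b, x}"] neg[OF yb] i by fastforce
    then show "{G, F, b} \<in> cut_triples h G" using i by simp
  qed
  have n3: "t \<in> cut_triples h G" if t: "t \<in> tris G (a # w @ [b])" for t
  proof -
    have "F \<notin> set (a # w @ [b])" using Fnot by auto
    from tris_rename[OF this, of G] t obtain s where s: "s \<in> ?D" "t = insert G (s - {F})" by blast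
    have sT: "s \<in> T" "F \<in> s" using s D split by blast+
    have "card (s - {F}) = 2" using T_card[OF sT(1)] sT(2) by simp
    from two_triples[OF sT(1) _ this] obtain s' where s': "s' \<in> T" "s' \<noteq> s" "s \<inter> s' = s - {F}" by blast
    have "F \<notin> s'" using s'(3) sT(2) by blast
    then have "s' \<in> T - ?D" using s' split by blast
    then have "0 < aff h (vertex s')" by (rule pos)
    moreover have i: "s' \<inter> s = s - {F}" using s'(3) by blast
    ultimately have "insert G (s' \<inter> s) \<in> cut_triples h G"
      using s'(1) sT(1) neg[OF s(1)] \<open>card (s - {F}) = 2\<close> by (intro cut_triplesI) simp_all
    then show ?thesis unfolding i s(2) .
  qed
  show ?thesis
  proof
    show "cut_triples h G \<subseteq> split_triples T F G a w b"
    proof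
      fix t assume "t \<in> cut_triples h G"
      then consider "t \<in> T" "0 < aff h (vertex t)" | p q where "t = insert G (p \<inter> q)" "p \<in> T" "q \<in> T"
        "0 < aff h (vertex p)" "aff h (vertex q) < 0" "card (p \<inter> q) = 2"
        unfolding cut_triples_def by blast
      then show "t \<in> split_triples T F G a w b"
      proof cases
        case 1
        then show ?thesis using plus unfolding split_triples_def by blast
      next
        case 2
        then show ?thesis using new[OF plus minus] unfolding split_triples_def by blast
      qed
    qed
    show "split_triples T F G a w b \<subseteq> cut_triples h G"
      using n1 n2 n3 pos unfolding split_triples_def cut_triples_def[of h G] by blast
  qed
qed

lemma simple_system_split:
  assumes G: "G \<notin> I" and cyc: "{t\<in>T. F \<in> t} = tris F (a # w @ b # rest @ [a])" and FI: "F \<in> I"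
    and dist: "distinct (a # w @ b # rest)" and Fnot: "F \<notin> set (a # w @ b # rest)"
    and setI: "set (a # w @ b # rest) \<subseteq> I" and len: "w \<noteq> [] \<or> rest \<noteq> []"
  shows "\<exists>h. simple_system (insert G I) (c(G := h)) (split_triples T F G a w b)"
    and "{t \<in> split_triples T F G a w b. F \<in> t} = tris F (a # G # b # rest @ [a])"
    and "deg (split_triples T F G a w b) G = length w + 3"
    and "i \<in> I \<Longrightarrow> i \<noteq> F \<Longrightarrow> deg (split_triples T F G a w b) i = deg T i + (if i = a \<or> i = b then 1 else 0)"
proof -
  let ?D = "tris F (a # w @ [b])" and ?E = "tris F (b # rest @ [a])" and ?T = "split_triples T F G a w b"
  have split: "{t\<in>T. F \<in> t} = ?D \<union> ?E"
    using cyc tris_append[of F "a # w" b "rest @ [a]"] by simp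
  obtain m where m: "\<And>t. t \<in> ?D \<Longrightarrow> 0 < aff m (vertex t)" "\<And>t. t \<in> ?E \<Longrightarrow> aff m (vertex t) < 0"
    using facet_separation[OF cyc dist len] by blast
  have disj: "?D \<inter> ?E = {}" using m by force
  have GT: "G \<notin> t" if "t \<in> T" for t using T_sub[OF that] G by blast
  show fcyc: "{t \<in> ?T. F \<in> t} = tris F (a # G # b # rest @ [a])"
  proof -
    have "F \<notin> t" if "t \<in> tris G (a # w @ [b])" for t using tris_subset[OF that] Fnot G FI by auto
    then have "{t \<in> ?T. F \<in> t} = ({t\<in>T. F \<in> t} - ?D) \<union> {{G, F, a}, {G, F, b}}"
      unfolding split_triples_def by blast
    also have "\<dots> = ?E \<union> {{G, F, a}, {G, F, b}}" using split disj by blast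
    finally show ?thesis by (simp add: insert_commute)
  qed
  have D: "?D \<subseteq> T" using split by blast
  have ds: "F \<notin> set (a # w @ [b])" "G \<noteq> F" "distinct (a # w @ [b])" "G \<notin> set (a # w @ [b])"
    using Fnot G FI dist setI by auto
  show dG: "deg ?T G = length w + 3" using deg_split(1)[OF finite_T GT D ds] by simp
  have dI: "deg ?T i = deg T i + (if i = a \<or> i = b then 1 else 0)" if "i \<in> I" "i \<noteq> F" for i
  proof -
    have "i \<noteq> G" using that G by blast
    then show ?thesis using deg_split(2)[OF finite_T GT D ds that(2)] by simp
  qed
  then show "deg ?T i = deg T i + (if i = a \<or> i = b then 1 else 0)" if "i \<in> I" "i \<noteq> F" using that .
  have "\<exists>e>0. \<forall>t\<in>{t\<in>T. F \<notin> t}. 0 < aff (c F) (vertex t) - e * aff m (vertex t)"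
    using finite_T aff_vertex_pos FI by (intro exists_small_perturbation) auto
  then obtain e where e: "e > 0" "\<And>t. t \<in> T \<Longrightarrow> F \<notin> t \<Longrightarrow> 0 < aff (c F) (vertex t) - e * aff m (vertex t)"
    by blast
  \<comment> \<open>The plane of \<open>F\<close> rotated about the chord. On \<open>F\<close> the
    function \<open>c F\<close> vanishes, so \<open>h\<close> has the sign of \<open>- m\<close>; at
    the vertices off \<open>F\<close> the choice of \<open>e\<close> keeps it positive.\<close>
  define h where "h = c F - e *\<^sub>R m"
  have hF: "aff h (vertex t) = - e * aff m (vertex t)" if "t \<in> T" "F \<in> t" for t
    using aff_vertex_eq_0_iff[OF that(1) FI] that(2) by (simp add: h_def aff_minus aff_scaleR)
  have neg: "aff h (vertex t) < 0" if "t \<in> ?D" for t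
  proof -
    have "t \<in> T" "F \<in> t" using that split by blast+
    then show ?thesis using hF[of t] m(1)[OF that] e(1) by simp
  qed
  have pos: "0 < aff h (vertex t)" if "t \<in> T - ?D" for t
  proof (cases "F \<in> t")
    case True
    then have "t \<in> ?E" using that split by blast
    then show ?thesis using hF[of t] m(2)[of t] that True e(1) by (simp add: mult_pos_neg)
  next
    case False
    then show ?thesis using e(2)[of t] that by (simp add: h_def aff_minus aff_scaleR)
  qed
  have eq: "cut_triples h G = ?T" by (rule cut_triples_split[OF G cyc dist Fnot neg pos disj])
  have "simple_system (insert G I) (c(G := h)) (cut_triples h G)"
  proof (rule simple_system_cut[OF G])
    show "aff h (vertex t) \<noteq> 0" if "t \<in> T" for t using neg[of t] pos[of t] that by force
    have GFa: "{G, F, a} \<in> ?T" by (simp add: split_triples_def)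
    have "i \<in> \<Union>?T" if i: "i \<in> I" "i \<noteq> F" for i
    proof -
      obtain t where "t \<in> T" "i \<in> t" using cover i by blast
      then have "deg T i \<noteq> 0" using finite_T by (auto simp: deg_def)
      then have "deg ?T i \<noteq> 0" using dI[OF i] by simp
      then show ?thesis unfolding deg_def by (metis (mono_tags, lifting) UnionI card.empty empty_Collect_eq)
    qed
    then show "insert G I \<subseteq> \<Union>(cut_triples h G)" unfolding eq using GFa by blast
  qed
  then show "\<exists>h. simple_system (insert G I) (c(G := h)) ?T" unfolding eq by blast
qed

end

section \<open>Polytopes with a distinguished facet and the cyclic word of its neighbours\<close>

definition cyclic_link :: "'i set set \<Rightarrow> 'i \<Rightarrow> 'i list \<Rightarrow> bool" where
  "cyclic_link T F fs \<longleftrightarrow> distinct fs \<and> F \<notin> set fs \<and> 3 \<le> length fs \<and> {t\<in>T. F \<in> t} = tris F (fs @ [hd fs])"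

text \<open>The facet \<open>F\<close> is the one that is split again and again. Its neighbours have
  sizes \<open>ws\<close>, the facets away from it have sizes \<open>M\<close>, and its own size is
  the length of \<open>ws\<close>. With natural numbers as indices a fresh one is always
  available.\<close>

definition realized :: "nat list \<Rightarrow> nat multiset \<Rightarrow> bool" where
  "realized ws M \<longleftrightarrow> (\<exists>(I :: nat set) c T F fs. simple_system I c T \<and> F \<in> I \<and> set fs \<subseteq> I \<and>
     cyclic_link T F fs \<and> ws = map (deg T) fs \<and>
     M = image_mset (deg T) (mset_set (I - insert F (set fs))))"

lemma realized_rotate:
  assumes "realized (x # ws) M"
  shows "realized (ws @ [x]) M"
proof -
  obtain I c T F fs where r: "simple_system (I :: nat set) c T" "F \<in> I" "set fs \<subseteq> I"
    "cyclic_link T F fs" "x # ws = map (deg T) fs"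
    "M = image_mset (deg T) (mset_set (I - insert F (set fs)))"
    using assms unfolding realized_def by (elim exE conjE) (rule that)
  obtain a gs where fs: "fs = a # gs" using r(5) by (cases fs) auto
  then obtain b hs where gs: "gs = b # hs" using r(4) by (cases gs) (auto simp: cyclic_link_def)
  have "tris F (gs @ [a] @ [hd (gs @ [a])]) = tris F (gs @ a # [b])" by (simp add: gs)
  also have "\<dots> = tris F (gs @ [a]) \<union> tris F [a, b]" by (rule tris_append)
  also have "\<dots> = tris F (fs @ [hd fs])" by (simp add: fs gs)
  finally have "cyclic_link T F (gs @ [a])" using r(4) by (auto simp: cyclic_link_def fs)
  moreover have "set (gs @ [a]) = set fs" by (auto simp: fs)
  moreover have "ws @ [x] = map (deg T) (gs @ [a])" using r(5) by (simp add: fs)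
  ultimately show ?thesis unfolding realized_def using r(1,2,3,6) by metis
qed

text \<open>The new facet meets \<open>F\<close>, the two end facets and the closed ones, which
  explains its size. The closed facets no longer touch \<open>F\<close> and move to
  \<open>M\<close>.\<close>

lemma realized_split:
  assumes "realized (x # ws @ y # vs) M"
  shows "realized (Suc x # (length ws + 3) # Suc y # vs) (M + mset ws)"
proof -
  obtain I c T F fs where r: "simple_system (I :: nat set) c T" "F \<in> I" "set fs \<subseteq> I"
    "cyclic_link T F fs" "x # ws @ y # vs = map (deg T) fs"
    "M = image_mset (deg T) (mset_set (I - insert F (set fs)))"
    using assms unfolding realized_def by (elim exE conjE) (rule that)
  interpret simple_system I c T by (rule r(1))
  obtain a w b rest where fs: "fs = a # w @ b # rest" and
    lab: "x = deg T a" "ws = map (deg T) w" "y = deg T b" "vs = map (deg T) rest"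
    using r(5) by (auto simp: Cons_eq_map_conv append_eq_map_conv)
  obtain G where G: "G \<notin> I" using ex_new_if_finite[OF infinite_UNIV_nat finite_I] by blast
  have link: "distinct (a # w @ b # rest)" "F \<notin> set (a # w @ b # rest)" "w \<noteq> [] \<or> rest \<noteq> []"
    "{t\<in>T. F \<in> t} = tris F (a # w @ b # rest @ [a])"
    using r(4) by (auto simp: cyclic_link_def fs)
  have setI: "set (a # w @ b # rest) \<subseteq> I" using r(3) fs by simp
  let ?T = "split_triples T F G a w b"
  note S = simple_system_split[OF G link(4) r(2) link(1) link(2) setI link(3)]
  obtain h where h: "simple_system (insert G I) (c(G := h)) ?T" using S(1) by blast
  have dT: "deg ?T i = deg T i" if "i \<in> I" "i \<noteq> F" "i \<noteq> a" "i \<noteq> b" for i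
    using S(4)[OF that(1,2)] that by simp
  let ?fs = "a # G # b # rest"
  have "cyclic_link ?T F ?fs"
    using S(2) link(1,2) G setI r(2) by (auto simp: cyclic_link_def)
  moreover have "Suc x # (length ws + 3) # Suc y # vs = map (deg ?T) ?fs"
  proof -
    have "deg ?T a = Suc x" "deg ?T b = Suc y" using S(4) link setI lab by auto
    moreover have "map (deg ?T) rest = vs" unfolding lab(4)
      using link setI by (intro map_cong refl dT) auto
    ultimately show ?thesis using S(3) lab by simp
  qed
  moreover have "M + mset ws = image_mset (deg ?T) (mset_set (insert G I - insert F (set ?fs)))"
  proof -
    have eq: "insert G I - insert F (set ?fs) = (I - insert F (set fs)) \<union> set w"
      using link setI G by (auto simp: fs)
    have "mset_set ((I - insert F (set fs)) \<union> set w) = mset_set (I - insert F (set fs)) + mset_set (set w)"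
      using finite_I by (intro mset_set_Union) (auto simp: fs)
    moreover have "image_mset (deg ?T) (mset_set (I - insert F (set fs))) = M"
      unfolding r(6) using finite_I by (intro image_mset_cong dT) (auto simp: fs)
    moreover have "image_mset (deg ?T) (mset_set (set w)) = mset ws"
    proof -
      have "mset_set (set w) = mset w" using link(1) by (intro mset_set_set) auto
      then have "image_mset (deg ?T) (mset_set (set w)) = mset (map (deg ?T) w)" by simp
      also have "map (deg ?T) w = ws" unfolding lab(2)
        using link setI by (intro map_cong refl dT) auto
      finally show ?thesis .
    qed
    ultimately show ?thesis unfolding eq by simp
  qed
  moreover have "set ?fs \<subseteq> insert G I" using setI by auto
  moreover have "F \<in> insert G I" using r(2) by blast
  ultimately show ?thesis unfolding realized_def using h
    by (intro exI[of _ "insert G I"] exI[of _ "c(G := h)"] exI[of _ ?T] exI[of _ F] exI[of _ ?fs] conjI)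
qed

section \<open>The simplex\<close>

definition simplex_system :: "nat \<Rightarrow> (real^3) \<times> real" where
  "simplex_system i = (if i = 0 then (vector [1,0,0], 0) else if i = 1 then (vector [0,1,0], 0)
     else if i = 2 then (vector [0,0,1], 0) else (vector [-1,-1,-1], 1))"

lemma aff_simplex:
  "aff (simplex_system 0) x = x$1" "aff (simplex_system (Suc 0)) x = x$2" "aff (simplex_system 2) x = x$3"
  "aff (simplex_system 3) x = 1 - x$1 - x$2 - x$3"
  by (simp_all add: aff_def simplex_system_def inner_vec_def sum_3)

lemma fst_simplex:
  "fst (simplex_system 0) \<bullet> x = x$1" "fst (simplex_system (Suc 0)) \<bullet> x = x$2" "fst (simplex_system 2) \<bullet> x = x$3"
  "fst (simplex_system 3) \<bullet> x = - x$1 - x$2 - x$3"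
  by (simp_all add: simplex_system_def inner_vec_def sum_3)

lemma simple_system_simplex:
  "simple_system {0,1,2,3} simplex_system {{0,1,2},{0,1,3},{0,2,3},{1,2,3}}"
proof -
  let ?I = "{0,1,2,3} :: nat set" and ?c = simplex_system
  let ?T = "{{0,1,2},{0,1,3},{0,2,3},{1,2,3}} :: nat set set"
  have reg: "x \<in> region ?I ?c \<longleftrightarrow> 0 \<le> x$1 \<and> 0 \<le> x$2 \<and> 0 \<le> x$3 \<and> x$1 + x$2 + x$3 \<le> 1" for x
    by (auto simp: region_def aff_simplex)
  have ti: "tight ?I ?c x = (if x$1 = 0 then {0} else {}) \<union> (if x$2 = 0 then {1} else {}) \<union>
    (if x$3 = 0 then {2} else {}) \<union> (if x$1 + x$2 + x$3 = 1 then {3} else {})" for x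
  proof (rule set_eqI)
    fix i :: nat
    consider "i = 0" | "i = 1" | "i = 2" | "i = 3" | "i \<notin> ?I" by blast
    then show "i \<in> tight ?I ?c x \<longleftrightarrow> i \<in> (if x$1 = 0 then {0} else {}) \<union> (if x$2 = 0 then {1} else {}) \<union>
      (if x$3 = 0 then {2} else {}) \<union> (if x$1 + x$2 + x$3 = 1 then {3} else {})"
      by cases (auto simp: tight_def aff_simplex)
  qed
  have sub: "tight ?I ?c x \<in> ?T" if "rigid (tight ?I ?c x) ?c" for x
  proof -
    have "3 \<le> card (tight ?I ?c x)" by (rule rigid_card_ge[OF _ that]) (simp add: tight_def)
    then show ?thesis unfolding ti by (simp split: if_splits add: insert_commute)
  qed
  have att: "\<exists>x\<in>region ?I ?c. tight ?I ?c x = t \<and> rigid t ?c" if "t \<in> ?T" for t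
  proof -
    have r: "rigid {0,1,2} ?c" "rigid {0,1,3} ?c" "rigid {0,2,3} ?c" "rigid {1,2,3} ?c"
      by (simp_all add: rigid_def fst_simplex vec_eq_iff forall_3)
    have "vector [0,0,0] \<in> region ?I ?c" "tight ?I ?c (vector [0,0,0]) = {0,1,2}"
      "vector [0,0,1] \<in> region ?I ?c" "tight ?I ?c (vector [0,0,1]) = {0,1,3}"
      "vector [0,1,0] \<in> region ?I ?c" "tight ?I ?c (vector [0,1,0]) = {0,2,3}"
      "vector [1,0,0] \<in> region ?I ?c" "tight ?I ?c (vector [1,0,0]) = {1,2,3}"
      unfolding reg ti by auto
    then show ?thesis using r that by blast
  qed
  show ?thesis
  proof
    have "region ?I ?c \<subseteq> cbox 0 (vec 1)" by (rule subsetI, unfold reg) (auto simp: mem_box_cart forall_3)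
    then show "bounded (region ?I ?c)" using bounded_cbox bounded_subset by blast
    show "card (tight ?I ?c x) = 3" if "x \<in> region ?I ?c" "rigid (tight ?I ?c x) ?c" for x
      using sub[OF that(2)] by auto
    show "?T = tight ?I ?c ` {x \<in> region ?I ?c. rigid (tight ?I ?c x) ?c}"
    proof (rule equalityI; rule subsetI)
      fix t assume "t \<in> ?T"
      from att[OF this] obtain x where "x \<in> region ?I ?c" "tight ?I ?c x = t" "rigid t ?c" by blast
      then show "t \<in> tight ?I ?c ` {x \<in> region ?I ?c. rigid (tight ?I ?c x) ?c}"
        by (intro image_eqI[of _ _ x] CollectI conjI) simp_all
    next
      fix t assume "t \<in> tight ?I ?c ` {x \<in> region ?I ?c. rigid (tight ?I ?c x) ?c}"
      then obtain x where "t = tight ?I ?c x" "rigid (tight ?I ?c x) ?c" by (elim imageE CollectE conjE)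
      then show "t \<in> ?T" using sub by (simp only:)
    qed
    show "?I \<subseteq> \<Union>?T" by (simp add: subset_iff)
  qed simp_all
qed

lemma realized_simplex: "realized [3,3,3] {#}"
proof -
  let ?T = "{{0,1,2},{0,1,3},{0,2,3},{1,2,3}} :: nat set set"
  have neI: "a \<in> A \<Longrightarrow> a \<notin> B \<Longrightarrow> A \<noteq> B" for a :: nat and A B by blast
  have ne: "{0,1,2} \<noteq> {0,1,3::nat}" "{0,1,2} \<noteq> {0,2,3::nat}" "{0,1,2} \<noteq> {1,2,3::nat}"
    "{0,1,3} \<noteq> {0,2,3::nat}" "{0,1,3} \<noteq> {1,2,3::nat}" "{0,2,3} \<noteq> {1,2,3::nat}"
    by (rule neI[of 2], simp, simp, rule neI[of 1], simp, simp, rule neI[of 0], simp, simp,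
        rule neI[of 1], simp, simp, rule neI[of 0], simp, simp, rule neI[of 0], simp, simp)
  have filter_insert: "{t\<in>insert a A. i \<in> t} = (if i \<in> a then insert a {t\<in>A. i \<in> t} else {t\<in>A. i \<in> t})"
    for a A and i :: nat by auto
  have "{t\<in>?T. 0 \<in> t} = {{0,1,2},{0,1,3},{0,2,3}}" "{t\<in>?T. 1 \<in> t} = {{0,1,2},{0,1,3},{1,2,3}}"
    "{t\<in>?T. 2 \<in> t} = {{0,1,2},{0,2,3},{1,2,3}}" unfolding filter_insert by simp_all
  then have d: "deg ?T 0 = 3" "deg ?T 1 = 3" "deg ?T 2 = 3"
    unfolding deg_def using ne by simp_all
  have t3: "{t\<in>?T. 3 \<in> t} = {{0,1,3},{0,2,3},{1,2,3}}" unfolding filter_insert by simp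
  have "tris 3 ([0,1,2] @ [hd [0,1,2]]) = {{3,0,1},{3,1,2},{3,2,0::nat}}" by simp
  also have "\<dots> = {{0,1,3},{0,2,3},{1,2,3}}" by (simp add: insert_commute)
  finally have "cyclic_link ?T 3 [0,1,2]" unfolding cyclic_link_def t3 by simp
  moreover have "{0,1,2,3} - insert 3 (set [0,1,2::nat]) = {}" by auto
  ultimately show ?thesis unfolding realized_def using simple_system_simplex d
    by (intro exI[of _ "{0,1,2,3}"] exI[of _ simplex_system] exI[of _ ?T] exI[of _ 3] exI[of _ "[0,1,2]"] conjI)
      (simp_all add: insert_Diff_if)
qed

section \<open>Chamfering\<close>

lemma aff_sum: "finite A \<Longrightarrow> aff (sum c A) x = (\<Sum>i\<in>A. aff (c i) x)"
  by (induction A rule: finite_induct) (auto simp: aff_plus, simp add: aff_def)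

lemma fst_sum_inner: "finite A \<Longrightarrow> fst (sum c A) \<bullet> d = (\<Sum>i\<in>A. fst (c i) \<bullet> d)"
  by (induction A rule: finite_induct) (auto simp: inner_add_left)

context simple_system begin

definition edges :: "'i set set" where
  "edges = {e. card e = 2 \<and> (\<exists>t\<in>T. e \<subseteq> t)}"

definition core :: "'i set \<Rightarrow> 'i set set" where
  "core t = {e. e \<subseteq> t \<and> card e = 2}"

definition corner :: "'i \<Rightarrow> 'i set \<Rightarrow> 'i set set" where
  "corner i t = insert {i} {e. i \<in> e \<and> e \<subseteq> t \<and> card e = 2}"

text \<open>Old facets are indexed by singletons and new hexagons by the two facets at their edge,
  so that one index type serves both.\<close>

definition chamfer_index :: "'i set set" where
  "chamfer_index = (\<lambda>i. {i}) ` I \<union> edges"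

text \<open>For \<open>{i}\<close> this is \<open>c i\<close>; for \<open>{i, j}\<close> it is
  \<open>c i + c j\<close> lowered by \<epsilon>, a plane that cuts off the edge. The factor
  \<open>card e - 1\<close> covers both cases.\<close>

definition chamfer_system :: "real \<Rightarrow> 'i set \<Rightarrow> (real^3) \<times> real" where
  "chamfer_system \<epsilon> e = sum c e - (0, (real (card e) - 1) * \<epsilon>)"

text \<open>An old vertex gives way to four: the \<open>core\<close>, where the hexagons over its
  three edges meet, and for each of its facets the \<open>corner\<close>, where the shrunken facet
  meets two of these hexagons.\<close>

definition chamfer_triples :: "'i set set set" where
  "chamfer_triples = core ` T \<union> {corner i t | i t. t \<in> T \<and> i \<in> t}"

lemma two_subsets:
  assumes "distinct [i,j,k]"
  shows "{e. e \<subseteq> {i,j,k} \<and> card e = 2} = {{i,j},{i,k},{j,k}}"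
proof
  show "{e. e \<subseteq> {i,j,k} \<and> card e = 2} \<subseteq> {{i,j},{i,k},{j,k}}"
  proof
    fix e assume "e \<in> {e. e \<subseteq> {i,j,k} \<and> card e = 2}"
    then obtain a b where "e = {a,b}" "a \<noteq> b" "a \<in> {i,j,k}" "b \<in> {i,j,k}" by (auto simp: card_2_iff)
    then show "e \<in> {{i,j},{i,k},{j,k}}" by (auto simp: insert_commute)
  qed
qed (use assms in auto)

lemma core_eq: "distinct [i,j,k] \<Longrightarrow> core {i,j,k} = {{i,j},{i,k},{j,k}}"
  unfolding core_def by (rule two_subsets)

lemma corner_eq: "distinct [i,j,k] \<Longrightarrow> corner i {i,j,k} = {{i},{i,j},{i,k}}"
proof -
  assume d: "distinct [i,j,k]"
  have "{e. i \<in> e \<and> e \<subseteq> {i,j,k} \<and> card e = 2} = {e \<in> {{i,j},{i,k},{j,k}}. i \<in> e}"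
    using two_subsets[OF d] by auto
  then show ?thesis using d by (auto simp: corner_def)
qed

lemma T_ijk:
  assumes "t \<in> T" "i \<in> t"
  obtains j k where "t = {i,j,k}" "distinct [i,j,k]"
proof -
  have "card (t - {i}) = 2" using T_card[OF assms(1)] T_finite[OF assms(1)] assms(2) by simp
  then obtain j k where "t - {i} = {j,k}" "j \<noteq> k" by (auto simp: card_2_iff)
  then have "t = {i,j,k}" "distinct [i,j,k]" using assms(2) by auto
  then show thesis using that by blast
qed

lemma aff_chamfer: "finite e \<Longrightarrow> aff (chamfer_system \<epsilon> e) x = (\<Sum>i\<in>e. aff (c i) x) - (real (card e) - 1) * \<epsilon>"
proof -
  assume "finite e"
  then show ?thesis unfolding chamfer_system_def aff_minus by (simp add: aff_sum) (simp add: aff_def)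
qed

lemma fst_chamfer: "finite e \<Longrightarrow> fst (chamfer_system \<epsilon> e) \<bullet> d = (\<Sum>i\<in>e. fst (c i) \<bullet> d)"
  unfolding chamfer_system_def by (simp add: fst_sum_inner)

lemma edges_ij: "t \<in> T \<Longrightarrow> i \<in> t \<Longrightarrow> j \<in> t \<Longrightarrow> i \<noteq> j \<Longrightarrow> {i,j} \<in> edges"
  by (auto simp: edges_def)

lemma region_chamfer:
  "x \<in> region chamfer_index (chamfer_system \<epsilon>) \<longleftrightarrow>
     x \<in> region I c \<and> (\<forall>i j. {i,j} \<in> edges \<longrightarrow> i \<noteq> j \<longrightarrow> \<epsilon> \<le> aff (c i) x + aff (c j) x)"
proof -
  have "0 \<le> aff (chamfer_system \<epsilon> {i}) x \<longleftrightarrow> 0 \<le> aff (c i) x" for i by (simp add: aff_chamfer)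
  moreover have "0 \<le> aff (chamfer_system \<epsilon> {i,j}) x \<longleftrightarrow> \<epsilon> \<le> aff (c i) x + aff (c j) x" if "i \<noteq> j" for i j
    using that by (simp add: aff_chamfer)
  moreover have "(\<forall>e\<in>edges. P e) \<longleftrightarrow> (\<forall>i j. {i,j} \<in> edges \<longrightarrow> i \<noteq> j \<longrightarrow> P {i,j})" for P
    unfolding edges_def by (auto simp: card_2_iff)
  ultimately show ?thesis
    unfolding region_def chamfer_index_def by (simp add: ball_Un)
qed

lemma tight_chamfer:
  "{i} \<in> tight chamfer_index (chamfer_system \<epsilon>) x \<longleftrightarrow> i \<in> I \<and> aff (c i) x = 0"
  "i \<noteq> j \<Longrightarrow> {i,j} \<in> tight chamfer_index (chamfer_system \<epsilon>) x \<longleftrightarrow> {i,j} \<in> edges \<and> aff (c i) x + aff (c j) x = \<epsilon>"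
proof -
  have "{i} \<in> chamfer_index \<longleftrightarrow> i \<in> I" by (auto simp: chamfer_index_def edges_def)
  then show "{i} \<in> tight chamfer_index (chamfer_system \<epsilon>) x \<longleftrightarrow> i \<in> I \<and> aff (c i) x = 0"
    by (simp add: tight_def aff_chamfer)
  assume ij: "i \<noteq> j"
  then have "{i,j} \<in> chamfer_index \<longleftrightarrow> {i,j} \<in> edges" by (auto simp: chamfer_index_def doubleton_eq_iff)
  then show "{i,j} \<in> tight chamfer_index (chamfer_system \<epsilon>) x \<longleftrightarrow> {i,j} \<in> edges \<and> aff (c i) x + aff (c j) x = \<epsilon>"
    using ij by (auto simp: tight_def aff_chamfer)
qed

lemma chamfer_index_cases:
  assumes "e \<in> chamfer_index"
  obtains i where "e = {i}" "i \<in> I" | i j where "e = {i,j}" "i \<noteq> j" "{i,j} \<in> edges"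
proof (cases "e \<in> edges")
  case True
  then obtain i j where "e = {i,j}" "i \<noteq> j" by (auto simp: edges_def card_2_iff)
  then show thesis using that(2) True by blast
next
  case False
  then show thesis using assms that(1) by (auto simp: chamfer_index_def)
qed

lemma finite_chamfer_index: "finite chamfer_index"
proof -
  have "edges \<subseteq> Pow I" using T_sub by (auto simp: edges_def)
  then have "finite edges" using finite_I by (meson finite_Pow_iff finite_subset)
  then show ?thesis using finite_I by (simp add: chamfer_index_def)
qed

text \<open>If \<open>J\<close> lies in no vertex triple, its constraints never vanish together, so
  by compactness their sum has a positive minimum and they are never all small. There are only
  finitely many such \<open>J\<close>.\<close>

lemma small_coordinates:
  "\<exists>\<delta>>0. \<forall>x\<in>region I c. \<exists>t\<in>T. {i\<in>I. aff (c i) x \<le> \<delta>} \<subseteq> t"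
proof -
  define B where "B = {J. J \<subseteq> I \<and> (\<forall>t\<in>T. \<not> J \<subseteq> t)}"
  have finB: "finite B" using finite_I by (auto simp: B_def)
  have ne: "region I c \<noteq> {}" using T_nonempty vertex_in by blast
  have comp: "compact (region I c)" using bounded_reg closed_region by (simp add: compact_eq_bounded_closed)
  have "\<exists>\<delta>>0. \<forall>x\<in>region I c. \<exists>i\<in>J. \<delta> < aff (c i) x" if J: "J \<in> B" for J
  proof -
    have finJ: "finite J" using J finite_I finite_subset by (auto simp: B_def)
    have "continuous_on (region I c) (\<lambda>x. \<Sum>i\<in>J. aff (c i) x)"
      by (intro continuous_on_sum continuous_aff)
    then obtain z where z: "z \<in> region I c" "\<And>x. x \<in> region I c \<Longrightarrow> (\<Sum>i\<in>J. aff (c i) z) \<le> (\<Sum>i\<in>J. aff (c i) x)"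
      using continuous_attains_inf[OF comp ne] by blast
    obtain t where t: "t \<in> T" "tight I c z \<subseteq> t" using tight_subset_T[OF z(1)] by blast
    have "\<not> J \<subseteq> tight I c z" using J t unfolding B_def by blast
    then obtain j where j: "j \<in> J" "j \<notin> tight I c z" by blast
    have JI: "J \<subseteq> I" using J by (simp add: B_def)
    have nn: "0 \<le> aff (c i) z" if "i \<in> J" for i using z(1) JI that by (auto simp: region_def)
    moreover have "aff (c j) z \<noteq> 0" using j JI by (auto simp: tight_def)
    ultimately have pos: "0 < (\<Sum>i\<in>J. aff (c i) z)"
      using j(1) finJ by (intro sum_pos2[of J j]) (auto simp: order_le_less)
    define \<delta> where "\<delta> = (\<Sum>i\<in>J. aff (c i) z) / (real (card J) + 1)"
    have d0: "0 < \<delta>" using pos by (simp add: \<delta>_def add_nonneg_pos)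
    have "\<exists>i\<in>J. \<delta> < aff (c i) x" if x: "x \<in> region I c" for x
    proof (rule ccontr)
      assume "\<not> (\<exists>i\<in>J. \<delta> < aff (c i) x)"
      then have "(\<Sum>i\<in>J. aff (c i) x) \<le> (\<Sum>i\<in>J. \<delta>)" by (intro sum_mono) auto
      also have "\<dots> = real (card J) * \<delta>" by simp
      also have "\<dots> < (real (card J) + 1) * \<delta>" using d0 by simp
      also have "\<dots> = (\<Sum>i\<in>J. aff (c i) z)" by (simp add: \<delta>_def)
      finally show False using z(2)[OF x] by simp
    qed
    then show ?thesis using d0 by blast
  qed
  then obtain \<delta> where d: "\<And>J. J \<in> B \<Longrightarrow> 0 < \<delta> J" "\<And>J x. J \<in> B \<Longrightarrow> x \<in> region I c \<Longrightarrow> \<exists>i\<in>J. \<delta> J < aff (c i) x"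
    by metis
  define m where "m = Min (insert 1 (\<delta> ` B))"
  have m: "0 < m" "\<And>J. J \<in> B \<Longrightarrow> m \<le> \<delta> J" using d finB by (auto simp: m_def)
  have "\<exists>t\<in>T. {i\<in>I. aff (c i) x \<le> m} \<subseteq> t" if x: "x \<in> region I c" for x
  proof (rule ccontr)
    assume "\<not> (\<exists>t\<in>T. {i\<in>I. aff (c i) x \<le> m} \<subseteq> t)"
    then have J: "{i\<in>I. aff (c i) x \<le> m} \<in> B" by (auto simp: B_def)
    then show False using d(2)[OF J x] m(2)[OF J] by force
  qed
  then show ?thesis using m(1) by blast
qed

text \<open>One depth serves two purposes: the constraints of value at most \<epsilon> at a point
  all belong to a single old vertex, and the four new vertices near each old one exist. The
  functions \<open>g\<close> are the coordinates of the latter in units of \<epsilon>: three times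
  1/2 for the core, and 0, 1, 1 for a corner.\<close>

lemma chamfer_parameter:
  "\<exists>\<epsilon>>0. (\<forall>x\<in>region I c. \<exists>t\<in>T. {i\<in>I. aff (c i) x \<le> \<epsilon>} \<subseteq> t) \<and>
     (\<forall>t\<in>T. \<forall>g\<in>insert (\<lambda>_. 1/2) ((\<lambda>i j. if j = i then 0 else 1) ` t).
        \<exists>x. (\<forall>i\<in>t. aff (c i) x = \<epsilon> * g i) \<and> (\<forall>i\<in>I - t. \<epsilon> < aff (c i) x))"
proof -
  obtain \<delta> where d: "\<delta> > 0" "\<forall>x\<in>region I c. \<exists>t\<in>T. {i\<in>I. aff (c i) x \<le> \<delta>} \<subseteq> t"
    using small_coordinates by blast
  define G where "G t = insert (\<lambda>_. 1/2) ((\<lambda>i j. if j = i then 0 else 1 :: real) ` t)" for t :: "'i set"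
  define S where "S = (SIGMA t:T. G t \<times> (I - t))"
  have finS: "finite S" unfolding S_def G_def using finite_T T_finite finite_I by auto
  obtain D where D: "\<And>t g i. t \<in> T \<Longrightarrow> i \<in> t \<Longrightarrow> fst (c i) \<bullet> D t g = g i"
    using vertex_solve by metis
  have "\<exists>e>0. \<forall>s\<in>insert None (Some ` S).
     0 < (case s of None \<Rightarrow> \<delta> | Some (t,g,i) \<Rightarrow> aff (c i) (vertex t)) -
       e * (case s of None \<Rightarrow> 1 | Some (t,g,i) \<Rightarrow> 1 - fst (c i) \<bullet> D t g)"
    using finS d(1) aff_vertex_pos by (intro exists_small_perturbation) (auto simp: S_def)
  then obtain e where e: "e > 0" "e < \<delta>"
    "\<And>t g i. t \<in> T \<Longrightarrow> g \<in> G t \<Longrightarrow> i \<in> I - t \<Longrightarrow> 0 < aff (c i) (vertex t) - e * (1 - fst (c i) \<bullet> D t g)"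
    by (force simp: S_def)
  have pts: "\<exists>x. (\<forall>i\<in>t. aff (c i) x = e * g i) \<and> (\<forall>i\<in>I - t. e < aff (c i) x)" if t: "t \<in> T" "g \<in> G t" for t g
  proof (intro exI conjI ballI)
    fix i assume "i \<in> t"
    then show "aff (c i) (vertex t + e *\<^sub>R D t g) = e * g i"
      using D[OF t(1)] aff_vertex_eq_0_iff[OF t(1)] T_sub[OF t(1)] by (auto simp: aff_add_scaleR)
  next
    fix i assume "i \<in> I - t"
    then show "e < aff (c i) (vertex t + e *\<^sub>R D t g)"
      using e(3)[OF t] by (force simp: aff_add_scaleR algebra_simps)
  qed
  have loc: "\<exists>t\<in>T. {i\<in>I. aff (c i) x \<le> e} \<subseteq> t" if "x \<in> region I c" for x
  proof -
    obtain t where "t \<in> T" "{i\<in>I. aff (c i) x \<le> \<delta>} \<subseteq> t" using d(2) \<open>x \<in> region I c\<close> by blast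
    then show ?thesis using e(2) by (intro bexI[of _ t]) auto
  qed
  show ?thesis
    using e(1) loc pts[unfolded G_def] by (intro exI[of _ e] conjI ballI)
qed

text \<open>Tight constraints involve only coordinates of size at most \<epsilon>, hence only one
  old vertex \<open>t\<close>, and rigidity makes them involve all of \<open>t\<close>. If one
  coordinate vanishes, the edge constraints force the other two to equal \<epsilon>, which is a
  corner. Otherwise only the three edge constraints can be tight, and rigidity needs them
  all.\<close>

lemma chamfer_vertex:
  assumes eps: "\<epsilon> > 0" "\<forall>x\<in>region I c. \<exists>t\<in>T. {i\<in>I. aff (c i) x \<le> \<epsilon>} \<subseteq> t"
    and x: "x \<in> region chamfer_index (chamfer_system \<epsilon>)"
    and rig: "rigid (tight chamfer_index (chamfer_system \<epsilon>) x) (chamfer_system \<epsilon>)"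
  shows "tight chamfer_index (chamfer_system \<epsilon>) x \<in> chamfer_triples \<and>
    card (tight chamfer_index (chamfer_system \<epsilon>) x) = 3"
proof -
  let ?t = "tight chamfer_index (chamfer_system \<epsilon>) x"
  have xr: "x \<in> region I c" and xe: "\<And>i j. {i,j} \<in> edges \<Longrightarrow> i \<noteq> j \<Longrightarrow> \<epsilon> \<le> aff (c i) x + aff (c j) x"
    using x region_chamfer by blast+
  have nn: "0 \<le> aff (c i) x" if "i \<in> I" for i using xr that by (auto simp: region_def)
  have edgeI: "i \<in> I" "j \<in> I" if "{i,j} \<in> edges" for i j using that T_sub by (auto simp: edges_def)
  obtain t where t: "t \<in> T" "{i\<in>I. aff (c i) x \<le> \<epsilon>} \<subseteq> t" using eps(2) xr by blast
  have small: "aff (c i) x \<le> \<epsilon> \<and> i \<in> I" if "e \<in> ?t" "i \<in> e" for e i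
  proof -
    have "e \<in> chamfer_index" using that by (simp add: tight_def)
    then show ?thesis
    proof (cases rule: chamfer_index_cases)
      case (1 k)
      then show ?thesis using that eps(1) tight_chamfer(1)[of k \<epsilon> x] by auto
    next
      case (2 j k)
      then have "aff (c j) x + aff (c k) x = \<epsilon>" using that tight_chamfer(2)[of j k \<epsilon> x] by auto
      moreover have "0 \<le> aff (c j) x" "0 \<le> aff (c k) x" using nn edgeI 2(3) by blast+
      ultimately show ?thesis using 2 that edgeI[OF 2(3)] by auto
    qed
  qed
  have sub: "e \<subseteq> t" if "e \<in> ?t" for e using small[OF that] t(2) by blast
  have full: "\<exists>e\<in>?t. i \<in> e" if i: "i \<in> t" for i
  proof (rule ccontr)
    assume no: "\<not> (\<exists>e\<in>?t. i \<in> e)"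
    obtain d where d: "\<forall>j\<in>t. fst (c j) \<bullet> d = (if j = i then 1 else 0)"
      using vertex_solve[OF t(1), of "\<lambda>j. if j = i then 1 else 0"] by blast
    have "d = 0"
    proof (rule rigidD[OF rig])
      fix e assume e: "e \<in> ?t"
      have "finite e" using sub[OF e] T_finite[OF t(1)] finite_subset by blast
      then show "fst (chamfer_system \<epsilon> e) \<bullet> d = 0"
        unfolding fst_chamfer[OF \<open>finite e\<close>]
      proof (intro sum.neutral ballI)
        fix j assume "j \<in> e"
        then have "j \<in> t" "j \<noteq> i" using sub[OF e] no e by auto
        then show "fst (c j) \<bullet> d = 0" using d by simp
      qed
    qed
    then show False using d i by auto
  qed
  have le: "aff (c i) x \<le> \<epsilon>" if "i \<in> t" for i using full[OF that] small by blast
  have tI: "i \<in> I" if "i \<in> t" for i using T_sub[OF t(1)] that by blast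
  show ?thesis
  proof (cases "\<exists>i\<in>t. aff (c i) x = 0")
    case True
    then obtain i where i: "i \<in> t" "aff (c i) x = 0" by blast
    obtain j k where tt: "t = {i,j,k}" "distinct [i,j,k]" using T_ijk[OF t(1) i(1)] .
    have ed: "{i,j} \<in> edges" "{i,k} \<in> edges" using edges_ij[OF t(1)] tt by auto
    have f: "aff (c j) x = \<epsilon>" "aff (c k) x = \<epsilon>"
      using xe[OF ed(1)] xe[OF ed(2)] le[of j] le[of k] tt i(2) by auto
    have "?t = {{i},{i,j},{i,k}}"
    proof
      show "{{i},{i,j},{i,k}} \<subseteq> ?t"
        using tight_chamfer tt(2) ed f i tI[OF i(1)] by auto
      show "?t \<subseteq> {{i},{i,j},{i,k}}"
      proof
        fix e assume e: "e \<in> ?t"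
        then have "e \<in> chamfer_index" by (simp add: tight_def)
        then show "e \<in> {{i},{i,j},{i,k}}"
        proof (cases rule: chamfer_index_cases)
          case (1 l)
          then have "aff (c l) x = 0" using e tight_chamfer(1)[of l] by auto
          then have "l = i" using sub[OF e] 1 tt f eps(1) by auto
          then show ?thesis using 1 by simp
        next
          case (2 l m)
          then have "aff (c l) x + aff (c m) x = \<epsilon>" using e tight_chamfer(2)[of l m] by auto
          moreover have "l \<in> {i,j,k}" "m \<in> {i,j,k}" using sub[OF e] 2 tt by auto
          ultimately have "l = i \<or> m = i" using f eps(1) by auto
          then show ?thesis using 2 \<open>l \<in> {i,j,k}\<close> \<open>m \<in> {i,j,k}\<close> by (auto simp: insert_commute)
        qed
      qed
    qed
    then have "?t = corner i t" using corner_eq tt by simp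
    moreover have "card {{i},{i,j},{i,k}} = 3" using tt(2) by (auto simp: doubleton_eq_iff card_insert_if)
    ultimately show ?thesis using i(1) t(1) \<open>?t = {{i},{i,j},{i,k}}\<close> by (auto simp: chamfer_triples_def)
  next
    case False
    obtain i where "i \<in> t" using T_card[OF t(1)] by fastforce
    from T_ijk[OF t(1) this] obtain j k where tt: "t = {i,j,k}" "distinct [i,j,k]" .
    have "?t \<subseteq> core t"
    proof
      fix e assume e: "e \<in> ?t"
      then have "e \<in> chamfer_index" by (simp add: tight_def)
      then show "e \<in> core t"
      proof (cases rule: chamfer_index_cases)
        case (1 l)
        then have "aff (c l) x = 0" using e tight_chamfer(1)[of l] by auto
        then show ?thesis using False sub[OF e] 1 by auto
      next
        case (2 l m)
        then show ?thesis using sub[OF e] by (auto simp: core_def)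
      qed
    qed
    moreover have c3: "card (core t) = 3" unfolding tt(1) core_eq[OF tt(2)]
      using tt(2) by (auto simp: doubleton_eq_iff card_insert_if)
    moreover have "3 \<le> card ?t"
      using finite_chamfer_index by (intro rigid_card_ge[OF _ rig]) (simp add: tight_def)
    ultimately have "?t = core t" by (intro card_seteq) (auto intro: card_ge_0_finite)
    then show ?thesis using c3 t(1) by (auto simp: chamfer_triples_def)
  qed
qed

lemma chamfer_attained:
  assumes eps: "\<epsilon> > 0" "\<forall>t\<in>T. \<forall>g\<in>insert (\<lambda>_. 1/2) ((\<lambda>i j. if j = i then 0 else 1) ` t).
        \<exists>x. (\<forall>i\<in>t. aff (c i) x = \<epsilon> * g i) \<and> (\<forall>i\<in>I - t. \<epsilon> < aff (c i) x)"
    and s: "s \<in> chamfer_triples"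
  shows "\<exists>x\<in>region chamfer_index (chamfer_system \<epsilon>).
    tight chamfer_index (chamfer_system \<epsilon>) x = s \<and> rigid s (chamfer_system \<epsilon>)"
proof -
  have edgeI: "i \<in> I" "j \<in> I" if "{i,j} \<in> edges" for i j using that T_sub by (auto simp: edges_def)
  obtain t i where ti: "t \<in> T" "i \<in> t" "s = core t \<or> s = corner i t"
  proof -
    consider t where "t \<in> T" "s = core t" | t i where "t \<in> T" "i \<in> t" "s = corner i t"
      using s unfolding chamfer_triples_def by blast
    then show thesis
    proof cases
      case 1
      moreover obtain i where "i \<in> t" using T_card[OF 1(1)] by fastforce
      ultimately show thesis using that by blast
    qed (use that in blast)
  qed
  obtain j k where tt: "t = {i,j,k}" "distinct [i,j,k]" using T_ijk[OF ti(1,2)] .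
  define g where "g = (if s = core t then (\<lambda>_. 1/2 :: real) else (\<lambda>j. if j = i then 0 else 1))"
  have gm: "g \<in> insert (\<lambda>_. 1/2) ((\<lambda>i j. if j = i then 0 else 1) ` t)" using ti(2) by (auto simp: g_def)
  obtain x where x: "\<And>i. i \<in> t \<Longrightarrow> aff (c i) x = \<epsilon> * g i" "\<And>i. i \<in> I - t \<Longrightarrow> \<epsilon> < aff (c i) x"
    using bspec[OF bspec[OF eps(2) ti(1)] gm] by blast
  have g: "0 \<le> g l" "l \<in> t \<Longrightarrow> m \<in> t \<Longrightarrow> l \<noteq> m \<Longrightarrow> 1 \<le> g l + g m" for l m by (auto simp: g_def)
  have nn: "0 \<le> aff (c l) x" if "l \<in> I" for l
    using x(1)[of l] x(2)[of l] g(1)[of l] eps(1) that by (cases "l \<in> t") auto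
  have out: "\<epsilon> < aff (c l) x + aff (c m) x" if "{l,m} \<in> edges" "\<not> {l,m} \<subseteq> t" for l m
    using that x(2)[of l] x(2)[of m] nn[of l] nn[of m] edgeI[OF that(1)] by fastforce
  have "\<epsilon> \<le> aff (c l) x + aff (c m) x" if "{l,m} \<in> edges" "l \<noteq> m" for l m
  proof (cases "{l,m} \<subseteq> t")
    case True
    then have "\<epsilon> * 1 \<le> \<epsilon> * (g l + g m)" using g(2)[of l m] that(2) eps(1) by (intro mult_left_mono) auto
    then show ?thesis using x(1)[of l] x(1)[of m] True by (simp add: algebra_simps)
  qed (use out that in force)
  then have xr: "x \<in> region chamfer_index (chamfer_system \<epsilon>)"
    unfolding region_chamfer using nn by (simp add: region_def)
  have tsub: "e \<subseteq> t" if "e \<in> tight chamfer_index (chamfer_system \<epsilon>) x" for e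
  proof -
    have "e \<in> chamfer_index" using that by (simp add: tight_def)
    then show ?thesis
    proof (cases rule: chamfer_index_cases)
      case (1 l)
      then show ?thesis using that tight_chamfer(1)[of l] x(2)[of l] eps(1) by force
    next
      case (2 l m)
      then show ?thesis using that tight_chamfer(2)[of l m] out[of l m] by auto
    qed
  qed
  let ?t = "tight chamfer_index (chamfer_system \<epsilon>) x"
  have cases7: "e \<in> {{i},{j},{k},{i,j},{i,k},{j,k}}" if "e \<in> ?t" for e
  proof -
    have "e \<in> chamfer_index" using that by (simp add: tight_def)
    then show ?thesis
    proof (cases rule: chamfer_index_cases)
      case (1 l)
      then show ?thesis using tsub[OF that] tt by auto
    next
      case (2 l m)
      then have "e \<in> {e. e \<subseteq> {i,j,k} \<and> card e = 2}" using tsub[OF that] tt by auto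
      then show ?thesis using two_subsets[OF tt(2)] by blast
    qed
  qed
  have mem: "{l} \<in> ?t \<longleftrightarrow> g l = 0" if "l \<in> t" for l
    using tight_chamfer(1)[of l \<epsilon> x] x(1)[OF that] that eps(1) T_sub[OF ti(1)] by auto
  have mem2: "{l,m} \<in> ?t \<longleftrightarrow> g l + g m = 1" if "l \<in> t" "m \<in> t" "l \<noteq> m" for l m
  proof -
    have "\<epsilon> * g l + \<epsilon> * g m = \<epsilon> \<longleftrightarrow> g l + g m = 1" using eps(1) by (simp flip: distrib_left)
    then show ?thesis
      using tight_chamfer(2)[of l m \<epsilon> x] x(1)[of l] x(1)[of m] that edges_ij[OF ti(1) that] by simp
  qed
  have ne: "i \<noteq> j" "i \<noteq> k" "j \<noteq> k" "j \<noteq> i" "k \<noteq> i" "k \<noteq> j" using tt(2) by auto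
  have in_t: "i \<in> t" "j \<in> t" "k \<in> t" using tt by auto
  have rg: "rigid s (chamfer_system \<epsilon>)" if
    "\<And>d. (\<And>e. e \<in> s \<Longrightarrow> (\<Sum>l\<in>e. fst (c l) \<bullet> d) = 0) \<Longrightarrow> fst (c i) \<bullet> d = 0 \<and> fst (c j) \<bullet> d = 0 \<and> fst (c k) \<bullet> d = 0"
    "\<And>e. e \<in> s \<Longrightarrow> finite e"
  proof (rule rigidI)
    fix d assume "\<And>e. e \<in> s \<Longrightarrow> fst (chamfer_system \<epsilon> e) \<bullet> d = 0"
    then have "fst (c i) \<bullet> d = 0 \<and> fst (c j) \<bullet> d = 0 \<and> fst (c k) \<bullet> d = 0"
      using that fst_chamfer by metis
    then show "d = 0" using rigidD[OF T_rigid[OF ti(1)]] tt by blast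
  qed
  show ?thesis
  proof (cases "s = core t")
    case True
    then have s: "s = {{i,j},{i,k},{j,k}}" using core_eq[OF tt(2)] tt(1) by simp
    have g2: "g = (\<lambda>_. 1/2)" using True by (simp add: g_def)
    have "?t = s" unfolding s
    proof
      show "?t \<subseteq> {{i,j},{i,k},{j,k}}" using cases7 mem in_t by (auto simp: g2)
      show "{{i,j},{i,k},{j,k}} \<subseteq> ?t" using mem2 in_t ne by (simp add: g2)
    qed
    moreover have "rigid s (chamfer_system \<epsilon>)"
    proof (rule rg)
      fix d assume d: "\<And>e. e \<in> s \<Longrightarrow> (\<Sum>l\<in>e. fst (c l) \<bullet> d) = 0"
      show "fst (c i) \<bullet> d = 0 \<and> fst (c j) \<bullet> d = 0 \<and> fst (c k) \<bullet> d = 0"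
        using d[of "{i,j}"] d[of "{i,k}"] d[of "{j,k}"] ne unfolding s by simp
    qed (auto simp: s)
    ultimately show ?thesis using xr by blast
  next
    case False
    then have s: "s = {{i},{i,j},{i,k}}" using corner_eq[OF tt(2)] tt(1) ti(3) by simp
    have g2: "g = (\<lambda>j. if j = i then 0 else 1)" using False by (simp add: g_def)
    have "?t = s" unfolding s
    proof
      show "?t \<subseteq> {{i},{i,j},{i,k}}"
        using cases7 mem[OF in_t(2)] mem[OF in_t(3)] mem2[OF in_t(2,3) ne(3)] ne by (auto simp: g2)
      show "{{i},{i,j},{i,k}} \<subseteq> ?t" using mem[OF in_t(1)] mem2 in_t ne by (simp add: g2)
    qed
    moreover have "rigid s (chamfer_system \<epsilon>)"
    proof (rule rg)
      fix d assume d: "\<And>e. e \<in> s \<Longrightarrow> (\<Sum>l\<in>e. fst (c l) \<bullet> d) = 0"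
      show "fst (c i) \<bullet> d = 0 \<and> fst (c j) \<bullet> d = 0 \<and> fst (c k) \<bullet> d = 0"
        using d[of "{i,j}"] d[of "{i,k}"] d[of "{i}"] ne unfolding s by simp
    qed (auto simp: s)
    ultimately show ?thesis using xr by blast
  qed
qed

lemma simple_system_chamfer:
  "\<exists>\<epsilon>. simple_system chamfer_index (chamfer_system \<epsilon>) chamfer_triples"
proof -
  obtain \<epsilon> where eps: "\<epsilon> > 0" "\<forall>x\<in>region I c. \<exists>t\<in>T. {i\<in>I. aff (c i) x \<le> \<epsilon>} \<subseteq> t"
    "\<forall>t\<in>T. \<forall>g\<in>insert (\<lambda>_. 1/2) ((\<lambda>i j. if j = i then 0 else 1) ` t).
        \<exists>x. (\<forall>i\<in>t. aff (c i) x = \<epsilon> * g i) \<and> (\<forall>i\<in>I - t. \<epsilon> < aff (c i) x)"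
    using chamfer_parameter by (elim exE conjE) (rule that)
  note V = chamfer_vertex[OF eps(1,2)] and A = chamfer_attained[OF eps(1,3)]
  have "simple_system chamfer_index (chamfer_system \<epsilon>) chamfer_triples"
  proof
    have "region chamfer_index (chamfer_system \<epsilon>) \<subseteq> region I c" using region_chamfer by blast
    then show "bounded (region chamfer_index (chamfer_system \<epsilon>))" using bounded_reg bounded_subset by blast
    show "chamfer_triples = tight chamfer_index (chamfer_system \<epsilon>) `
      {x \<in> region chamfer_index (chamfer_system \<epsilon>). rigid (tight chamfer_index (chamfer_system \<epsilon>) x) (chamfer_system \<epsilon>)}"
      using V A by blast
    show "chamfer_triples \<noteq> {}" using T_nonempty by (auto simp: chamfer_triples_def)
    show "chamfer_index \<subseteq> \<Union>chamfer_triples"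
    proof
      fix e assume "e \<in> chamfer_index"
      then consider i where "e = {i}" "i \<in> I" | "e \<in> edges" unfolding chamfer_index_def by blast
      then show "e \<in> \<Union>chamfer_triples"
      proof cases
        case 1
        then obtain t where "t \<in> T" "i \<in> t" using cover by blast
        then have "corner i t \<in> chamfer_triples" by (auto simp: chamfer_triples_def)
        moreover have "e \<in> corner i t" using 1 by (simp add: corner_def)
        ultimately show ?thesis by blast
      next
        case 2
        then obtain t where "t \<in> T" "e \<in> core t" by (auto simp: edges_def core_def)
        then show ?thesis by (auto simp: chamfer_triples_def)
      qed
    qed
  qed (use V finite_chamfer_index in blast)+
  then show ?thesis by blast
qed

end

section \<open>Facets of the region of a simple system\<close>

lemma extreme_point_region_iff:
  assumes "finite I"
  shows "x extreme_point_of region I c \<longleftrightarrow> x \<in> region I c \<and> rigid (tight I c x) c"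
proof
  assume x: "x extreme_point_of region I c"
  then have xr: "x \<in> region I c" by (simp add: extreme_point_of_def)
  moreover have "rigid (tight I c x) c"
  proof (rule rigidI, rule ccontr)
    fix d assume d: "\<And>i. i \<in> tight I c x \<Longrightarrow> fst (c i) \<bullet> d = 0" "d \<noteq> 0"
    have pos: "0 < aff (c i) x" if "i \<in> I - tight I c x" for i
      using that xr by (force simp: tight_def region_def)
    have "\<exists>e>0. \<forall>i\<in>I - tight I c x. 0 < aff (c i) x - e * \<bar>fst (c i) \<bullet> d\<bar>"
      using assms pos by (intro exists_small_perturbation) auto
    then obtain e where e: "e > 0" "\<And>i. i \<in> I - tight I c x \<Longrightarrow> 0 < aff (c i) x - e * \<bar>fst (c i) \<bullet> d\<bar>"
      by blast
    have in': "x + s *\<^sub>R d \<in> region I c" if "\<bar>s\<bar> = e" for s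
      unfolding region_def
    proof (rule CollectI, rule ballI)
      fix i assume i: "i \<in> I"
      show "0 \<le> aff (c i) (x + s *\<^sub>R d)"
      proof (cases "i \<in> tight I c x")
        case True
        then show ?thesis using d(1)[OF True] by (simp add: aff_add_scaleR tight_def)
      next
        case False
        have "\<bar>s * (fst (c i) \<bullet> d)\<bar> = e * \<bar>fst (c i) \<bullet> d\<bar>" using that by (simp add: abs_mult)
        then show ?thesis using e(2)[of i] False i by (simp add: aff_add_scaleR)
      qed
    qed
    have a: "x + e *\<^sub>R d \<in> region I c" and b: "x + (- e) *\<^sub>R d \<in> region I c" using in'[of e] in'[of "- e"] e(1) by simp_all
    have "x = (1 - 1/2) *\<^sub>R (x + e *\<^sub>R d) + (1/2) *\<^sub>R (x + (- e) *\<^sub>R d)"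
      by (simp add: algebra_simps flip: scaleR_add_left)
    moreover have "x + e *\<^sub>R d \<noteq> x + (- e) *\<^sub>R d"
      using d(2) e(1) by (simp add: eq_neg_iff_add_eq_0 flip: scaleR_add_left)
    ultimately have "x \<in> open_segment (x + e *\<^sub>R d) (x + (- e) *\<^sub>R d)"
      unfolding in_segment by (intro conjI exI[of _ "1/2"]) auto
    then show False using x a b by (auto simp: extreme_point_of_def)
  qed
  ultimately show "x \<in> region I c \<and> rigid (tight I c x) c" by blast
next
  assume x: "x \<in> region I c \<and> rigid (tight I c x) c"
  show "x extreme_point_of region I c"
    unfolding extreme_point_of_def
  proof (intro conjI ballI notI)
    fix a b assume ab: "a \<in> region I c" "b \<in> region I c" "x \<in> open_segment a b"
    then obtain u where u: "a \<noteq> b" "0 < u" "u < 1" "x = (1 - u) *\<^sub>R a + u *\<^sub>R b"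
      by (auto simp: in_segment)
    have "tight I c x = tight I c a \<inter> tight I c b" using tight_between(2)[OF ab(1,2) u(2,3)] u(4) by simp
    then have "fst (c i) \<bullet> (b - a) = 0" if "i \<in> tight I c x" for i
      using that aff_diff[of "c i" b a] by (auto simp: tight_def)
    then have "b - a = 0" using x rigidD by blast
    then show False using u(1) by simp
  qed (use x in blast)
qed

context simple_system begin

lemma extreme_points: "{x. x extreme_point_of region I c} = vertex ` T"
proof -
  have "x \<in> vertex ` T" if "x \<in> region I c" "rigid (tight I c x) c" for x
  proof -
    have "tight I c x \<in> T" using T_I that by blast
    moreover then have "x = vertex (tight I c x)" by (intro eq_vertexI) (auto simp: tight_def)
    ultimately show ?thesis by blast
  qed
  then show ?thesis
    using extreme_point_region_iff[OF finite_I] vertex_in tight_vertex T_rigid by fastforce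
qed

lemma normal_nonzero: "i \<in> I \<Longrightarrow> fst (c i) \<noteq> 0"
proof -
  assume "i \<in> I"
  then obtain t where "t \<in> T" "i \<in> t" using cover by blast
  then show ?thesis using vertex_solve[of t "\<lambda>_. 1"] by fastforce
qed

text \<open>A short move from the vertex in a direction that raises exactly the constraints of
  \<open>t\<close> outside \<open>J\<close>. It provides interior points and points lying on a
  single facet.\<close>

lemma point_off_facets:
  assumes "t \<in> T" "J \<subseteq> t"
  shows "\<exists>x. (\<forall>i\<in>J. aff (c i) x = 0) \<and> (\<forall>i\<in>I - J. 0 < aff (c i) x)"
proof -
  obtain d where d: "\<And>i. i \<in> t \<Longrightarrow> fst (c i) \<bullet> d = (if i \<in> J then 0 else 1)"
    using vertex_solve[OF assms(1), of "\<lambda>i. if i \<in> J then 0 else 1"] by auto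
  have "\<exists>e>0. \<forall>i\<in>I - t. 0 < aff (c i) (vertex t) - e * - (fst (c i) \<bullet> d)"
    using finite_I aff_vertex_pos[OF assms(1)] by (intro exists_small_perturbation) auto
  then obtain e where e: "e > 0" "\<And>i. i \<in> I - t \<Longrightarrow> 0 < aff (c i) (vertex t) - e * - (fst (c i) \<bullet> d)"
    by blast
  have 0: "aff (c i) (vertex t) = 0" if "i \<in> t" for i
    using aff_vertex_eq_0_iff[OF assms(1)] that T_sub[OF assms(1)] by blast
  have "aff (c i) (vertex t + e *\<^sub>R d) = 0" if "i \<in> J" for i
    using d[of i] that assms(2) 0[of i] by (auto simp: aff_add_scaleR)
  moreover have "0 < aff (c i) (vertex t + e *\<^sub>R d)" if "i \<in> I - J" for i
    using d[of i] that 0[of i] e by (cases "i \<in> t") (auto simp: aff_add_scaleR)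
  ultimately show ?thesis by blast
qed

lemma open_positive: "finite J \<Longrightarrow> open {x. \<forall>i\<in>J. 0 < aff (c i) x}"
proof -
  assume "finite J"
  moreover have "{x. \<forall>i\<in>J. 0 < aff (c i) x} = (\<Inter>i\<in>J. {x. 0 < aff (c i) x})" by auto
  ultimately show ?thesis by (auto intro!: open_INT open_Collect_less continuous_aff)
qed

lemma interior_region: "{x. \<forall>i\<in>I. 0 < aff (c i) x} \<subseteq> interior (region I c)"
  using open_positive[OF finite_I] by (intro interior_maximal) (auto simp: region_def less_imp_le)

lemma polytope3_region: "polytope3 (region I c)"
proof -
  have "region I c = convex hull (vertex ` T)"
    using Krein_Milman_Minkowski[of "region I c"] convex_region closed_region bounded_reg extreme_points
    by (metis compact_eq_bounded_closed)
  then have "polytope (region I c)" using finite_T polytope_def by blast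
  moreover obtain t where "t \<in> T" using T_nonempty by blast
  then have "interior (region I c) \<noteq> {}"
    using point_off_facets[of t "{}"] interior_region by auto
  then have "aff_dim (region I c) = 3" using aff_dim_nonempty_interior by fastforce
  ultimately show ?thesis by (simp add: polytope3_def)
qed

definition facet :: "'i \<Rightarrow> (real^3) set" where
  "facet i = region I c \<inter> {x. aff (c i) x = 0}"

lemma facet_face: "i \<in> I \<Longrightarrow> facet i face_of region I c"
proof -
  assume i: "i \<in> I"
  have "region I c \<inter> {x. fst (c i) \<bullet> x = - snd (c i)} face_of region I c"
    using i by (intro face_of_Int_supporting_hyperplane_ge convex_region) (auto simp: region_def aff_def)
  moreover have "{x. fst (c i) \<bullet> x = - snd (c i)} = {x. aff (c i) x = 0}" by (auto simp: aff_def)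
  ultimately show ?thesis by (simp add: facet_def)
qed

lemma facet_memI:
  assumes "aff (c i) z = 0" "\<forall>j\<in>I - {i}. 0 < aff (c j) z"
  shows "z \<in> facet i"
proof -
  have "0 \<le> aff (c j) z" if "j \<in> I" for j
    using assms that by (cases "j = i") (auto simp: less_imp_le)
  then show ?thesis using assms(1) by (simp add: facet_def region_def)
qed

lemma aff_dim_facet: "i \<in> I \<Longrightarrow> aff_dim (facet i) = 2"
proof -
  assume i: "i \<in> I"
  let ?H = "{x. fst (c i) \<bullet> x = - snd (c i)}" and ?U = "{x. \<forall>j\<in>I - {i}. 0 < aff (c j) x}"
  have H: "?H = {x. aff (c i) x = 0}" by (auto simp: aff_def)
  obtain t where "t \<in> T" "i \<in> t" using cover i by blast
  then obtain x where x: "aff (c i) x = 0" "\<forall>j\<in>I - {i}. 0 < aff (c j) x"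
    using point_off_facets[of t "{i}"] by auto
  have "aff_dim (?H \<inter> ?U) = aff_dim ?H"
    using x finite_I by (intro aff_dim_convex_Int_open convex_hyperplane open_positive) (auto simp: H)
  moreover have "aff_dim ?H = 2" using aff_dim_hyperplane[OF normal_nonzero[OF i]] by simp
  moreover have "?H \<inter> ?U \<subseteq> facet i"
  proof
    fix z assume "z \<in> ?H \<inter> ?U"
    then have "aff (c i) z = 0" "\<forall>j\<in>I - {i}. 0 < aff (c j) z" by (auto simp: H)
    then show "z \<in> facet i" by (rule facet_memI)
  qed
  then have "aff_dim (?H \<inter> ?U) \<le> aff_dim (facet i)" by (rule aff_dim_subset)
  moreover have "aff_dim (facet i) \<le> aff_dim ?H" by (rule aff_dim_subset) (auto simp: facet_def H)
  ultimately show ?thesis by linarith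
qed

text \<open>A facet has empty intersection with the interior, so at a relative interior point of it
  some constraint \<open>i\<close> is tight, and the facet is a face of \<open>facet i\<close>. Both
  have dimension 2, so they agree.\<close>

lemma facet_of_region_iff: "F facet_of region I c \<longleftrightarrow> (\<exists>i\<in>I. F = facet i)"
proof
  assume F: "F facet_of region I c"
  then have face: "F face_of region I c" and ne: "F \<noteq> {}" and dim: "aff_dim F = 2"
    using polytope3_region by (auto simp: facet_of_def polytope3_def)
  have "rel_interior F \<noteq> {}" using ne face face_of_imp_convex rel_interior_eq_empty convex_region by blast
  then obtain x where x: "x \<in> rel_interior F" by blast
  then have xF: "x \<in> F" using rel_interior_subset by blast
  then have xr: "x \<in> region I c" using face face_of_imp_subset by blast
  have "\<exists>i\<in>I. aff (c i) x = 0"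
  proof (rule ccontr)
    assume "\<not> (\<exists>i\<in>I. aff (c i) x = 0)"
    then have "x \<in> interior (region I c)" using xr interior_region by (force simp: region_def)
    moreover have "F \<noteq> region I c" using dim polytope3_region by (auto simp: polytope3_def)
    ultimately show False using face_of_disjoint_interior[OF face] xF by blast
  qed
  then obtain i where i: "i \<in> I" "aff (c i) x = 0" by blast
  have "F \<subseteq> facet i"
    using x xr xF i face_of_imp_subset[OF face]
    by (intro subset_of_face_of[OF facet_face[OF i(1)]]) (auto simp: facet_def)
  then have sub: "F face_of facet i"
    using face face_of_imp_subset[OF facet_face[OF i(1)]] face_of_subset by blast
  have "F = facet i"
  proof (rule ccontr)
    assume "F \<noteq> facet i"
    then have "aff_dim F < aff_dim (facet i)"
      using face_of_aff_dim_lt[OF _ sub] face_of_imp_convex[OF facet_face[OF i(1)]] convex_region by blast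
    then show False using dim aff_dim_facet[OF i(1)] by simp
  qed
  then show "\<exists>i\<in>I. F = facet i" using i by blast
next
  assume "\<exists>i\<in>I. F = facet i"
  then obtain i where i: "i \<in> I" "F = facet i" by blast
  moreover have "aff_dim F = aff_dim (region I c) - 1"
    using aff_dim_facet[OF i(1)] i polytope3_region by (simp add: polytope3_def)
  moreover have "F \<noteq> {}" using aff_dim_facet[OF i(1)] i by auto
  ultimately show "F facet_of region I c" using facet_face by (simp add: facet_of_def)
qed

lemma inj_facet: "inj_on facet I"
proof (rule inj_onI)
  fix i j assume ij: "i \<in> I" "j \<in> I" "facet i = facet j"
  obtain t where "t \<in> T" "i \<in> t" using cover ij by blast
  then obtain x where x: "aff (c i) x = 0" "\<forall>j\<in>I - {i}. 0 < aff (c j) x"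
    using point_off_facets[of t "{i}"] by auto
  then have "x \<in> facet i" by (rule facet_memI)
  then show "i = j" using ij x by (force simp: facet_def)
qed

lemma vertex_in_facet: "t \<in> T \<Longrightarrow> i \<in> I \<Longrightarrow> vertex t \<in> facet i \<longleftrightarrow> i \<in> t"
  using vertex_in aff_vertex_eq_0_iff by (auto simp: facet_def)

lemma pk_region: "pk (region I c) k = card {i\<in>I. deg T i = k}"
proof -
  have "card {v. v extreme_point_of facet i} = deg T i" if i: "i \<in> I" for i
  proof -
    have "{v. v extreme_point_of facet i} = {v. v extreme_point_of region I c} \<inter> facet i"
      using extreme_point_of_face[OF facet_face[OF i]] by auto
    also have "\<dots> = vertex ` {t\<in>T. i \<in> t}"
      unfolding extreme_points using vertex_in_facet i by auto
    moreover have "inj_on vertex {t\<in>T. i \<in> t}" using vertex_inj by (auto simp: inj_on_def)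
    ultimately show ?thesis by (simp add: card_image deg_def)
  qed
  then have "{F. F facet_of region I c \<and> card {v. v extreme_point_of F} = k} = facet ` {i\<in>I. deg T i = k}"
    unfolding facet_of_region_iff by auto
  moreover have "inj_on facet {i\<in>I. deg T i = k}" using inj_facet by (rule inj_on_subset) auto
  ultimately show ?thesis by (simp add: pk_def card_image)
qed

lemma simple_polytope3_region: "simple_polytope3 (region I c)"
  unfolding simple_polytope3_def
proof (intro allI impI)
  fix v assume "v extreme_point_of region I c"
  then obtain t where t: "t \<in> T" "v = vertex t" using extreme_points by blast
  have "{F. F facet_of region I c \<and> v \<in> F} = facet ` t"
    unfolding facet_of_region_iff using vertex_in_facet[OF t(1)] t T_sub[OF t(1)] by auto
  moreover have "inj_on facet t" using inj_facet T_sub[OF t(1)] by (rule inj_on_subset)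
  ultimately show "card {F. F facet_of region I c \<and> v \<in> F} = 3" using T_card[OF t(1)] by (simp add: card_image)
qed

text \<open>The constraints tight at a common point of two facets lie in some vertex triple, so
  being flag becomes a condition on \<open>T\<close> alone.\<close>

lemma flag_polytope3_region:
  assumes "\<And>K. K \<subseteq> I \<Longrightarrow> (\<And>i j. i \<in> K \<Longrightarrow> j \<in> K \<Longrightarrow> \<exists>t\<in>T. i \<in> t \<and> j \<in> t) \<Longrightarrow> \<exists>t\<in>T. K \<subseteq> t"
  shows "flag_polytope3 (region I c)"
  unfolding flag_polytope3_def
proof (intro allI impI)
  fix S assume S: "S \<subseteq> {F. F facet_of region I c} \<and> (\<forall>F\<in>S. \<forall>G\<in>S. F \<inter> G \<noteq> {})"
  define K where "K = {i\<in>I. facet i \<in> S}"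
  have SK: "S = facet ` K" using S facet_of_region_iff by (auto simp: K_def)
  have "\<exists>t\<in>T. K \<subseteq> t"
  proof (rule assms)
    show "K \<subseteq> I" by (auto simp: K_def)
    fix i j assume ij: "i \<in> K" "j \<in> K"
    then have "facet i \<inter> facet j \<noteq> {}" using S by (auto simp: K_def)
    then obtain x where x: "x \<in> facet i" "x \<in> facet j" by blast
    then obtain t where "t \<in> T" "tight I c x \<subseteq> t" using tight_subset_T by (auto simp: facet_def)
    moreover have "i \<in> tight I c x" "j \<in> tight I c x" using x ij by (auto simp: tight_def facet_def K_def)
    ultimately show "\<exists>t\<in>T. i \<in> t \<and> j \<in> t" by blast
  qed
  then obtain t where t: "t \<in> T" "K \<subseteq> t" by blast
  have "vertex t \<in> \<Inter>S" unfolding SK using vertex_in_facet[OF t(1)] t T_sub[OF t(1)] by blast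
  then show "\<Inter>S \<noteq> {}" by blast
qed

end

section \<open>Combinatorics of the chamfered polytope\<close>

context simple_system begin

text \<open>The three vertices span the facet: the barycentric coordinates of a point are read off
  from \<open>c l\<close>, \<open>c j\<close> and \<open>c k\<close>, each of which vanishes at two
  of the vertices. Any vertex of the facet, being extreme, is then one of the three.\<close>

lemma triangular_facet:
  assumes t: "{i,j,k} \<in> T" "{i,k,l} \<in> T" "{i,j,l} \<in> T" and d: "distinct [i,j,k,l]"
  shows "deg T i = 3"
proof -
  let ?u = "vertex {i,j,k}" and ?v = "vertex {i,k,l}" and ?w = "vertex {i,j,l}"
  have I: "i \<in> I" "j \<in> I" "k \<in> I" "l \<in> I" using T_sub[OF t(1)] T_sub[OF t(2)] by auto
  have z: "aff (c i) ?u = 0" "aff (c j) ?u = 0" "aff (c k) ?u = 0" "aff (c i) ?v = 0" "aff (c k) ?v = 0"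
    "aff (c l) ?v = 0" "aff (c i) ?w = 0" "aff (c j) ?w = 0" "aff (c l) ?w = 0"
    using aff_vertex_eq_0_iff t I by auto
  have p: "0 < aff (c l) ?u" "0 < aff (c j) ?v" "0 < aff (c k) ?w"
    using aff_vertex_pos t I d by auto
  have in_hull: "x \<in> convex hull {?u, ?v, ?w}" if x: "x \<in> region I c" "aff (c i) x = 0" for x
  proof -
    define \<alpha> \<beta> \<gamma> where "\<alpha> = aff (c l) x / aff (c l) ?u" and "\<beta> = aff (c j) x / aff (c j) ?v"
      and "\<gamma> = 1 - \<alpha> - \<beta>"
    define y where "y = \<alpha> *\<^sub>R ?u + \<beta> *\<^sub>R ?v + \<gamma> *\<^sub>R ?w"
    have ay: "aff a y = \<alpha> * aff a ?u + \<beta> * aff a ?v + \<gamma> * aff a ?w" for a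
    proof -
      have "\<alpha> * snd a + \<beta> * snd a + \<gamma> * snd a = snd a" by (simp add: \<gamma>_def algebra_simps)
      then show ?thesis by (simp add: y_def aff_def inner_add_right algebra_simps)
    qed
    have "aff (c i) y = aff (c i) x" "aff (c j) y = aff (c j) x" "aff (c l) y = aff (c l) x"
      using p z x(2) by (simp_all add: ay \<alpha>_def \<beta>_def)
    then have "fst (c m) \<bullet> (x - y) = 0" if "m \<in> {i,j,l}" for m
      using that aff_diff[of "c m" x y] by auto
    then have "x - y = 0" using rigidD[OF T_rigid[OF t(3)]] by blast
    then have xy: "x = y" by simp
    have nn: "0 \<le> aff (c j) x" "0 \<le> aff (c k) x" "0 \<le> aff (c l) x" using x(1) I by (auto simp: region_def)
    have "aff (c k) x = \<gamma> * aff (c k) ?w" using ay[of "c k"] z by (simp add: xy)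
    then have "0 \<le> \<gamma>" using nn(2) p(3) by (simp add: zero_le_mult_iff)
    moreover have "0 \<le> \<alpha>" "0 \<le> \<beta>" using nn p by (simp_all add: \<alpha>_def \<beta>_def)
    moreover have "\<alpha> + \<beta> + \<gamma> = 1" by (simp add: \<gamma>_def)
    ultimately show ?thesis unfolding convex_hull_3 xy y_def by blast
  qed
  have "t' \<in> {{i,j,k},{i,k,l},{i,j,l}}" if t': "t' \<in> T" "i \<in> t'" for t'
  proof -
    let ?x = "vertex t'"
    have "?x extreme_point_of region I c" using extreme_points t'(1) by blast
    moreover have "?x \<in> convex hull {?u, ?v, ?w}"
      using in_hull[OF vertex_in[OF t'(1)]] aff_vertex_eq_0_iff[OF t'(1) I(1)] t'(2) by blast
    moreover have "convex hull {?u, ?v, ?w} \<subseteq> region I c"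
      using vertex_in t by (intro hull_minimal convex_region) auto
    ultimately have "?x extreme_point_of (convex hull {?u, ?v, ?w})"
      by (auto simp: extreme_point_of_def)
    then have "?x \<in> {?u, ?v, ?w}" by (rule extreme_point_of_convex_hull)
    then show ?thesis using vertex_inj[OF t'(1)] t by auto
  qed
  then have "{t'\<in>T. i \<in> t'} = {{i,j,k},{i,k,l},{i,j,l}}" using t by auto
  moreover have "l \<notin> {i,j,k}" "j \<notin> {i,k,l}" "k \<notin> {i,j,l}" using d by auto
  then have "{i,j,k} \<noteq> {i,k,l}" "{i,j,k} \<noteq> {i,j,l}" "{i,k,l} \<noteq> {i,j,l}" by blast+
  ultimately show ?thesis by (simp add: deg_def)
qed

lemma Union_core: "t \<in> T \<Longrightarrow> \<Union>(core t) = t"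
proof -
  assume t: "t \<in> T"
  obtain i where "i \<in> t" using T_card[OF t] by fastforce
  from T_ijk[OF t this] obtain j k where "t = {i,j,k}" "distinct [i,j,k]" .
  then show ?thesis by (auto simp: core_eq)
qed

lemma Union_corner: "t \<in> T \<Longrightarrow> i \<in> t \<Longrightarrow> \<Union>(corner i t) = t"
proof -
  assume t: "t \<in> T" "i \<in> t"
  obtain j k where "t = {i,j,k}" "distinct [i,j,k]" using T_ijk[OF t] .
  then show ?thesis by (auto simp: corner_eq)
qed

lemma deg_chamfer_facet: "deg chamfer_triples {i} = deg T i"
proof -
  have "{s\<in>chamfer_triples. {i} \<in> s} = corner i ` {t\<in>T. i \<in> t}"
    by (auto simp: chamfer_triples_def core_def corner_def)
  moreover have "inj_on (corner i) {t\<in>T. i \<in> t}"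
    using Union_corner by (intro inj_onI) (metis (mono_tags, lifting) mem_Collect_eq)
  ultimately show ?thesis by (simp add: deg_def card_image)
qed

text \<open>At each of the two ends of the edge, its hexagon has the core vertex and one corner of
  each of the two adjacent facets.\<close>

lemma deg_chamfer_edge:
  assumes "e \<in> edges"
  shows "deg chamfer_triples e = 6"
proof -
  obtain i j where ij: "e = {i,j}" "i \<noteq> j" using assms by (auto simp: edges_def card_2_iff)
  obtain t where t: "t \<in> T" "e \<subseteq> t" using assms by (auto simp: edges_def)
  define E where "E = {t\<in>T. e \<subseteq> t}"
  have cE: "card E = 2" unfolding E_def using assms by (intro card_edge_triples[OF t]) (auto simp: edges_def)
  then have finE: "finite E" by (simp add: card_ge_0_finite)
  have eq: "{s\<in>chamfer_triples. e \<in> s} = core ` E \<union> (corner i ` E \<union> corner j ` E)"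
  proof
    show "{s\<in>chamfer_triples. e \<in> s} \<subseteq> core ` E \<union> (corner i ` E \<union> corner j ` E)"
    proof
      fix s assume s: "s \<in> {s\<in>chamfer_triples. e \<in> s}"
      then consider t where "t \<in> T" "s = core t" | k t where "t \<in> T" "k \<in> t" "s = corner k t"
        unfolding chamfer_triples_def by blast
      then show "s \<in> core ` E \<union> (corner i ` E \<union> corner j ` E)"
      proof cases
        case 1
        then show ?thesis using s by (auto simp: core_def E_def)
      next
        case 2
        have "e \<noteq> {k}" using ij by auto
        then have "k \<in> e" "e \<subseteq> t" using s 2 by (auto simp: corner_def)
        then show ?thesis using 2 ij by (auto simp: E_def)
      qed
    qed
    show "core ` E \<union> (corner i ` E \<union> corner j ` E) \<subseteq> {s\<in>chamfer_triples. e \<in> s}"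
      using ij by (auto simp: chamfer_triples_def core_def corner_def E_def)
  qed
  have "inj_on core E" unfolding E_def
    using Union_core by (intro inj_onI) (metis (mono_tags, lifting) mem_Collect_eq)
  moreover have "inj_on (corner k) E" if "k \<in> e" for k unfolding E_def
    using Union_corner that by (intro inj_onI) (metis (mono_tags, lifting) mem_Collect_eq subsetD)
  ultimately have cards: "card (core ` E) = 2" "card (corner i ` E) = 2" "card (corner j ` E) = 2"
    using cE ij by (simp_all add: card_image)
  have "\<And>t. {i} \<notin> core t \<and> {j} \<notin> core t" by (simp add: core_def)
  moreover have "\<And>t. {i} \<in> corner i t \<and> {j} \<in> corner j t \<and> {i} \<notin> corner j t" using ij by (auto simp: corner_def)
  ultimately have "core ` E \<inter> (corner i ` E \<union> corner j ` E) = {}" "corner i ` E \<inter> corner j ` E = {}"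
    by (metis (no_types, lifting) UnE disjoint_iff imageE)+
  then show ?thesis unfolding deg_def eq using finE cards by (simp add: card_Un_disjoint)
qed

text \<open>Hexagons meet only if their edges have a common end, whose triple they span. An old
  facet meets only the hexagons over its own sides and no other old facet.\<close>

lemma chamfer_adjacent:
  assumes "s \<in> chamfer_triples" "e \<in> s" "e' \<in> s" "e \<noteq> e'"
  shows "card e = 2 \<Longrightarrow> card e' = 2 \<Longrightarrow> e \<union> e' \<in> T" "e = {i} \<Longrightarrow> i \<in> e' \<and> card e' = 2"
proof -
  obtain t k where t: "t \<in> T" "s = core t \<or> (k \<in> t \<and> s = corner k t)"
    using assms(1) by (auto simp: chamfer_triples_def)
  show "e \<union> e' \<in> T" if c: "card e = 2" "card e' = 2"
  proof -
    have sub: "e \<subseteq> t" "e' \<subseteq> t" using t assms(2,3) c by (auto simp: core_def corner_def)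
    have "e \<subset> e \<union> e'" using c assms(4) by (metis card_subset_eq card.infinite psubsetI sup_ge1 sup_ge2 zero_neq_numeral)
    moreover have "finite (e \<union> e')" using c by (metis card.infinite finite_UnI zero_neq_numeral)
    ultimately have "2 < card (e \<union> e')" using psubset_card_mono c by metis
    then have "e \<union> e' = t" using sub T_card[OF t(1)] T_finite[OF t(1)] by (intro card_seteq) auto
    then show ?thesis using t by simp
  qed
  show "i \<in> e' \<and> card e' = 2" if "e = {i}"
    using t assms(2-4) that by (auto simp: core_def corner_def)
qed

text \<open>Old facets have become pairwise disjoint, so at most one occurs in \<open>K\<close>.
  Edges that pairwise share an end lie in a common triple unless three of them belong to one facet
  \<open>i\<close>, as in \<open>star\<close>; then the three neighbours close up around
  \<open>i\<close>, which is a triangle.\<close>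

lemma chamfer_flag:
  assumes no3: "\<And>i. i \<in> I \<Longrightarrow> deg T i \<noteq> 3"
    and K: "K \<subseteq> chamfer_index"
      "\<And>e e'. e \<in> K \<Longrightarrow> e' \<in> K \<Longrightarrow> \<exists>s\<in>chamfer_triples. e \<in> s \<and> e' \<in> s"
  shows "\<exists>s\<in>chamfer_triples. K \<subseteq> s"
proof -
  have card12: "card e = 2 \<or> (\<exists>i\<in>I. e = {i})" if "e \<in> K" for e
    using that K(1) by (auto simp: chamfer_index_def edges_def)
  have union: "e \<union> e' \<in> T" if "e \<in> K" "e' \<in> K" "e \<noteq> e'" "card e = 2" "card e' = 2" for e e'
    using K(2)[OF that(1,2)] chamfer_adjacent(1)[OF _ _ _ that(3-5)] by blast
  have star: False if e: "e1 \<in> K" "e2 \<in> K" "e3 \<in> K" "card e1 = 2" "card e2 = 2" "card e3 = 2"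
    "e1 \<noteq> e2" "e1 \<noteq> e3" "e2 \<noteq> e3" "i \<in> e1" "i \<in> e2" "i \<in> e3" for e1 e2 e3 i
  proof -
    have other: "\<exists>j. e = {i,j} \<and> j \<noteq> i" if "card e = 2" "i \<in> e" for e
      using that by (auto simp: card_2_iff doubleton_eq_iff)
    obtain j k l where jkl: "e1 = {i,j}" "e2 = {i,k}" "e3 = {i,l}" "j \<noteq> i" "k \<noteq> i" "l \<noteq> i"
      using other e by metis
    then have d: "distinct [i,j,k,l]" using e by auto
    have "{i,j,k} \<in> T" "{i,k,l} \<in> T" "{i,j,l} \<in> T"
      using union[OF e(1,2,7,4,5)] union[OF e(2,3,9,5,6)] union[OF e(1,3,8,4,6)] jkl
      by (simp_all add: insert_commute)
    then have "deg T i = 3" "i \<in> I" using triangular_facet[OF _ _ _ d] T_sub by blast+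
    then show False using no3 by blast
  qed
  show ?thesis
  proof (cases "\<exists>i. {i} \<in> K")
    case True
    then obtain i where i: "{i} \<in> K" by blast
    have iI: "i \<in> I" using K(1) i by (auto simp: chamfer_index_def edges_def)
    have other: "i \<in> e \<and> card e = 2" if "e \<in> K" "e \<noteq> {i}" for e
      using K(2)[OF i that(1)] chamfer_adjacent(2)[of _ "{i}" e i] that(2) by blast
    have "\<exists>t\<in>T. i \<in> t \<and> K \<subseteq> corner i t"
    proof (cases "\<exists>e1\<in>K. \<exists>e2\<in>K. e1 \<noteq> {i} \<and> e2 \<noteq> {i} \<and> e1 \<noteq> e2")
      case True
      then obtain e1 e2 where e: "e1 \<in> K" "e2 \<in> K" "e1 \<noteq> {i}" "e2 \<noteq> {i}" "e1 \<noteq> e2" by blast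
      note o1 = other[OF e(1,3)] and o2 = other[OF e(2,4)]
      have t: "e1 \<union> e2 \<in> T" using union[OF e(1,2,5)] o1 o2 by blast
      have "e \<in> corner i (e1 \<union> e2)" if "e \<in> K" for e
      proof (cases "e = {i} \<or> e = e1 \<or> e = e2")
        case True
        then show ?thesis using o1 o2 by (auto simp: corner_def)
      next
        case False
        then show ?thesis using star[OF e(1,2) that] e other[OF that] o1 o2 by blast
      qed
      then show ?thesis using t o1 by blast
    next
      case False
      obtain e where e: "e \<in> edges" "i \<in> e" "K \<subseteq> {{i}, e}"
      proof (cases "K = {{i}}")
        case True
        obtain t where t: "t \<in> T" "i \<in> t" using cover iI by blast
        obtain j k where "t = {i,j,k}" "distinct [i,j,k]" using T_ijk[OF t] .
        then have "{i,j} \<in> edges" using edges_ij[OF t(1), of i j] by auto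
        then show thesis using that True by blast
      next
        case F: False
        then obtain e where e: "e \<in> K" "e \<noteq> {i}" using i by blast
        then have "K \<subseteq> {{i}, e}" using False by blast
        moreover have "e \<in> edges" using K(1) e other[OF e] by (auto simp: chamfer_index_def)
        ultimately show thesis using that other[OF e] by blast
      qed
      obtain t where t: "t \<in> T" "e \<subseteq> t" "card e = 2" using e(1) by (auto simp: edges_def)
      then have "K \<subseteq> corner i t" using e by (auto simp: corner_def)
      then show ?thesis using t e by blast
    qed
    then show ?thesis by (auto simp: chamfer_triples_def)
  next
    case False
    then have c2: "card e = 2" if "e \<in> K" for e using card12[OF that] that by auto
    have "\<exists>t\<in>T. K \<subseteq> core t"
    proof (cases "\<exists>e1\<in>K. \<exists>e2\<in>K. e1 \<noteq> e2")
      case True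
      then obtain e1 e2 where e: "e1 \<in> K" "e2 \<in> K" "e1 \<noteq> e2" by blast
      have t: "e1 \<union> e2 \<in> T" using union[OF e] c2 e by blast
      have "e \<subseteq> e1 \<union> e2" if k: "e \<in> K" for e
      proof (cases "e = e1 \<or> e = e2")
        case F: False
        have meet: "\<exists>p. p \<in> e \<and> p \<in> f" if "f \<in> K" "f \<noteq> e" for f
        proof (rule ccontr)
          assume "\<nexists>p. p \<in> e \<and> p \<in> f"
          then have "e \<inter> f = {}" by blast
          then have "card (e \<union> f) = 4" using c2[OF k] c2[OF that(1)] by (metis card_Un_disjoint card.infinite numeral_Bit0 zero_neq_numeral)
          then show False using union[OF k that(1)] that(2) c2[OF k] c2[OF that(1)] T_card by fastforce
        qed
        obtain p q where pq: "p \<in> e" "p \<in> e1" "q \<in> e" "q \<in> e2" using meet[OF e(1)] meet[OF e(2)] F by blast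
        \<comment> \<open>A common element of \<open>e\<close>, \<open>e1\<close> and
          \<open>e2\<close> would form a star. So \<open>e\<close> consists of one element of each
          of the other two.\<close>
        have "p \<noteq> q" using star[OF e(1,2) k c2[OF e(1)] c2[OF e(2)] c2[OF k] e(3)] F pq by blast
        then have "e = {p,q}" using c2[OF k] pq by (auto simp: card_2_iff)
        then show ?thesis using pq by auto
      qed auto
      then show ?thesis using t c2 by (auto simp: core_def)
    next
      case same: False
      show ?thesis
      proof (cases "K = {}")
        case True
        then show ?thesis using T_nonempty by auto
      next
        case F: False
        then obtain e where e: "e \<in> K" by blast
        then have "e \<in> edges" using K(1) c2[OF e] by (auto simp: chamfer_index_def)
        then obtain t where "t \<in> T" "e \<in> core t" by (auto simp: edges_def core_def)
        moreover have "K = {e}" using same e by blast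
        ultimately show ?thesis by blast
      qed
    qed
    then show ?thesis by (auto simp: chamfer_triples_def)
  qed
qed

lemma flag_polytope_from_system:
  assumes no3: "\<And>i. i \<in> I \<Longrightarrow> deg T i \<noteq> 3"
  shows "\<exists>P. polytope3 P \<and> simple_polytope3 P \<and> flag_polytope3 P \<and>
    (\<forall>k. k \<noteq> 6 \<longrightarrow> pk P k = card {i\<in>I. deg T i = k})"
proof -
  obtain \<epsilon> where "simple_system chamfer_index (chamfer_system \<epsilon>) chamfer_triples"
    using simple_system_chamfer by blast
  then interpret C: simple_system chamfer_index "chamfer_system \<epsilon>" chamfer_triples .
  have "flag_polytope3 (region chamfer_index (chamfer_system \<epsilon>))"
    by (rule C.flag_polytope3_region) (rule chamfer_flag[OF no3])
  moreover have "pk (region chamfer_index (chamfer_system \<epsilon>)) k = card {i\<in>I. deg T i = k}" if "k \<noteq> 6" for k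
  proof -
    have "{e\<in>chamfer_index. deg chamfer_triples e = k} = (\<lambda>i. {i}) ` {i\<in>I. deg T i = k}"
      using deg_chamfer_facet deg_chamfer_edge that by (auto simp: chamfer_index_def)
    then show ?thesis unfolding C.pk_region by (simp add: card_image)
  qed
  ultimately show ?thesis using C.polytope3_region C.simple_polytope3_region by blast
qed

end

text \<open>The three summands are the facets away from \<open>F\<close>, its neighbours, and
  \<open>F\<close> itself. The value 6 is left out because chamfering adds a hexagon for every
  edge.\<close>

lemma realized_polytope:
  assumes "realized ws M" "3 \<notin># M + mset ws + {#length ws#}"
  shows "\<exists>P. polytope3 P \<and> simple_polytope3 P \<and> flag_polytope3 P \<and>
    (\<forall>k. k \<noteq> 6 \<longrightarrow> pk P k = count (M + mset ws + {#length ws#}) k)"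
proof -
  obtain I c T F fs where r: "simple_system (I :: nat set) c T" "F \<in> I" "set fs \<subseteq> I"
    "cyclic_link T F fs" "ws = map (deg T) fs"
    "M = image_mset (deg T) (mset_set (I - insert F (set fs)))"
    using assms(1) unfolding realized_def by (elim exE conjE) (rule that)
  interpret simple_system I c T by (rule r(1))
  have fs: "distinct fs" "F \<notin> set fs" "3 \<le> length fs" "{t\<in>T. F \<in> t} = tris F (fs @ [hd fs])"
    using r(4) by (auto simp: cyclic_link_def)
  have "deg T F = length fs"
  proof -
    obtain a b gs where l: "fs = a # b # gs" using fs(3) by (metis Suc_le_length_iff numeral_3_eq_3)
    obtain h y where gy: "b # gs = h @ [y]" by (metis rev_exhaust list.distinct(1))
    have hne: "h \<noteq> []" using gy fs(3) l by (cases gs) auto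
    have "fs @ [hd fs] = (a # h) @ y # [a]" using l gy by simp
    then have "tris F (fs @ [hd fs]) = tris F (a # h @ [y]) \<union> {{F, y, a}}"
      using tris_append[of F "a # h" y "[a]"] by simp
    moreover have fh: "fs = a # h @ [y]" using l gy by simp
    moreover have "{F, y, a} \<notin> tris F fs"
    proof
      assume m: "{F, y, a} \<in> tris F fs"
      obtain h1 hs where h1: "h = h1 # hs" using hne by (cases h) auto
      then have "tris F fs = insert {F, a, h1} (tris F (h1 # hs @ [y]))" using fh by simp
      with m consider "{F, y, a} = {F, a, h1}" | "{F, y, a} \<in> tris F (h1 # hs @ [y])"
        by (metis insert_iff)
      then show False
      proof cases
        case 1
        then have "y \<in> {F, a, h1}" by blast
        then show False using fs(1,2) fh h1 by auto
      next
        case 2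
        from tris_subset[OF this] show False using fs(1,2) fh h1 by auto
      qed
    qed
    ultimately show ?thesis unfolding deg_def fs(4)
      using card_tris[OF fs(1,2)] finite_tris[of F fs] fs(3) by simp
  qed
  moreover have "mset_set I = {#F#} + mset_set (set fs) + mset_set (I - insert F (set fs))"
  proof -
    have "I = insert F (set fs \<union> (I - insert F (set fs)))" using r(2,3) by auto
    then have "mset_set I = mset_set (insert F (set fs \<union> (I - insert F (set fs))))" by simp
    also have "\<dots> = add_mset F (mset_set (set fs \<union> (I - insert F (set fs))))"
      using finite_I fs(2) by (intro mset_set.insert) auto
    also have "mset_set (set fs \<union> (I - insert F (set fs))) = mset_set (set fs) + mset_set (I - insert F (set fs))"
      using finite_I by (intro mset_set_Union) auto
    finally show ?thesis by simp
  qed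
  moreover have "mset_set (set fs) = mset fs" using fs(1) by (rule mset_set_set)
  ultimately have N: "M + mset ws + {#length ws#} = image_mset (deg T) (mset_set I)"
    using r(5,6) by simp
  have cnt: "count (image_mset (deg T) (mset_set I)) k = card {i\<in>I. deg T i = k}" for k
  proof -
    have "count (image_mset (deg T) (mset_set I)) k = (\<Sum>i\<in>I. if deg T i = k then 1 else 0)"
      using finite_I by (induction I rule: finite_induct) auto
    also have "\<dots> = card {i\<in>I. deg T i = k}" using finite_I by (simp add: sum.If_cases Int_def)
    finally show ?thesis .
  qed
  have "deg T i \<noteq> 3" if "i \<in> I" for i
    using assms(2) that finite_I unfolding N by auto
  from flag_polytope_from_system[OF this] show ?thesis unfolding N cnt .
qed

section \<open>Rewriting of cyclic words\<close>

text \<open>The number of hexagons is free, so the closed facets are recorded only up to additional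
  hexagons.\<close>

definition reachable :: "nat list \<Rightarrow> nat multiset \<Rightarrow> bool" where
  "reachable ws M \<longleftrightarrow> (\<exists>j. realized ws (M + replicate_mset j 6))"

definition non6 :: "nat multiset \<Rightarrow> nat multiset" where
  "non6 M = filter_mset (\<lambda>x. x \<noteq> 6) M"

text \<open>A local move on a factor of the cyclic word: \<open>r\<close> is the rest of the word,
  and \<open>M\<close> collects the facets closed by the move. Rotation makes the move applicable at
  any position.\<close>

definition rw :: "nat list \<Rightarrow> nat list \<Rightarrow> nat multiset \<Rightarrow> bool" where
  "rw u v M \<longleftrightarrow> (\<forall>r N. reachable (u @ r) N \<longrightarrow> reachable (v @ r) (N + M))"

abbreviation fives :: "nat \<Rightarrow> nat list" where "fives n \<equiv> replicate n 5"

lemma non6_simps [simp]: "non6 {#} = {#}" "non6 (A + B) = non6 A + non6 B"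
  "non6 (add_mset x A) = (if x = 6 then non6 A else add_mset x (non6 A))"
  by (simp_all add: non6_def)

lemma non6_decomp: "\<exists>j. A = non6 A + replicate_mset j 6"
proof -
  have "A = non6 A + filter_mset (\<lambda>x. x = 6) A" unfolding non6_def by (simp add: multiset_partition)
  moreover have "filter_mset (\<lambda>x. x = 6) A = replicate_mset (count A 6) 6"
    by (metis filter_eq_replicate_mset)
  ultimately show ?thesis by metis
qed

lemma reachable_append_commute: "reachable (xs @ ys) N \<Longrightarrow> reachable (ys @ xs) N"
proof (induction xs arbitrary: ys)
  case (Cons x xs)
  then have "reachable ((xs @ ys) @ [x]) N"
    unfolding reachable_def using realized_rotate[of x "xs @ ys"] by (metis append_Cons)
  then have "reachable (xs @ (ys @ [x])) N" by simp
  from Cons.IH[OF this] show ?case by simp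
qed simp

lemma rw_split: "rw (a # w @ [b]) [Suc a, length w + 3, Suc b] (non6 (mset w))"
  unfolding rw_def
proof (intro allI impI)
  fix r N assume "reachable ((a # w @ [b]) @ r) N"
  then obtain j where "realized (a # w @ b # r) (N + replicate_mset j 6)" by (auto simp: reachable_def)
  from realized_split[OF this]
  have 1: "realized (Suc a # (length w + 3) # Suc b # r) (N + replicate_mset j 6 + mset w)" .
  obtain i where i: "mset w = non6 (mset w) + replicate_mset i 6" using non6_decomp by blast
  have "N + replicate_mset j 6 + mset w = (N + non6 (mset w)) + replicate_mset (j + i) 6"
    by (subst i) (simp add: multiset_eq_iff)
  with 1 show "reachable ([Suc a, length w + 3, Suc b] @ r) (N + non6 (mset w))"
    unfolding reachable_def by (metis append_Cons append_Nil)
qed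

lemma rw_refl: "rw u u {#}" by (simp add: rw_def)

lemma rw_trans: "rw u v M \<Longrightarrow> rw v w M' \<Longrightarrow> rw u w (M + M')"
  unfolding rw_def by (metis add.assoc)

lemma rw_context: "rw u v M \<Longrightarrow> rw (p @ u @ q) (p @ v @ q) M"
  unfolding rw_def
proof (intro allI impI)
  fix r N
  assume h: "\<forall>r N. reachable (u @ r) N \<longrightarrow> reachable (v @ r) (N + M)" and "reachable ((p @ u @ q) @ r) N"
  then have "reachable (p @ (u @ q @ r)) N" by simp
  then have "reachable (u @ (q @ r @ p)) N" using reachable_append_commute by fastforce
  then have "reachable (v @ (q @ r @ p)) (N + M)" using h by blast
  then have "reachable ((v @ q @ r) @ p) (N + M)" by simp
  from reachable_append_commute[OF this] show "reachable ((p @ v @ q) @ r) (N + M)" by simp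
qed

lemma rw_step:
  assumes "rw u v M" "x = p @ u @ q" "rw (p @ v @ q) y M'"
  shows "rw x y (M + M')"
  using rw_trans[OF rw_context[OF assms(1), of p q] assms(3)] assms(2) by simp

lemma rw_append: "rw u v M \<Longrightarrow> rw u' v' M' \<Longrightarrow> rw (u @ u') (v @ v') (M + M')"
  using rw_step[of u v M "u @ u'" "[]" u' "v @ v'" M'] rw_context[of u' v' M' v "[]"] by simp

lemma rw_reachable: "rw u v M \<Longrightarrow> reachable (p @ u @ q) N \<Longrightarrow> reachable (p @ v @ q) (N + M)"
  using rw_context[of u v M p q] unfolding rw_def by (metis append_Nil2)

section \<open>Elementary moves and fans\<close>

lemma rw_insert: "rw [a, b] [Suc a, 3, Suc b] {#}"
  using rw_split[of a "[]" b] by simp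

lemma rw_close1: "rw [a, x, b] [Suc a, 4, Suc b] (non6 {#x#})"
  using rw_split[of a "[x]" b] by simp

lemma rw_close2: "rw [a, x, y, b] [Suc a, 5, Suc b] (non6 {#x, y#})"
  using rw_split[of a "[x, y]" b] by (simp add: add_mset_commute)

text \<open>All insertions take place directly behind \<open>x\<close>: each raises \<open>x\<close>
  by one and turns the previous triangle into a quadrangle.\<close>

lemma rw_fan: "rw [x, b] ([x + Suc j, 3] @ replicate j 4 @ [Suc b]) {#}"
proof (induction j)
  case 0
  then show ?case using rw_insert[of x b] by simp
next
  case (Suc j)
  have "rw ([] @ [x + Suc j, 3] @ (replicate j 4 @ [Suc b])) ([] @ [Suc (x + Suc j), 3, 4] @ (replicate j 4 @ [Suc b])) {#}"
    using rw_context[OF rw_insert[of "x + Suc j" 3], of "[]" "replicate j 4 @ [Suc b]"] by simp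
  then show ?case using rw_trans[OF Suc] by (simp add: numeral_eq_Suc)
qed

text \<open>The large facet is built with only \<open>k - 1\<close> sides because the ring that
  closes it adds one. The pattern \<open>3, 4\<close> reappears behind it, ready for the next
  fan.\<close>

lemma rw_fan34: "6 \<le> k \<Longrightarrow> rw [3, 4] ([k - 1, 3, 4] @ replicate (k - 6) 4 @ [5]) {#}"
proof -
  assume "6 \<le> k"
  then have "k - 5 = Suc (k - 6)" "3 + Suc (k - 5) = k - 1" by auto
  then show ?thesis using rw_fan[of 3 4 "k - 5"] by simp
qed

text \<open>What the fans leave behind: \<open>k - 6\<close> letters 4, the future pentagons that
  balance a \<open>k\<close>-gon, and a letter 5. An entry \<open>k = 6\<close> leaves just a 5;
  such entries are the spare hexagons that adjust the length.\<close>

definition fan_word :: "nat list \<Rightarrow> nat list" where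
  "fan_word ks = concat (map (\<lambda>k. replicate (k - 6) 4 @ [5]) ks)"

lemma fan_word_simps [simp]: "fan_word [] = []" "fan_word (k # ks) = replicate (k - 6) 4 @ 5 # fan_word ks"
  "fan_word (ks @ ls) = fan_word ks @ fan_word ls" "fan_word (replicate n 6) = fives n"
proof -
  show "fan_word (replicate n 6) = fives n" unfolding fan_word_def by (induction n) auto
qed (simp_all add: fan_word_def)

lemma set_fan_word: "set (fan_word ks) \<subseteq> {4, 5}"
  by (induction ks) (auto simp: set_replicate_conv_if)

lemma count_list_replicate: "count_list (replicate n x) y = (if x = y then n else 0)"
  by (induction n) auto

lemma count_fan_word: "count_list (fan_word ks) 4 = (\<Sum>k\<leftarrow>ks. k - 6)"
  by (induction ks) (auto simp: count_list_append count_list_replicate)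

lemma length_fan_word: "length (fan_word ks) = (\<Sum>k\<leftarrow>ks. k - 6) + length ks"
  by (induction ks) auto

text \<open>Fans are chained at the pattern \<open>3, 4\<close> behind the large facets. The start
  is the tetrahedron with one small fan, whose remaining letters stay at both ends.\<close>

lemma reachable_fan_word:
  "\<forall>k\<in>set ks. 6 \<le> k \<Longrightarrow>
     \<exists>bs. mset bs = mset (map (\<lambda>k. k - 1) ks) \<and> reachable ([5] @ bs @ [3, 4] @ fan_word ks @ [4, 3]) {#}"
proof (induction ks)
  case Nil
  have "reachable [3, 3, 3] {#}" using realized_simplex unfolding reachable_def by (intro exI[of _ 0]) simp
  moreover have "rw [3, 3] [5, 3, 4, 4] {#}" using rw_fan[of 3 3 1] by simp
  ultimately have "reachable ([5, 3, 4, 4] @ [3]) {#}" using rw_reachable[of "[3,3]" "[5,3,4,4]" "{#}" "[]" "[3]"] by simp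
  then show ?case by simp
next
  case (Cons k ks)
  then obtain bs where bs: "mset bs = mset (map (\<lambda>k. k - 1) ks)"
    "reachable (([5] @ bs) @ [3, 4] @ (fan_word ks @ [4, 3])) {#}" by auto
  have "6 \<le> k" using Cons.prems by simp
  from rw_reachable[OF rw_fan34[OF this] bs(2)]
  have "reachable ([5] @ (bs @ [k - 1]) @ [3, 4] @ fan_word (k # ks) @ [4, 3]) {#}" by simp
  moreover have "mset (bs @ [k - 1]) = mset (map (\<lambda>k. k - 1) (k # ks))" using bs(1) by simp
  ultimately show ?case by blast
qed

section \<open>Merging two letters 4 into one letter 3\<close>

lemma rw_row: "rw ([g, 6] @ fives j @ [4]) ([Suc g] @ fives j @ [4, 5]) {#}"
proof (induction j arbitrary: g)
  case 0
  then show ?case using rw_close1[of g 6 4] by simp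
next
  case (Suc j)
  have "rw [g, 6, 5] [Suc g, 4, 6] {#}" using rw_close1[of g 6 5] by simp
  moreover have "rw ([Suc g] @ ([4, 6] @ fives j @ [4]) @ []) ([Suc g] @ ([5] @ fives j @ [4, 5]) @ []) {#}"
    using rw_context[OF Suc[of 4], of "[Suc g]" "[]"] by simp
  ultimately have "rw ([g, 6, 5] @ fives j @ [4]) ([Suc g] @ [5] @ fives j @ [4, 5]) ({#} + {#})"
    by - (rule rw_step[of "[g, 6, 5]" "[Suc g, 4, 6]" "{#}" _ "[]" "fives j @ [4]"], simp_all)
  then show ?case by simp
qed

text \<open>In a ring two letters 4 become two pentagons and a letter 3 becomes one quadrangle; this
  move trades one for the other and closes only hexagons. A triangle inserted behind the left 4
  raises the next 5 to a 6, and the row of hexagons started by this 6 restores the pattern with a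
  gap shorter by one.\<close>

lemma rw_merge: "rw ([4] @ fives a @ [4]) (fives (Suc a) @ [3] @ fives (Suc a)) {#}"
proof (induction a)
  case 0
  then show ?case using rw_insert[of 4 4] by simp
next
  case (Suc a)
  have 1: "rw [4, 5] [5, 3, 6] {#}" using rw_insert[of 4 5] by simp
  have 2: "rw ([5] @ ([3, 6] @ fives a @ [4]) @ []) ([5] @ ([4] @ fives a @ [4, 5]) @ []) {#}"
    using rw_context[OF rw_row[of 3 a], of "[5]" "[]"] by simp
  have 3: "rw ([5] @ ([4] @ fives a @ [4]) @ [5]) ([5] @ (fives (Suc a) @ [3] @ fives (Suc a)) @ [5]) {#}"
    by (rule rw_context[OF Suc])
  have "rw ([4, 5] @ fives a @ [4]) ([5] @ ([4] @ fives a @ [4]) @ [5]) ({#} + {#})"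
    using 2 by - (rule rw_step[OF 1, of _ "[]" "fives a @ [4]"], simp_all)
  from rw_trans[OF this 3] show ?case
    by (simp add: replicate_append_same)
qed

lemma first_four:
  assumes "set X \<subseteq> {4, 5}" "0 < count_list X 4"
  obtains p Y where "X = fives p @ 4 # Y"
proof -
  have "4 \<in> set X" using assms(2) by (metis count_notin less_irrefl)
  then obtain us Y where "X = us @ 4 # Y" "4 \<notin> set us" by (meson split_list_first)
  moreover then have "us = fives (length us)" using assms(1) by (intro replicate_length_same[symmetric]) auto
  ultimately show thesis using that by metis
qed

lemma rw_merge_many:
  assumes "set X \<subseteq> {4, 5}" "2 * q \<le> count_list X 4"
  shows "\<exists>X'. rw X X' {#} \<and> set X' \<subseteq> {3, 4, 5} \<and> count_list X' 3 = q \<and>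
    count_list X' 4 = count_list X 4 - 2 * q"
  using assms
proof (induction q arbitrary: X)
  case 0
  have "3 \<notin> set X" using 0 by auto
  then have "count_list X 3 = 0" by simp
  then show ?case using 0 rw_refl by (intro exI[of _ X]) auto
next
  case (Suc q)
  obtain p Z where X: "X = fives p @ 4 # Z" using first_four[OF Suc.prems(1)] Suc.prems(2) by auto
  have cp: "count_list (fives n) 4 = 0" "count_list (fives n) 3 = 0" for n
    by (simp_all add: count_list_0_iff)
  have "set Z \<subseteq> {4, 5}" "0 < count_list Z 4"
    using Suc.prems by (auto simp: X count_list_append cp)
  then obtain a Y where Z: "Z = fives a @ 4 # Y" using first_four by blast
  have Y: "set Y \<subseteq> {4, 5}" "count_list X 4 = count_list Y 4 + 2"
    using Suc.prems(1) by (auto simp: X Z count_list_append cp)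
  then obtain Y' where Y': "rw Y Y' {#}" "set Y' \<subseteq> {3, 4, 5}" "count_list Y' 3 = q"
    "count_list Y' 4 = count_list Y 4 - 2 * q"
    using Suc.IH[of Y] Suc.prems(2) by auto
  have "rw (fives p @ ([4] @ fives a @ [4]) @ Y) (fives p @ (fives (Suc a) @ [3] @ fives (Suc a)) @ Y') ({#} + ({#} + {#}))"
    by (intro rw_append rw_refl rw_merge Y')
  then show ?case
    using Y' Y(2) by (intro exI[of _ "fives p @ (fives (Suc a) @ [3] @ fives (Suc a)) @ Y'"])
      (auto simp: X Z count_list_append cp set_replicate_conv_if)
qed

text \<open>If each block has an even number of letters 4, its first merges with a 4 on its left,
  its last with one on its right, and the inner ones among themselves. A gap of \<open>a\<close>
  letters turns a factor of length \<open>a + 2\<close> into one of length \<open>2 * a + 3\<close>,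
  whence the length modulo 3. The variable \<open>a\<close> is general because an entry 6 has no
  letter 4 and only widens the gap.\<close>

lemma rw_merge_even:
  assumes "\<forall>k\<in>set ks. 6 \<le> k \<and> even k"
  shows "\<exists>Z. rw ([4] @ fives a @ fan_word ks @ [4]) Z {#} \<and> set Z \<subseteq> {3, 5} \<and>
    2 * count_list Z 3 = 2 + (\<Sum>k\<leftarrow>ks. k - 6) \<and> length Z mod 3 = (2 * a + 2 * length ks) mod 3"
  using assms
proof (induction ks arbitrary: a)
  case Nil
  have "length (fives (Suc a) @ [3] @ fives (Suc a)) mod 3 = (2 * a) mod 3"
    by simp
  then show ?case using rw_merge[of a]
    by (intro exI[of _ "fives (Suc a) @ [3] @ fives (Suc a)"]) (auto simp: count_list_append count_list_0_iff set_replicate_conv_if)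
next
  case (Cons k ks)
  show ?case
  proof (cases "k = 6")
    case True
    then have eq: "[4] @ fives a @ fan_word (k # ks) @ [4] = [4] @ fives (Suc a) @ fan_word ks @ [4]"
      by (simp add: replicate_app_Cons_same)
    moreover obtain Z where "rw ([4] @ fives (Suc a) @ fan_word ks @ [4]) Z {#}" "set Z \<subseteq> {3, 5}"
      "2 * count_list Z 3 = 2 + (\<Sum>k\<leftarrow>ks. k - 6)" "length Z mod 3 = (2 * Suc a + 2 * length ks) mod 3"
      using Cons.IH[of "Suc a"] Cons.prems by auto
    ultimately show ?thesis unfolding eq using True by (intro exI[of _ Z]) auto
  next
    case False
    \<comment> \<open>The block has \<open>2 * j + 2\<close> letters 4, of which
      \<open>2 * j\<close> are inner ones.\<close>
    then obtain j where j: "k - 6 = Suc (2 * j + 1)" "k = 2 * j + 8"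
    proof -
      have "6 \<le> k" "even k" using Cons.prems by auto
      then obtain m where "k = 2 * m" by blast
      then have "k = 2 * (m - 4) + 8" "k - 6 = Suc (2 * (m - 4) + 1)" using \<open>6 \<le> k\<close> False by auto
      then show thesis using that by blast
    qed
    have pairs: "\<exists>Q. rw (replicate (2 * j) 4) Q {#} \<and> set Q \<subseteq> {3, 5} \<and> count_list Q 3 = j \<and> length Q = 3 * j"
    proof (induction j)
      case 0
      then show ?case using rw_refl by (intro exI[of _ "[]"]) auto
    next
      case (Suc j)
      then obtain Q where "rw (replicate (2 * j) 4) Q {#}" "set Q \<subseteq> {3, 5}" "count_list Q 3 = j" "length Q = 3 * j" by blast
      moreover have "rw [4, 4] [5, 3, 5] {#}" using rw_insert[of 4 4] by simp
      ultimately show ?case using rw_append[of "[4, 4]" "[5, 3, 5]" "{#}" "replicate (2 * j) 4" Q "{#}"]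
        by (intro exI[of _ "[5, 3, 5] @ Q"]) auto
    qed
    then obtain Q where Q: "rw (replicate (2 * j) 4) Q {#}" "set Q \<subseteq> {3, 5}" "count_list Q 3 = j" "length Q = 3 * j" by blast
    obtain Z where Z: "rw ([4] @ fives 1 @ fan_word ks @ [4]) Z {#}" "set Z \<subseteq> {3, 5}"
      "2 * count_list Z 3 = 2 + (\<Sum>k\<leftarrow>ks. k - 6)" "length Z mod 3 = (2 * 1 + 2 * length ks) mod 3"
      using Cons.IH[of 1] Cons.prems by auto
    let ?P = "fives (Suc a) @ [3] @ fives (Suc a)"
    have eq: "[4] @ fives a @ fan_word (k # ks) @ [4] =
      ([4] @ fives a @ [4]) @ (replicate (2 * j) 4 @ ([4] @ fives 1 @ fan_word ks @ [4]))"
      using j by (simp add: replicate_app_Cons_same)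
    moreover have "rw (([4] @ fives a @ [4]) @ (replicate (2 * j) 4 @ ([4] @ fives 1 @ fan_word ks @ [4])))
      (?P @ (Q @ Z)) ({#} + ({#} + {#}))"
      by (intro rw_append rw_merge Q Z)
    moreover have "2 * count_list (?P @ Q @ Z) 3 = 2 + (\<Sum>k\<leftarrow>k # ks. k - 6)"
      using Q Z j by (simp add: count_list_append count_list_0_iff)
    moreover have "length (?P @ Q @ Z) mod 3 = (2 * a + 2 * length (k # ks)) mod 3"
    proof -
      have "length (?P @ Q @ Z) = 3 + 2 * a + 3 * j + length Z" using Q by simp
      also have "\<dots> = 3 * (1 + j) + (2 * a + length Z)" by simp
      also have "\<dots> mod 3 = (2 * a + length Z) mod 3" by (rule mod_mult_self4)
      also have "\<dots> = (2 * a + (2 * 1 + 2 * length ks)) mod 3" using Z(4) by (rule mod_add_cong[OF refl])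
      finally show ?thesis by (simp add: algebra_simps)
    qed
    ultimately show ?thesis unfolding eq using Q(2) Z(2)
      by (intro exI[of _ "?P @ Q @ Z"] conjI) (auto simp: set_replicate_conv_if)
  qed
qed

section \<open>Rings and caps\<close>

text \<open>The letter \<open>Suc s\<close> already counts the ring facet on its left. Its
  \<open>m\<close> private facets are inserted one after the other, and a last facet closes
  it.\<close>

lemma rw_roll: "rw [g, Suc s, b] (Suc g # replicate m 4 @ [4, Suc b]) (non6 {#s + Suc m#})"
proof (induction m arbitrary: g s)
  case 0
  then show ?case using rw_close1[of g "Suc s" b] by simp
next
  case (Suc m)
  have 1: "rw [g, Suc s] [Suc g, 3, Suc (Suc s)] {#}" by (rule rw_insert)
  have "rw ([Suc g] @ [3, Suc (Suc s), b] @ []) ([Suc g] @ (Suc 3 # replicate m 4 @ [4, Suc b]) @ []) (non6 {#Suc s + Suc m#})"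
    by (rule rw_context[OF Suc])
  then have "rw [g, Suc s, b] ([Suc g] @ (Suc 3 # replicate m 4 @ [4, Suc b])) ({#} + non6 {#Suc s + Suc m#})"
    by - (rule rw_step[OF 1, of _ "[]" "[b]"], simp_all)
  then show ?case by simp
qed

text \<open>Consecutive letters share a ring facet: it appears as a 4 when the first of them is
  closed and becomes a 5 when the second is. It has then also raised the second letter by one, which
  is the form that the next roll expects.\<close>

lemma rw_rolls:
  "rw (g # Suc x # xs @ [b])
     (Suc g # replicate (m x) 4 @ concat (map (\<lambda>y. 5 # replicate (m y) 4) xs) @ [4, Suc b])
     (non6 (mset (map (\<lambda>y. y + Suc (m y)) (x # xs))))"
proof (induction xs arbitrary: g x)
  case Nil
  then show ?case using rw_roll[of g x b "m x"] by simp
next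
  case (Cons y ys)
  let ?p = "Suc g # replicate (m x) 4"
  have 1: "rw [g, Suc x, y] (?p @ [4, Suc y]) (non6 {#x + Suc (m x)#})"
    using rw_roll[of g x y "m x"] by simp
  have 2: "rw (?p @ (4 # Suc y # ys @ [b]) @ [])
      (?p @ (Suc 4 # replicate (m y) 4 @ concat (map (\<lambda>y. 5 # replicate (m y) 4) ys) @ [4, Suc b]) @ [])
      (non6 (mset (map (\<lambda>y. y + Suc (m y)) (y # ys))))"
    by (rule rw_context[OF Cons])
  have "rw (g # Suc x # (y # ys) @ [b])
      (?p @ (Suc 4 # replicate (m y) 4 @ concat (map (\<lambda>y. 5 # replicate (m y) 4) ys) @ [4, Suc b]))
      (non6 {#x + Suc (m x)#} + non6 (mset (map (\<lambda>y. y + Suc (m y)) (y # ys))))"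
    using 2 by - (rule rw_step[OF 1, of _ "[]" "ys @ [b]"], simp_all)
  moreover have "non6 {#x + Suc (m x)#} + non6 (mset (map (\<lambda>y. y + Suc (m y)) (y # ys))) =
      non6 (mset (map (\<lambda>y. y + Suc (m y)) (x # y # ys)))"
    by (simp del: mset_map)
  ultimately show ?case by (simp del: mset_map)
qed

text \<open>A complete ring of new faces around the word: the letter \<open>s\<close> receives \<open>m s\<close> faces that meet
  only it, besides the two faces it shares with its neighbours, so it is closed as an
  \<open>(s + m s + 1)\<close>-gon. The last two letters get no private faces.\<close>

lemma reachable_ring:
  assumes "reachable (x # xs @ [y, z]) N"
  shows "reachable ([5, 5] @ concat (map (\<lambda>y. 5 # replicate (m y) 4) (x # xs)))
    (N + non6 (mset (map (\<lambda>y. y + Suc (m y)) (x # xs)) + {#Suc y, Suc z#}))"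
proof -
  let ?mid = "concat (map (\<lambda>y. 5 # replicate (m y) 4) xs)"
  have "reachable ((x # xs @ [y]) @ [z]) N" using assms by simp
  from reachable_append_commute[OF this]
  have "reachable ([] @ [z, x] @ (xs @ [y])) N" by simp
  from rw_reachable[OF rw_insert this]
  have "reachable ([Suc z] @ (3 # Suc x # xs @ [y])) N" by simp
  from reachable_append_commute[OF this]
  have "reachable ([] @ (3 # Suc x # xs @ [y]) @ [Suc z]) N" by simp
  from rw_reachable[OF rw_rolls[where m = m] this]
  have "reachable ((4 # replicate (m x) 4 @ ?mid) @ [4, Suc y, Suc z]) (N + non6 (mset (map (\<lambda>y. y + Suc (m y)) (x # xs))))"
    (is "reachable _ ?N") by (simp del: mset_map)
  from reachable_append_commute[OF this]
  have "reachable ([] @ [4, Suc y, Suc z, 4] @ (replicate (m x) 4 @ ?mid)) ?N" by (simp del: mset_map)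
  \<comment> \<open>A single facet across the last two letters joins the end of the ring to its
    beginning.\<close>
  from rw_reachable[OF rw_close2 this]
  have "reachable ([5, 5] @ concat (map (\<lambda>y. 5 # replicate (m y) 4) (x # xs))) (?N + non6 {#Suc y, Suc z#})"
    by (simp del: mset_map non6_simps(3))
  then show ?thesis by (simp only: non6_simps(2) add.assoc)
qed

text \<open>The ring without private facets: it closes letters 3 and 4 as quadrangles and pentagons,
  completes each \<open>k - 1\<close> to a \<open>k\<close>-gon, and leaves a tube.\<close>

lemma reachable_ring0:
  assumes "reachable ws N" "3 \<le> length ws"
  shows "reachable (fives (length ws)) (N + non6 (mset (map Suc ws)))"
proof -
  obtain x ws' where w: "ws = x # ws'" "2 \<le> length ws'" using assms(2) by (cases ws) auto
  obtain ys z where "ws' = ys @ [z]" using w(2) by (cases ws' rule: rev_cases) auto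
  moreover then obtain xs y where "ys = xs @ [y]" using w(2) by (cases ys rule: rev_cases) auto
  ultimately have e: "ws = x # xs @ [y, z]" using w by simp
  have c: "concat (map (\<lambda>y. 5 # replicate 0 4) us) = fives (length us)" for us :: "nat list" by (induction us) auto
  have w: "[5, 5] @ fives (length (x # xs)) = fives (length ws)" by (simp add: e)
  have f: "mset (map (\<lambda>y. y + Suc 0) (x # xs)) + {#Suc y, Suc z#} = mset (map Suc ws)" by (simp add: e)
  show ?thesis using reachable_ring[of x xs y z N "\<lambda>_. 0"] assms(1) unfolding c w f unfolding e by blast
qed

lemma non6_Suc:
  "set Y \<subseteq> {3, 4, 5} \<Longrightarrow>
    non6 (mset (map Suc Y)) = replicate_mset (count_list Y 3) 4 + replicate_mset (count_list Y 4) 5"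
  by (induction Y) auto

text \<open>A corner of the cap has curvature 2: either one quadrangle, using four letters, or two
  pentagons, using five, as in \<open>rw_pent_cap\<close>. Both leave the border
  \<open>6 5 5 6\<close>, so they are interchangeable.\<close>

lemma rw_quad_cap: "rw (fives 4) [6, 5, 5, 6] {#4#}"
proof -
  have 1: "rw [5, 5] [6, 3, 6] {#}" using rw_insert[of 5 5] by simp
  have 2: "rw [5, 6, 3] [6, 4, 4] {#}" using rw_close1[of 5 6 3] by simp
  have 3: "rw [4, 4, 6, 5] [5, 5, 6] {#4#}" using rw_close2[of 4 4 6 5] by simp
  have a: "rw ([6] @ [4, 4, 6, 5] @ []) ([6] @ [5, 5, 6] @ []) {#4#}" by (rule rw_context[OF 3])
  have b: "rw [5, 6, 3, 6, 5] [6, 5, 5, 6] ({#} + {#4#})"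
    using a by - (rule rw_step[OF 2, of _ "[]" "[6, 5]"], simp_all)
  have "rw [5, 5, 5, 5] [6, 5, 5, 6] ({#} + ({#} + {#4#}))"
    using b by - (rule rw_step[OF 1, of _ "[5]" "[5]"], simp_all)
  moreover have "fives 4 = [5, 5, 5, 5]" by (simp add: eval_nat_numeral)
  ultimately show ?thesis by simp
qed

lemma rw_pent_cap: "rw (fives 5) [6, 5, 5, 6] {#5, 5#}"
proof -
  have 1: "rw [5, 5, 5] [6, 4, 6] {#5#}" using rw_close1[of 5 5 5] by simp
  have 2: "rw [5, 6, 4] [6, 4, 5] {#}" using rw_close1[of 5 6 4] by simp
  have 3: "rw [4, 5, 6, 5] [5, 5, 6] {#5#}" using rw_close2[of 4 5 6 5] by simp
  have a: "rw ([6] @ [4, 5, 6, 5] @ []) ([6] @ [5, 5, 6] @ []) {#5#}" by (rule rw_context[OF 3])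
  have b: "rw [5, 6, 4, 6, 5] [6, 5, 5, 6] ({#} + {#5#})"
    using a by - (rule rw_step[OF 2, of _ "[]" "[6, 5]"], simp_all)
  have "rw [5, 5, 5, 5, 5] [6, 5, 5, 6] ({#5#} + ({#} + {#5#}))"
    using b by - (rule rw_step[OF 1, of _ "[5]" "[5]"], simp_all)
  moreover have "fives 5 = [5, 5, 5, 5, 5]" by (simp add: eval_nat_numeral)
  ultimately show ?thesis by simp
qed

text \<open>A row of hexagons along one side of a hole whose corners are letters 6: it starts at one
  corner, each closed letter turns the next 5 into a 6, and it ends by closing the second
  corner.\<close>

lemma rw_push: "rw ([g, 6] @ fives j @ [6, 5]) ([Suc g] @ fives (Suc j) @ [6]) {#}"
proof (induction j arbitrary: g)
  case 0
  then show ?case using rw_close2[of g 6 6 5] by simp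
next
  case (Suc j)
  have 1: "rw [g, 6, 5] [Suc g, 4, 6] {#}" using rw_close1[of g 6 5] by simp
  have "rw ([Suc g] @ ([4, 6] @ fives j @ [6, 5]) @ []) ([Suc g] @ ([Suc 4] @ fives (Suc j) @ [6]) @ []) {#}"
    by (rule rw_context[OF Suc])
  then have "rw ([g, 6, 5] @ fives j @ [6, 5]) ([Suc g] @ ([Suc 4] @ fives (Suc j) @ [6])) ({#} + {#})"
    by - (rule rw_step[OF 1, of _ "[]" "fives j @ [6, 5]"], simp_all)
  then show ?case by simp
qed

text \<open>Part of the border of the hole in the cap: letters 6 are corners, with \<open>x\<close>
  and \<open>y\<close> letters 5 between them. Three copies bound a hexagonal hole with alternating
  sides.\<close>

definition hex_side :: "nat \<Rightarrow> nat \<Rightarrow> nat list" where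
  "hex_side x y = [6] @ fives x @ [6] @ fives y"

definition hex_word :: "nat \<Rightarrow> nat \<Rightarrow> nat list" where
  "hex_word x y = hex_side x y @ hex_side x y @ hex_side x y"

lemma hex_word_swap: "reachable (hex_word x y) N \<Longrightarrow> reachable (hex_word y x) N"
  using reachable_append_commute[of "[6] @ fives x" "[6] @ fives y @ [6] @ fives x @ [6] @ fives y @ [6] @ fives x @ [6] @ fives y" N]
  by (simp add: hex_word_def hex_side_def)

text \<open>After a rotation by one letter, each side of type \<open>x\<close> has a 5 from the
  adjacent \<open>y\<close> sides at both ends. A row along each of the three sides lengthens it by
  one and shortens the \<open>y\<close> sides by two.\<close>

lemma hex_word_push:
  assumes "reachable (hex_word x (Suc (Suc y))) N"
  shows "reachable (hex_word (Suc x) y) N"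
proof -
  let ?s = "([5, 6] @ fives x @ [6, 5]) @ fives y"
  have r: "rw ?s (hex_side (Suc x) y) ({#} + {#})"
    using rw_append[OF rw_push[of 5 x] rw_refl[of "fives y"]] by (simp add: hex_side_def)
  have eq: "hex_word x (Suc (Suc y)) =
     ([6] @ fives x @ [6, 5] @ fives y @ [5, 6] @ fives x @ [6, 5] @ fives y @ [5, 6] @ fives x @ [6, 5] @ fives y) @ [5]"
    by (simp add: hex_word_def hex_side_def replicate_app_Cons_same replicate_append_same)
  from reachable_append_commute[OF assms[unfolded eq]]
  have "reachable ([] @ (?s @ (?s @ ?s)) @ []) N" by simp
  from rw_reachable[OF rw_append[OF r rw_append[OF r r]] this]
  show ?thesis by (simp add: hex_word_def)
qed

text \<open>A round of pushes lowers \<open>x + y\<close> by one and needs a side of at least two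
  letters; a rotation exchanges \<open>x\<close> and \<open>y\<close>. The holes with both at most 1
  are filled directly, and at the end six hexagons surround \<open>F\<close>, a hexagon
  itself.\<close>

lemma reachable_hex_word: "reachable (hex_word x y) N \<Longrightarrow> reachable [6,6,6,6,6,6] N"
proof (induction "x + y" arbitrary: x y rule: less_induct)
  case less
  have t01: "reachable [6,6,6,6,6,6] N" if "reachable (hex_word 0 1) N"
  proof -
    have "reachable ([6,6] @ [5,6,6,5,6,6,5]) N" using that by (simp add: hex_word_def hex_side_def)
    from reachable_append_commute[OF this]
    have "reachable ([] @ [5,6,6,5] @ [6,6,5,6,6]) N" by simp
    from rw_reachable[OF rw_close2 this]
    have "reachable ([6] @ (5 # [6,6,6] @ [5]) @ [6,6]) N" by simp
    from rw_reachable[OF rw_split this] show ?thesis by simp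
  qed
  have t11: "reachable [6,6,6,6,6,6] N" if "reachable (hex_word 1 1) N"
  proof -
    have "reachable ([6] @ [5,6,5] @ [6,5,6,5,6,5,6,5]) N" using that by (simp add: hex_word_def hex_side_def)
    from rw_reachable[OF rw_close1 this]
    have "reachable ([6,6] @ [4,6,6,5] @ [6,5,6,5,6,5]) N" by simp
    from rw_reachable[OF rw_close2 this]
    have "reachable ([6,6,5] @ [5,6,6,5] @ [6,5,6,5]) N" by simp
    from rw_reachable[OF rw_close2 this]
    have "reachable ([6,6,5,6] @ [5,6,6,5] @ [6,5]) N" by simp
    from rw_reachable[OF rw_close2 this]
    have "reachable ([6,6,5,6,6] @ [5,6,6,5] @ []) N" by simp
    from rw_reachable[OF rw_close2 this]
    have "reachable ([6,6,5,6,6,6] @ [5,6]) N" by simp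
    from reachable_append_commute[OF this]
    have "reachable ([] @ (5 # [6,6,6] @ [5]) @ [6,6,6]) N" by simp
    from rw_reachable[OF rw_split this] show ?thesis by simp
  qed
  consider y' where "y = Suc (Suc y')" | x' where "x = Suc (Suc x')" | "x \<le> 1" "y \<le> 1"
    by (metis One_nat_def le_SucE le_zero_eq not0_implies_Suc not_less_eq_eq)
  then show ?case
  proof cases
    case 1
    then show ?thesis using less.hyps[of "Suc x" y'] hex_word_push[of x y' N] less.prems by simp
  next
    case 2
    then show ?thesis using less.hyps[of "Suc y" x'] hex_word_push[of y x' N] hex_word_swap[OF less.prems] by simp
  next
    case 3
    then consider "x = 0" "y = 0" | "x = 0" "y = 1" | "x = 1" "y = 0" | "x = 1" "y = 1" by linarith
    then show ?thesis
    proof cases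
      case 1
      then show ?thesis using less.prems by (simp add: hex_word_def hex_side_def)
    next
      case 3
      then show ?thesis using t01 hex_word_swap[OF less.prems] by simp
    qed (use less.prems t01 t11 in simp)+
  qed
qed

text \<open>Three corners of five letters, one letter less for each of the \<open>A\<close>
  quadrangular ones, and three sides of equal length \<open>b\<close>: hence
  \<open>15 - A + 3 * b\<close>. The other \<open>3 - A\<close> corners contribute two pentagons
  each.\<close>

lemma reachable_cap:
  assumes "reachable (fives n) N" "A \<le> 3" "n = 15 - A + 3 * b"
  shows "reachable [6,6,6,6,6,6] (N + replicate_mset A 4 + replicate_mset (6 - 2 * A) 5)"
proof -
  let ?q = "fives 4 @ fives b" and ?p = "fives 5 @ fives b"
  have q: "rw ?q (hex_side 2 b) {#4#}"
    using rw_append[OF rw_quad_cap rw_refl[of "fives b"]] by (simp add: hex_side_def numeral_2_eq_2)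
  have p: "rw ?p (hex_side 2 b) {#5, 5#}"
    using rw_append[OF rw_pent_cap rw_refl[of "fives b"]] by (simp add: hex_side_def numeral_2_eq_2)
  have fin: "reachable [6,6,6,6,6,6] (N + M)" if "rw u (hex_word 2 b) M" "u = fives n" for u M
    using reachable_hex_word[of 2 b "N + M"] rw_reachable[OF that(1), of "[]" "[]" N] assms(1) that(2) by simp
  consider "A = 0" | "A = 1" | "A = 2" | "A = 3" using assms(2) by linarith
  then show ?thesis
  proof cases
    case 1
    have "?p @ ?p @ ?p = fives n" using 1 assms(3) by (simp flip: replicate_add)
    from fin[OF rw_append[OF p rw_append[OF p p], folded hex_word_def] this] 1 show ?thesis
      by (simp add: eval_nat_numeral)
  next
    case 2
    have "?q @ ?p @ ?p = fives n" using 2 assms(3) by (simp flip: replicate_add)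
    from fin[OF rw_append[OF q rw_append[OF p p], folded hex_word_def] this] 2 show ?thesis
      by (simp add: eval_nat_numeral add_mset_commute)
  next
    case 3
    have "?q @ ?q @ ?p = fives n" using 3 assms(3) by (simp flip: replicate_add)
    from fin[OF rw_append[OF q rw_append[OF q p], folded hex_word_def] this] 3 show ?thesis
      by (simp add: eval_nat_numeral add_mset_commute)
  next
    case 4
    have "?q @ ?q @ ?q = fives n" using 4 assms(3) by (simp flip: replicate_add)
    from fin[OF rw_append[OF q rw_append[OF q q], folded hex_word_def] this] 4 show ?thesis
      by (simp add: eval_nat_numeral)
  qed
qed

section \<open>Realising the face vector\<close>

lemma mset_map_Suc_pred:
  assumes "mset bs = mset (map (\<lambda>k. k - 1) ks)" "\<forall>k\<in>set ks. 6 \<le> k"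
  shows "mset (map Suc bs) = mset ks"
proof -
  have "mset (map Suc bs) = mset (map (Suc \<circ> (\<lambda>k. k - 1)) ks)" using assms(1) by (simp add: image_mset.compositionality)
  also have "map (Suc \<circ> (\<lambda>k. k - 1)) ks = ks" using assms(2) by (intro map_idI) auto
  finally show ?thesis .
qed

lemma non6_large: "\<forall>k\<in>set ks. 7 \<le> k \<Longrightarrow> non6 (mset ks) = mset ks"
  by (induction ks) auto

lemma non6_sixes: "non6 (mset (replicate c 6)) = {#}"
  by (induction c) auto

text \<open>As 2 is its own inverse modulo 3, \<open>c\<close> has to be congruent to
  \<open>2 * D + X\<close>. This holds for \<open>8 + r\<close> because 16 is congruent to -8, and
  the 8 ensures that \<open>2 * c\<close> is at least \<open>D\<close>.\<close>

lemma solve_mod_3: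
  fixes X D :: nat
  assumes "D \<le> 16"
  shows "\<exists>c b. 8 \<le> c \<and> X + 2 * c = D + 3 * b"
proof -
  define r where "r = (2 * D + X + 16) mod 3"
  have "(X + 2 * (8 + r)) mod 3 = (X + 16 + 2 * r) mod 3" by (simp add: add.assoc)
  also have "\<dots> = (X + 16 + 2 * (2 * D + X + 16)) mod 3"
    unfolding r_def by (metis mod_add_right_eq mod_mult_right_eq)
  also have "X + 16 + 2 * (2 * D + X + 16) = D + 3 * (D + X + 16)" by simp
  also have "\<dots> mod 3 = D mod 3" by (rule mod_mult_self2)
  finally have "(X + 2 * (8 + r)) mod 3 = D mod 3" .
  moreover have le: "D \<le> X + 2 * (8 + r)" using assms by simp
  ultimately have "3 dvd X + 2 * (8 + r) - D" by (simp add: mod_eq_dvd_iff_nat)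
  then obtain b where "X + 2 * (8 + r) - D = 3 * b" by blast
  then have "X + 2 * (8 + r) = D + 3 * b" using le by linarith
  then show ?thesis by (intro exI[of _ "8 + r"] exI[of _ b]) simp
qed

text \<open>At most three quadrangles are all supplied by the cap, so the fan part must close
  without any. A first ring disposes of the two letters 3, and a second one closes the letters 4
  that this creates.\<close>

lemma reachable_pentagons:
  assumes ks: "\<forall>k\<in>set ks. 7 \<le> k" and A: "A \<le> 3"
  shows "reachable [6,6,6,6,6,6]
    (mset ks + replicate_mset A 4 + replicate_mset (12 + (\<Sum>k\<leftarrow>ks. k - 6) - 2 * A) 5)"
proof -
  let ?S = "\<Sum>k\<leftarrow>ks. k - 6"
  have A16: "15 - A \<le> (16 :: nat)" by simp
  \<comment> \<open>The number \<open>c\<close> of spare hexagons gives the word after the first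
    ring the length that the cap needs. The 9 counts the letters that depend neither on
    \<open>ks\<close> nor on \<open>c\<close>.\<close>
  obtain c b where cb: "8 \<le> c" "(9 + 2 * length ks + ?S) + 2 * c = 15 - A + 3 * b"
    using solve_mod_3[OF A16, of "9 + 2 * length ks + ?S"] by blast
  then obtain c1 where c1: "c = Suc c1" by (cases c) auto
  define ks' where "ks' = ks @ replicate c 6"
  have ks': "\<forall>k\<in>set ks'. 6 \<le> k" using ks by (auto simp: ks'_def)
  obtain bs where bs: "mset bs = mset (map (\<lambda>k. k - 1) ks')"
    "reachable ([5] @ bs @ [3, 4] @ fan_word ks' @ [4, 3]) {#}"
    using reachable_fan_word[OF ks'] by blast
  have lbs: "length bs = length ks + c" using arg_cong[OF bs(1), of size] by (simp add: ks'_def)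
  have b5: "5 \<le> x" if "x \<in> set bs" for x
  proof -
    have "x \<in># mset (map (\<lambda>k. k - 1) ks')" using that bs(1) by (metis set_mset_mset)
    then show ?thesis using ks' by auto
  qed
  \<comment> \<open>Two private facets close a letter 3 as a hexagon instead of a quadrangle. The
    two letters 3 thus produce four letters 4, which become pentagons in the second ring.\<close>
  define m :: "nat \<Rightarrow> nat" where "m s = (if s = 3 then 2 else 0)" for s
  let ?xs = "[5] @ bs @ [3, 4] @ fan_word ks @ fives c1"
  have fw: "fan_word ks' = fan_word ks @ fives c1 @ [5]"
    by (simp add: ks'_def c1 replicate_append_same)
  have "reachable (([5] @ bs @ [3, 4] @ fan_word ks' @ [4]) @ [3]) {#}" using bs(2) by simp
  from reachable_append_commute[OF this]
  have "reachable (3 # ?xs @ [5, 4]) {#}" by (simp add: fw)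
  from reachable_ring[OF this, of m]
  have R: "reachable ([5, 5] @ concat (map (\<lambda>y. 5 # replicate (m y) 4) (3 # ?xs)))
     (non6 (mset (map (\<lambda>y. y + Suc (m y)) (3 # ?xs)) + {#6, 5#}))" (is "reachable ?Y ?N")
    by (simp del: mset_map map_append concat_append)
  have plain: "concat (map (\<lambda>y. 5 # replicate (m y) 4) L) = fives (length L)"
    "map (\<lambda>y. y + Suc (m y)) L = map Suc L" if "3 \<notin> set L" for L
    using that by (induction L) (auto simp: m_def)
  have n3: "3 \<notin> set bs" "3 \<notin> set (4 # fan_word ks @ fives c1)"
    using b5 set_fan_word[of ks] by fastforce+
  have x3: "3 # ?xs = [3] @ [5] @ bs @ [3] @ (4 # fan_word ks @ fives c1)" by simp
  have Y: "?Y = [5, 5, 5, 4, 4, 5] @ fives (length bs) @ [5, 4, 4] @ fives (length (4 # fan_word ks @ fives c1))"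
    unfolding x3 map_append concat_append plain(1)[OF n3(1)] plain(1)[OF n3(2)]
    by (simp add: m_def numeral_2_eq_2)
  have N: "?N = mset ks + replicate_mset (2 + ?S) 5"
  proof -
    have "non6 (mset (map Suc bs)) = mset ks"
      using mset_map_Suc_pred[OF bs(1) ks'] non6_large[OF ks] non6_sixes[of c] by (simp add: ks'_def)
    moreover have "non6 (mset (map Suc (4 # fan_word ks @ fives c1))) = replicate_mset (1 + ?S) 5"
    proof -
      have "count_list (fan_word ks) 3 = 0" using set_fan_word[of ks] by (auto simp: count_list_0_iff)
      then show ?thesis using set_fan_word[of ks]
        by (subst non6_Suc) (auto simp: count_list_append count_list_replicate count_fan_word)
    qed
    ultimately show ?thesis
      unfolding x3 map_append plain(2)[OF n3(1)] plain(2)[OF n3(2)] mset_append non6_simps(2)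
      by (simp add: m_def del: mset_map)
  qed
  have lY: "length ?Y = 15 - A + 3 * b"
    using cb(2) unfolding Y by (simp add: lbs length_fan_word c1)
  have "reachable (fives (length ?Y)) (?N + non6 (mset (map Suc ?Y)))"
    by (rule reachable_ring0[OF R]) simp
  moreover have "non6 (mset (map Suc ?Y)) = replicate_mset 4 5"
    unfolding Y by (subst non6_Suc) (auto simp: count_list_append count_list_replicate eval_nat_numeral)
  ultimately have "reachable (fives (15 - A + 3 * b)) (mset ks + replicate_mset (6 + ?S) 5)"
    unfolding lY N by (simp add: add.assoc numeral_eq_Suc)
  from reachable_cap[OF this A refl]
  have "reachable [6,6,6,6,6,6] (mset ks + replicate_mset (6 + ?S) 5 + replicate_mset A 4 + replicate_mset (6 - 2 * A) 5)" .
  moreover have "mset ks + replicate_mset (6 + ?S) 5 + replicate_mset A 4 + replicate_mset (6 - 2 * A) 5 =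
    mset ks + replicate_mset A 4 + replicate_mset (12 + ?S - 2 * A) 5"
    using A by (auto simp: multiset_eq_iff)
  ultimately show ?thesis by simp
qed

text \<open>The spare hexagons separate two groups of fans, and letters 4 are merged only within a
  group. So \<open>X'\<close> and \<open>Y'\<close> do not depend on \<open>c\<close>, and each
  spare hexagon adds exactly two letters. Of the quadrangles, 2 come from the letters 3 of the
  start, \<open>q1 + q2\<close> from merges and \<open>A\<close> from the cap.\<close>

lemma reachable_merged:
  assumes ks: "\<forall>k\<in>set (rest @ tail). 7 \<le> k" and A: "A \<le> 3"
    and q1: "2 * q1 \<le> 1 + (\<Sum>k\<leftarrow>rest. k - 6)" and q2: "2 * q2 \<le> 1 + (\<Sum>k\<leftarrow>tail. k - 6)"
  shows "reachable [6,6,6,6,6,6] (mset (rest @ tail) + replicate_mset (2 + q1 + q2 + A) 4 +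
    replicate_mset ((1 + (\<Sum>k\<leftarrow>rest. k - 6) - 2 * q1) + (1 + (\<Sum>k\<leftarrow>tail. k - 6) - 2 * q2) + (6 - 2 * A)) 5)"
proof -
  let ?X = "4 # fan_word rest" and ?Y = "fan_word tail @ [4]"
  obtain X' where X': "rw ?X X' {#}" "set X' \<subseteq> {3, 4, 5}" "count_list X' 3 = q1"
    "count_list X' 4 = 1 + (\<Sum>k\<leftarrow>rest. k - 6) - 2 * q1"
    using rw_merge_many[of ?X q1] q1 set_fan_word[of rest] by (auto simp: count_fan_word)
  obtain Y' where Y': "rw ?Y Y' {#}" "set Y' \<subseteq> {3, 4, 5}" "count_list Y' 3 = q2"
    "count_list Y' 4 = 1 + (\<Sum>k\<leftarrow>tail. k - 6) - 2 * q2"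
    using rw_merge_many[of ?Y q2] q2 set_fan_word[of tail] by (auto simp: count_fan_word count_list_append)
  have A16: "15 - A \<le> (16 :: nat)" by simp
  obtain c b where cb: "8 \<le> c" "(3 + length rest + length tail + length X' + length Y') + 2 * c = 15 - A + 3 * b"
    using solve_mod_3[OF A16, of "3 + length rest + length tail + length X' + length Y'"] by blast
  define ks' where "ks' = rest @ replicate c 6 @ tail"
  have "\<forall>k\<in>set rest. 7 \<le> k" "\<forall>k\<in>set tail. 7 \<le> k" using ks by simp_all
  then have ks': "\<forall>k\<in>set ks'. 6 \<le> k" by (auto simp: ks'_def)
  obtain bs where bs: "mset bs = mset (map (\<lambda>k. k - 1) ks')"
    "reachable ([5] @ bs @ [3, 4] @ fan_word ks' @ [4, 3]) {#}"
    using reachable_fan_word[OF ks'] by blast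
  have lbs: "length bs = length rest + length tail + c" using arg_cong[OF bs(1), of size] by (simp add: ks'_def)
  have "reachable (([5] @ bs @ [3]) @ (?X @ fives c @ ?Y) @ [3]) {#}" using bs(2) by (simp add: ks'_def)
  from rw_reachable[OF rw_append[OF X'(1) rw_append[OF rw_refl Y'(1)]] this]
  have R: "reachable ([5] @ bs @ ([3] @ X' @ fives c @ Y' @ [3])) {#}" (is "reachable ?W _") by simp
  have "reachable (fives (length ?W)) ({#} + non6 (mset (map Suc ?W)))"
    by (rule reachable_ring0[OF R]) simp
  moreover have "length ?W = 15 - A + 3 * b" using cb(2) lbs by simp
  moreover have "non6 (mset (map Suc ?W)) = mset (rest @ tail) + replicate_mset (2 + q1 + q2) 4 +
    replicate_mset ((1 + (\<Sum>k\<leftarrow>rest. k - 6) - 2 * q1) + (1 + (\<Sum>k\<leftarrow>tail. k - 6) - 2 * q2)) 5"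
  proof -
    have "non6 (mset (map Suc bs)) = mset (rest @ tail)"
      using mset_map_Suc_pred[OF bs(1) ks'] non6_large[OF ks] non6_sixes[of c] by (simp add: ks'_def)
    moreover have "non6 (mset (map Suc ([3] @ X' @ fives c @ Y' @ [3]))) = replicate_mset (2 + q1 + q2) 4 +
      replicate_mset ((1 + (\<Sum>k\<leftarrow>rest. k - 6) - 2 * q1) + (1 + (\<Sum>k\<leftarrow>tail. k - 6) - 2 * q2)) 5"
      using X' Y' by (subst non6_Suc) (auto simp: count_list_append count_list_replicate set_replicate_conv_if)
    ultimately show ?thesis
      unfolding map_append mset_append non6_simps(2) by (simp add: add.assoc)
  qed
  ultimately have "reachable (fives (15 - A + 3 * b)) (mset (rest @ tail) + replicate_mset (2 + q1 + q2) 4 +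
    replicate_mset ((1 + (\<Sum>k\<leftarrow>rest. k - 6) - 2 * q1) + (1 + (\<Sum>k\<leftarrow>tail. k - 6) - 2 * q2)) 5)"
    by (simp only: add_0)
  from reachable_cap[OF this A refl] show ?thesis
    by (rule back_subst[where P = "reachable _"]) (auto simp: multiset_eq_iff)
qed

text \<open>Here merges cross the spare hexagons, which therefore cannot adjust the residue. It is
  right nevertheless: the length of \<open>Z\<close> is congruent to \<open>2 * length ks\<close>,
  and the large facets contribute another \<open>length ks\<close>, so the total is divisible by
  3.\<close>

lemma reachable_even:
  assumes ks: "\<forall>k\<in>set ks. 7 \<le> k \<and> even k" and q: "2 * q = 2 + (\<Sum>k\<leftarrow>ks. k - 6)"
  shows "reachable [6,6,6,6,6,6] (mset ks + replicate_mset (5 + q) 4)"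
proof -
  \<comment> \<open>Twelve spare hexagons make the tube long enough for a cap with three
    quadrangles.\<close>
  define ks' where "ks' = ks @ replicate 12 6"
  have ks': "\<forall>k\<in>set ks'. 6 \<le> k" "\<forall>k\<in>set ks'. 6 \<le> k \<and> even k" using ks by (auto simp: ks'_def)
  obtain bs where bs: "mset bs = mset (map (\<lambda>k. k - 1) ks')"
    "reachable ([5] @ bs @ [3, 4] @ fan_word ks' @ [4, 3]) {#}"
    using reachable_fan_word[OF ks'(1)] by blast
  have lbs: "length bs = length ks + 12" using arg_cong[OF bs(1), of size] by (simp add: ks'_def)
  obtain Z where Z: "rw ([4] @ fives 0 @ fan_word ks' @ [4]) Z {#}" "set Z \<subseteq> {3, 5}"
    "2 * count_list Z 3 = 2 + (\<Sum>k\<leftarrow>ks'. k - 6)" "length Z mod 3 = (2 * 0 + 2 * length ks') mod 3"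
    using rw_merge_even[OF ks'(2)] by blast
  have cZ: "count_list Z 3 = q" "count_list Z 4 = 0"
    using Z(2,3) q by (auto simp: ks'_def sum_list_replicate count_list_0_iff)
  have "reachable (([5] @ bs @ [3]) @ ([4] @ fives 0 @ fan_word ks' @ [4]) @ [3]) {#}" using bs(2) by simp
  from rw_reachable[OF Z(1) this]
  have R: "reachable ([5] @ bs @ ([3] @ Z @ [3])) {#}" (is "reachable ?W _") by simp
  have "reachable (fives (length ?W)) ({#} + non6 (mset (map Suc ?W)))"
    by (rule reachable_ring0[OF R]) simp
  moreover have "\<exists>b. length ?W = 15 - 3 + 3 * b"
  proof -
    have "length Z mod 3 = (2 * length ks + 24) mod 3" using Z(4) by (simp add: ks'_def)
    then have "\<exists>b. 15 + length ks + length Z = 12 + 3 * b" by presburger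
    then show ?thesis using lbs by simp
  qed
  moreover have "non6 (mset (map Suc ?W)) = mset ks + replicate_mset (2 + q) 4"
  proof -
    have l: "\<forall>k\<in>set ks. 7 \<le> k" using ks by blast
    have "non6 (mset (map Suc bs)) = mset ks"
      using mset_map_Suc_pred[OF bs(1) ks'(1)] non6_large[OF l] non6_sixes[of 12] by (simp add: ks'_def)
    moreover have "non6 (mset (map Suc ([3] @ Z @ [3]))) = replicate_mset (2 + q) 4"
      using Z(2) cZ by (subst non6_Suc) (auto simp: count_list_append)
    ultimately show ?thesis
      unfolding map_append mset_append non6_simps(2) by simp
  qed
  ultimately obtain b where "reachable (fives (15 - 3 + 3 * b)) (mset ks + replicate_mset (2 + q) 4)"
    by (metis add_0)
  from reachable_cap[OF this order_refl refl] show ?thesis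
    by (rule back_subst[where P = "reachable _"]) (auto simp: multiset_eq_iff)
qed

text \<open>Beyond three quadrangles, two come from the letters 3 of the fan word, up to three from
  the cap and \<open>q\<close> from merges. If there are too few letters 4 in the first group for
  this, then no pentagons are wanted and every 4 must be merged: an odd facet, if present, yields
  two groups with an even number of letters 4, and otherwise \<open>reachable_even\<close>
  applies.\<close>

lemma reachable_all:
  assumes ks: "\<forall>k\<in>set ks. 7 \<le> k" and eq: "2 * p4 + p5 = 12 + (\<Sum>k\<leftarrow>ks. k - 6)"
  shows "reachable [6,6,6,6,6,6] (mset ks + replicate_mset p4 4 + replicate_mset p5 5)"
proof (cases "p4 \<le> 3")
  case True
  moreover have "p5 = 12 + (\<Sum>k\<leftarrow>ks. k - 6) - 2 * p4" using eq by simp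
  ultimately show ?thesis using reachable_pentagons[OF ks True] by simp
next
  case False
  let ?S = "\<Sum>k\<leftarrow>ks. k - 6"
  \<comment> \<open>The difference \<open>p4 - 2\<close> leaves room for the two quadrangles that
    the letters 3 produce.\<close>
  define A where "A = min 3 (p4 - 2)"
  define q where "q = p4 - A - 2"
  have A: "A \<le> 3" "p4 = 2 + q + A" using False by (auto simp: A_def q_def)
  show ?thesis
  proof (cases "2 * q \<le> 1 + ?S")
    case True
    \<comment> \<open>The separate summand 1 is the trailing letter 4, which stays unmerged as the
      second group has no fan.\<close>
    have "p5 = (1 + ?S - 2 * q) + 1 + (6 - 2 * A)" using eq A True by simp
    then show ?thesis using reachable_merged[of ks "[]" A q 0] ks A True by simp
  next
    case big: False
    have A3: "A = 3"
    proof (rule ccontr)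
      assume "A \<noteq> 3"
      then have "q = 0" by (auto simp: A_def q_def min_def split: if_splits)
      then show False using big by simp
    qed
    \<comment> \<open>With \<open>A = 3\<close> the face equation reads
      \<open>2 * q + p5 = 2 + ?S\<close>, and the left summand already exceeds
      \<open>1 + ?S\<close>.\<close>
    have q: "2 * q = 2 + ?S" "p5 = 0" using eq A big A3 by auto
    show ?thesis
    proof (cases "\<forall>k\<in>set ks. even k")
      case True
      then show ?thesis using reachable_even[of ks q] ks q A A3 by (simp add: add.commute)
    next
      case False
      then obtain l where l: "l \<in> set ks" "odd l" by blast
      define rest where "rest = remove1 l ks"
      have perm: "mset ks = mset (rest @ [l])" using l by (simp add: rest_def)
      have S: "?S = (\<Sum>k\<leftarrow>rest. k - 6) + (l - 6)"
      proof -
        have "?S = sum_mset (image_mset (\<lambda>k. k - 6) (mset ks))" by (simp flip: sum_mset_sum_list)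
        also have "\<dots> = (\<Sum>k\<leftarrow>rest. k - 6) + (l - 6)" unfolding perm by (simp flip: sum_mset_sum_list)
        finally show ?thesis .
      qed
      have set: "\<forall>k\<in>set (rest @ [l]). 7 \<le> k" using ks l by (auto simp: rest_def dest: notin_set_remove1)
      obtain r where r: "l = 2 * r + 1" using l(2) by (rule oddE)
      have "7 \<le> l" using ks l by blast
      \<comment> \<open>The second group is the fan of \<open>l\<close> with one boundary letter;
        its \<open>l - 5\<close> letters 4 form \<open>r - 2\<close> pairs.\<close>
      define q2 where "q2 = r - 2"
      define q1 where "q1 = q - q2"
      have 1: "2 * q2 = 1 + (l - 6)" using r \<open>7 \<le> l\<close> by (simp add: q2_def)
      have 2: "2 * q1 = 1 + (\<Sum>k\<leftarrow>rest. k - 6)" "q = q1 + q2" using q(1) S 1 by (auto simp: q1_def)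
      show ?thesis using reachable_merged[OF set A(1), of q1 q2] 1 2 A A3 q(2) by (simp add: perm add.assoc)
    qed
  qed
qed

text \<open>Leaving \<open>k = 6\<close> out of the conclusion expresses the free choice of the
  number of hexagons; finite support above 6 gives the sum its meaning.\<close>

theorem theorem3:
  fixes p :: "nat \<Rightarrow> nat"
  assumes fin: "finite {k. 7 \<le> k \<and> p k \<noteq> 0}"
    and p3: "p 3 = 0"
    and eq: "3 * p 3 + 2 * p 4 + p 5 = 12 + (\<Sum>k\<in>{k. 7 \<le> k \<and> p k \<noteq> 0}. (k - 6) * p k)"
  shows "\<exists>P. polytope3 P \<and> simple_polytope3 P \<and> flag_polytope3 P \<and>
             (\<forall>k. 3 \<le> k \<and> k \<noteq> 6 \<longrightarrow> pk P k = p k)"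
proof -
  define K where "K = {k. 7 \<le> k \<and> p k \<noteq> 0}"
  define L where "L = (\<Sum>k\<in>K. replicate_mset (p k) k)"
  have finK: "finite K" using fin by (simp add: K_def)
  have cL: "count L k = (if k \<in> K then p k else 0)" for k
    using finK by (auto simp: L_def count_sum sum.delta)
  obtain ks where ks: "mset ks = L" using ex_mset by blast
  have "7 \<le> k" if "k \<in> set ks" for k
  proof -
    have "0 < count L k" using that ks by (metis count_greater_zero_iff set_mset_mset)
    then show ?thesis by (auto simp: cL K_def split: if_splits)
  qed
  moreover have "(\<Sum>k\<leftarrow>ks. k - 6) = (\<Sum>k\<in>K. (k - 6) * p k)"
  proof -
    have "(\<Sum>k\<leftarrow>ks. k - 6) = sum_mset (image_mset (\<lambda>k. k - 6) L)" by (simp flip: ks sum_mset_sum_list)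
    also have "\<dots> = (\<Sum>k\<in>K. (k - 6) * p k)" unfolding L_def
      using finK by (induction K rule: finite_induct) (auto simp: mult.commute)
    finally show ?thesis .
  qed
  ultimately have "reachable [6,6,6,6,6,6] (L + replicate_mset (p 4) 4 + replicate_mset (p 5) 5)"
    using reachable_all[of ks "p 4" "p 5"] eq p3 by (simp add: ks K_def)
  then obtain j where r: "realized [6,6,6,6,6,6] (L + replicate_mset (p 4) 4 + replicate_mset (p 5) 5 + replicate_mset j 6)"
    (is "realized ?ws ?M") by (auto simp: reachable_def)
  have c: "count (?M + mset ?ws + {#length ?ws#}) k = p k" if k: "3 \<le> k" "k \<noteq> 6" for k
  proof -
    consider "7 \<le> k" | "k = 3" | "k = 4" | "k = 5" using k by linarith
    then show ?thesis by cases (use p3 in \<open>auto simp: cL K_def\<close>)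
  qed
  have "3 \<notin># ?M + mset ?ws + {#length ?ws#}"
    unfolding not_in_iff using c[of 3] p3 by (simp only:)
  from realized_polytope[OF r this] show ?thesis using c by auto
qed

end
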